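(* Let $\Omega\subset\mathbb{R}^n$ be a domain, $1\le p<\infty$ and $u\in W^{1,p}(\Omega,E)$. Then for a.e. $x\in\Omega$ the harmonic differential $D_\Delta u(x)$ of $u$ exists, $D_wu(x)=D_\Delta u(x)$, and $$D_wu(x)=\lim_{\varepsilon\to0^+}\frac1{\omega_n}\int_{S^{n-1}}\frac{u(x+\varepsilon\xi)-u(x)}{\varepsilon}\otimes\xi\,d\sigma(\xi)$$ for a.e. $x\in\Omega$ and in $L^p_{loc}(\Omega,\mathcal{L}(\mathbb{R}^n,E))$. Furthermore, for any elliptic first order operator $\mathcal{A}$, $$\mathcal{A}u(x)=\sum_{j=1}^n\mathbb{A}(x,e_j)D_wu(x)(e_j)+B(x)u(x)\qquad\text{for a.e. }x\in\Omega.$$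
   Context: $E,F$ are finite-dimensional real Euclidean vector spaces, $\mathcal{L}(V,W)$ the linear maps $V\to W$; for $a\in E,\ \xi\in\mathbb{R}^n$, $a\otimes\xi\in\mathcal{L}(\mathbb{R}^n,E)$ is $(a\otimes\xi)(\eta)=\langle\xi,\eta\rangle a$. $D_wu$ is the weak (distributional) total derivative. $\omega_n=|B_1(0)|$, and $\sigma$ is surface measure on $S^{n-1}$. For Sobolev $u$, the restriction of $u$ to spheres is understood in the trace sense; note that $\int_{S^{n-1}}\xi\,d\sigma=0$. Harmonic differential: $u$ has a harmonic differential at $x$ if there is $T_x\in\mathcal{L}(\mathbb{R}^n,E)$ with $$\operatorname*{ess\,lim}_{\varepsilon\to0^+}\frac1{\omega_n}\int_{S^{n-1}}\langle\xi,\eta\rangle\frac{u(x+\varepsilon\eta)-u(x)}{\varepsilon}\,d\sigma(\eta)=T_x(\xi)\quad\text{for all }\xi,$$ where ess lim means the limit along $\varepsilon$ outside a Lebesgue null set; one writes $T_x=D_\Delta u(x)$. $\mathcal{A}u=\sum_{j=1}^nA_j\partial_ju+Bu$ with $A_j,B\in C^\infty(\Omega,\mathcal{L}(E,F))$, and $\mathbb{A}(x,\xi)=\sum_j\xi_jA_j(x)$; $\mathcal{A}$ is elliptic if $\mathbb{A}(x,\xi)$ is injective for all $x\in\Omega$ and $\xi\in\mathbb{R}^n\setminus\{0\}$. $\mathcal{A}u$ is understood in the weak (distributional) sense; $e_1,\dots,e_n$ is the standard basis. *)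

theory Defs
  imports "HOL-Analysis.Analysis"
begin

text \<open>Bochner integrals of \<open>\<L>(\<real>\<^sup>n,E)\<close>-valued functions require this instance,
  which the library does not provide.\<close>

instance blinfun :: (euclidean_space, euclidean_space) second_countable_topology
proof
  have "\<exists>N :: ('a \<Rightarrow>\<^sub>L 'b) set. finite N \<and> cball 0 (real n) \<subseteq> (\<Union>x\<in>N. ball x (1 / real (Suc k)))"
    for n k :: nat
  proof -
    have "compact (cball (0 :: 'a \<Rightarrow>\<^sub>L 'b) (real n))" by (rule compact_cball)
    moreover have "0 < 1 / real (Suc k)" by simp
    ultimately show ?thesis
      unfolding compact_eq_totally_bounded by blast
  qed
  then obtain N :: "nat \<Rightarrow> nat \<Rightarrow> ('a \<Rightarrow>\<^sub>L 'b) set" where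
    N: "\<And>n k. finite (N n k)" "\<And>n k. cball 0 (real n) \<subseteq> (\<Union>x\<in>N n k. ball x (1 / real (Suc k)))"
    by metis
  define B where "B = (\<Union>n. \<Union>k. (\<lambda>x. ball x (1 / real (Suc k))) ` N n k)"
  have "countable B"
    unfolding B_def using N(1) by (intro countable_UN) (auto intro: countable_finite)
  moreover have "topological_basis B"
  proof (rule topological_basisI)
    show "open S" if "S \<in> B" for S using that by (auto simp: B_def)
    fix S :: "('a \<Rightarrow>\<^sub>L 'b) set" and f
    assume "open S" "f \<in> S"
    then obtain e where e: "e > 0" "ball f e \<subseteq> S" by (auto simp: open_contains_ball)
    obtain k where k: "1 / real (Suc k) < e / 2"
      using e(1) reals_Archimedean[of "e / 2"] by (auto simp: inverse_eq_divide)
    obtain n where "norm f \<le> real n" using real_arch_simple by blast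
    then have "f \<in> cball 0 (real n)" by simp
    then obtain x where x: "x \<in> N n k" "f \<in> ball x (1 / real (Suc k))"
      using N(2)[of n k] by blast
    have "ball x (1 / real (Suc k)) \<subseteq> ball f e"
    proof
      fix y assume y: "y \<in> ball x (1 / real (Suc k))"
      have "dist f y \<le> dist x f + dist x y" by (rule dist_triangle3)
      also have "\<dots> < e" using x(2) y k by simp
      finally show "y \<in> ball f e" by simp
    qed
    with x e(2) show "\<exists>B'\<in>B. f \<in> B' \<and> B' \<subseteq> S"
      unfolding B_def by blast
  qed
  ultimately show "\<exists>B :: ('a \<Rightarrow>\<^sub>L 'b) set set. countable B \<and> open = generate_topology B"
    by (blast intro: topological_basis_imp_subbasis)
qed

definition tensor :: "'e::real_normed_vector \<Rightarrow> 'a::real_inner \<Rightarrow> ('a \<Rightarrow>\<^sub>L 'e)"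
  where "tensor a \<xi> = Blinfun (\<lambda>\<eta>. (\<xi> \<bullet> \<eta>) *\<^sub>R a)"


section \<open>Smooth functions and test functions\<close>

primrec Ck_on :: "nat \<Rightarrow> (real^'n \<Rightarrow> 'b::real_normed_vector) \<Rightarrow> (real^'n) set \<Rightarrow> bool" where
  "Ck_on 0 f S \<longleftrightarrow> continuous_on S f"
| "Ck_on (Suc k) f S \<longleftrightarrow> (\<forall>x\<in>S. f differentiable (at x)) \<and>
     (\<forall>j. Ck_on k (\<lambda>x. frechet_derivative f (at x) (axis j 1)) S)"

text \<open>Meant for open \<open>S\<close>.\<close>

definition smooth_on :: "(real^'n \<Rightarrow> 'b::real_normed_vector) \<Rightarrow> (real^'n) set \<Rightarrow> bool"
  where "smooth_on f S \<longleftrightarrow> (\<forall>k. Ck_on k f S)"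

definition test_function :: "(real^'n) set \<Rightarrow> (real^'n \<Rightarrow> real) \<Rightarrow> bool"
  where "test_function \<Omega> \<phi> \<longleftrightarrow> smooth_on \<phi> UNIV \<and>
    (\<exists>K. compact K \<and> K \<subseteq> \<Omega> \<and> (\<forall>x. x \<notin> K \<longrightarrow> \<phi> x = 0))"


section \<open>Weak derivatives and Sobolev functions\<close>

text \<open>Elements of Lebesgue and Sobolev spaces are represented by functions on all of \<open>\<real>\<^sup>n\<close>,
  of which only the values on the given set matter.\<close>

definition Lp_on :: "real \<Rightarrow> (real^'n) set \<Rightarrow> (real^'n \<Rightarrow> 'b::real_normed_vector) \<Rightarrow> bool"
  where "Lp_on p S f \<longleftrightarrow> f \<in> borel_measurable (lebesgue_on S) \<and>
    integrable (lebesgue_on S) (\<lambda>x. norm (f x) powr p)"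

definition L1_loc :: "(real^'n) set \<Rightarrow> (real^'n \<Rightarrow> 'b::real_normed_vector) \<Rightarrow> bool"
  where "L1_loc \<Omega> f \<longleftrightarrow> (\<forall>K. compact K \<and> K \<subseteq> \<Omega> \<longrightarrow> Lp_on 1 K f)"

definition has_weak_derivative ::
  "(real^'n) set \<Rightarrow> (real^'n \<Rightarrow> 'e::euclidean_space) \<Rightarrow> (real^'n \<Rightarrow> ((real^'n) \<Rightarrow>\<^sub>L 'e)) \<Rightarrow> bool"
  where "has_weak_derivative \<Omega> u D \<longleftrightarrow> L1_loc \<Omega> u \<and> L1_loc \<Omega> D \<and>
    (\<forall>\<phi> j. test_function \<Omega> \<phi> \<longrightarrow>
      (LINT x|lebesgue_on \<Omega>. frechet_derivative \<phi> (at x) (axis j 1) *\<^sub>R u x) =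
      - (LINT x|lebesgue_on \<Omega>. \<phi> x *\<^sub>R D x (axis j 1)))"

definition sobolev1 :: "real \<Rightarrow> (real^'n) set \<Rightarrow> (real^'n \<Rightarrow> 'e::euclidean_space) \<Rightarrow> bool"
  where "sobolev1 p \<Omega> u \<longleftrightarrow> Lp_on p \<Omega> u \<and> (\<exists>D. has_weak_derivative \<Omega> u D \<and> Lp_on p \<Omega> D)"


section \<open>Surface measure and traces on spheres\<close>

text \<open>The surface measure of \<open>A \<subseteq> S\<^sup>n\<^sup>-\<^sup>1\<close> is \<open>n\<close> times the volume of the cone
  \<open>{t \<eta> | 0 < t < 1, \<eta> \<in> A}\<close>, which is the preimage of \<open>A\<close> under \<open>y \<mapsto> y / \<bar>y\<bar>\<close> in the
  punctured unit ball.\<close>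

definition sphere_measure :: "(real^'n) measure"
  where "sphere_measure = scale_measure (of_nat CARD('n))
    (distr (restrict_space lborel (ball 0 1 - {0})) (restrict_space borel (sphere 0 1)) sgn)"

text \<open>The trace of \<open>u\<close> on the sphere of radius \<open>r\<close> about \<open>x\<close>, as a function of
  \<open>\<eta> \<in> S\<^sup>n\<^sup>-\<^sup>1\<close>: the continuous extension to \<open>W\<^sup>1\<^sup>,\<^sup>1\<close> of the ball of the restriction of functions
  that are smooth up to the boundary. On a ball \<open>W\<^sup>1\<^sup>,\<^sup>p \<subseteq> W\<^sup>1\<^sup>,\<^sup>1\<close> for all \<open>p \<ge> 1\<close>, and the traces
  agree.\<close>

definition has_sphere_trace ::
  "(real^'n \<Rightarrow> 'e::euclidean_space) \<Rightarrow> real^'n \<Rightarrow> real \<Rightarrow> (real^'n \<Rightarrow> 'e) \<Rightarrow> bool"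
  where "has_sphere_trace u x r g \<longleftrightarrow> 0 < r \<and> sobolev1 1 (ball x r) u \<and> integrable sphere_measure g \<and>
    (\<exists>D v. has_weak_derivative (ball x r) u D \<and> (\<forall>k. smooth_on (v k) UNIV) \<and>
      (\<lambda>k::nat. LINT y|lebesgue_on (ball x r). norm (v k y - u y)) \<longlonglongrightarrow> 0 \<and>
      (\<lambda>k. LINT y|lebesgue_on (ball x r).
        norm (Blinfun (frechet_derivative (v k) (at y)) - D y)) \<longlonglongrightarrow> 0 \<and>
      (\<lambda>k. LINT \<eta>|sphere_measure. norm (v k (x + r *\<^sub>R \<eta>) - g \<eta>)) \<longlonglongrightarrow> 0)"

text \<open>Unique up to null sets of the sphere.\<close>

definition sphere_trace ::
  "(real^'n \<Rightarrow> 'e::euclidean_space) \<Rightarrow> real^'n \<Rightarrow> real \<Rightarrow> real^'n \<Rightarrow> 'e"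
  where "sphere_trace u x r = (SOME g. has_sphere_trace u x r g)"


section \<open>Harmonic differential\<close>

text \<open>The essential limit is the limit along the positive \<open>\<epsilon>\<close> outside of a null set \<open>N\<close>. The
  requirement that the traces exist makes the integrals meaningful.\<close>

definition has_harmonic_differential ::
  "(real^'n \<Rightarrow> 'e::euclidean_space) \<Rightarrow> real^'n \<Rightarrow> ((real^'n) \<Rightarrow>\<^sub>L 'e) \<Rightarrow> bool"
  where "has_harmonic_differential u x T \<longleftrightarrow> (\<forall>\<xi>. \<exists>N\<in>null_sets lebesgue.
    (\<forall>\<^sub>F \<epsilon> in at 0 within {0<..} - N. \<exists>g. has_sphere_trace u x \<epsilon> g) \<and>
    ((\<lambda>\<epsilon>. (1 / measure lborel (ball (0::real^'n) 1)) *\<^sub>R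
        (LINT \<eta>|sphere_measure. (\<xi> \<bullet> \<eta>) *\<^sub>R ((sphere_trace u x \<epsilon> \<eta> - u x) /\<^sub>R \<epsilon>)))
      \<longlongrightarrow> T \<xi>) (at 0 within {0<..} - N))"

lemma has_harmonic_differential_unique:
  assumes "has_harmonic_differential u x T" "has_harmonic_differential u x T'"
  shows "T = T'"
proof (rule blinfun_eqI)
  fix \<xi>
  define M where "M \<epsilon> = (1 / measure lborel (ball (0::real^'a) 1)) *\<^sub>R
    (LINT \<eta>|sphere_measure. (\<xi> \<bullet> \<eta>) *\<^sub>R ((sphere_trace u x \<epsilon> \<eta> - u x) /\<^sub>R \<epsilon>))" for \<epsilon>
  obtain N where N: "N \<in> null_sets lebesgue" "(M \<longlongrightarrow> T \<xi>) (at 0 within {0<..} - N)"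
    using assms(1) unfolding has_harmonic_differential_def M_def by blast
  obtain N' where N': "N' \<in> null_sets lebesgue" "(M \<longlongrightarrow> T' \<xi>) (at 0 within {0<..} - N')"
    using assms(2) unfolding has_harmonic_differential_def M_def by blast
  define L where "L = N \<union> N'"
  have L: "L \<in> null_sets lebesgue" unfolding L_def using N(1) N'(1) by blast
  have "0 islimpt ({0<..} - L)"
    unfolding islimpt_approachable
  proof (intro allI impI)
    fix e :: real assume "e > 0"
    have "\<not> {0<..<e} \<subseteq> L"
    proof
      assume "{0<..<e} \<subseteq> L"
      then have "negligible {0<..<e}"
        using L negligible_iff_null_sets negligible_subset by blast
      with \<open>e > 0\<close> show False using open_not_negligible[of "{0<..<e}"] by simp
    qed
    then obtain \<epsilon> where "\<epsilon> \<in> {0<..<e}" "\<epsilon> \<notin> L" by blast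
    then show "\<exists>\<epsilon>\<in>{0<..} - L. \<epsilon> \<noteq> 0 \<and> dist \<epsilon> 0 < e" by (intro bexI[of _ \<epsilon>]) auto
  qed
  then have "at 0 within {0<..} - L \<noteq> bot" by (simp add: trivial_limit_within)
  moreover have "(M \<longlongrightarrow> T \<xi>) (at 0 within {0<..} - L)"
    by (rule tendsto_within_subset[OF N(2)]) (auto simp: L_def)
  moreover have "(M \<longlongrightarrow> T' \<xi>) (at 0 within {0<..} - L)"
    by (rule tendsto_within_subset[OF N'(2)]) (auto simp: L_def)
  ultimately show "T \<xi> = T' \<xi>" by (rule tendsto_unique)
qed

definition sphere_difference_mean ::
  "(real^'n \<Rightarrow> 'e::euclidean_space) \<Rightarrow> real \<Rightarrow> real^'n \<Rightarrow> ((real^'n) \<Rightarrow>\<^sub>L 'e)"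
  where "sphere_difference_mean u \<epsilon> x = (1 / measure lborel (ball (0::real^'n) 1)) *\<^sub>R
    (LINT \<xi>|sphere_measure. tensor ((sphere_trace u x \<epsilon> \<xi> - u x) /\<^sub>R \<epsilon>) \<xi>)"

text \<open>\<open>f \<epsilon>\<close> need only be \<open>p\<close>-integrable on a given compact set for small \<open>\<epsilon>\<close>.\<close>

definition tendsto_Lp_loc :: "real \<Rightarrow> (real^'n) set \<Rightarrow>
  ('i \<Rightarrow> real^'n \<Rightarrow> 'b::real_normed_vector) \<Rightarrow> (real^'n \<Rightarrow> 'b) \<Rightarrow> 'i filter \<Rightarrow> bool"
  where "tendsto_Lp_loc p \<Omega> f g F \<longleftrightarrow> (\<forall>K. compact K \<and> K \<subseteq> \<Omega> \<longrightarrow>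
    Lp_on p K g \<and> (\<forall>\<^sub>F \<epsilon> in F. Lp_on p K (f \<epsilon>)) \<and>
    ((\<lambda>\<epsilon>. LINT x|lebesgue_on K. norm (f \<epsilon> x - g x) powr p) \<longlongrightarrow> 0) F)"


section \<open>First order operators\<close>

definition op_symbol ::
  "('n::finite \<Rightarrow> real^'n \<Rightarrow> ('e::euclidean_space \<Rightarrow>\<^sub>L 'f::euclidean_space)) \<Rightarrow>
    real^'n \<Rightarrow> real^'n \<Rightarrow> ('e \<Rightarrow>\<^sub>L 'f)"
  where "op_symbol A x \<xi> = (\<Sum>j\<in>UNIV. (\<xi> $ j) *\<^sub>R A j x)"

definition elliptic_operator :: "(real^'n) set \<Rightarrow>
  ('n \<Rightarrow> real^'n \<Rightarrow> ('e::euclidean_space \<Rightarrow>\<^sub>L 'f::euclidean_space)) \<Rightarrow>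
  (real^'n \<Rightarrow> ('e \<Rightarrow>\<^sub>L 'f)) \<Rightarrow> bool"
  where "elliptic_operator \<Omega> A B \<longleftrightarrow> (\<forall>j. smooth_on (A j) \<Omega>) \<and> smooth_on B \<Omega> \<and>
    (\<forall>x\<in>\<Omega>. \<forall>\<xi>. \<xi> \<noteq> 0 \<longrightarrow> inj (blinfun_apply (op_symbol A x \<xi>)))"

text \<open>\<open>f\<close> represents the distribution \<open>\<Sum>\<^sub>j A\<^sub>j \<partial>\<^sub>j u + B u\<close>, whose value at \<open>\<phi>\<close> is
  \<open>- \<Sum>\<^sub>j \<integral> \<partial>\<^sub>j (\<phi> A\<^sub>j) u + \<integral> \<phi> B u\<close>.\<close>

definition has_weak_image :: "(real^'n) set \<Rightarrow>
  ('n \<Rightarrow> real^'n \<Rightarrow> ('e::euclidean_space \<Rightarrow>\<^sub>L 'f::euclidean_space)) \<Rightarrow>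
  (real^'n \<Rightarrow> ('e \<Rightarrow>\<^sub>L 'f)) \<Rightarrow> (real^'n \<Rightarrow> 'e) \<Rightarrow> (real^'n \<Rightarrow> 'f) \<Rightarrow> bool"
  where "has_weak_image \<Omega> A B u f \<longleftrightarrow> L1_loc \<Omega> f \<and> (\<forall>\<phi>. test_function \<Omega> \<phi> \<longrightarrow>
    (LINT x|lebesgue_on \<Omega>. \<phi> x *\<^sub>R f x) =
    - (\<Sum>j\<in>UNIV. LINT x|lebesgue_on \<Omega>.
        (frechet_derivative (\<lambda>y. \<phi> y *\<^sub>R A j y) (at x) (axis j 1)) (u x)) +
    (LINT x|lebesgue_on \<Omega>. \<phi> x *\<^sub>R B x (u x)))"

end

theory Submission
  imports Defs
begin

text \<open>The theorem rests on one identity. If \<open>u\<close> is smooth near the closed ball of radius \<open>\<epsilon>\<close> about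
  \<open>x\<close>, the divergence theorem gives
  \<open>\<integral> \<eta>\<^sub>j u(x + \<epsilon> \<eta>) d\<sigma>(\<eta>) = \<epsilon> / \<epsilon> ^ n * \<integral> \<partial>\<^sub>j u\<close>, where the first integral is over the unit sphere
  and the second over the ball. The coordinates have mean zero on the sphere, so the constant \<open>u(x)\<close>
  can be subtracted under the integral; dividing by \<open>\<epsilon>\<close> and by the volume of the unit ball, the
  spherical mean of the difference quotients turns out to be equal to the mean of the derivative
  over the ball. Both sides are continuous under the approximation that defines the trace, so the
  identity holds for Sobolev functions with the weak derivative on the right
  (\<open>trace_divergence\<close>, \<open>sphere_difference_mean_eq\<close>). Hence harmonic differentiability is
  Lebesgue differentiation of the weak derivative, and the convergence in \<open>L\<^sup>p\<^sub>l\<^sub>o\<^sub>c\<close> is the convergence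
  of means over balls.

  The analytic tools are built as follows. Lebesgue's differentiation theorem comes from density
  of continuous functions in \<open>L\<^sup>1\<close> and Vitali's covering lemma (\<open>Lebesgue_differentiation\<close>). It
  gives almost everywhere convergence of approximate identities. Convergence in \<open>L\<^sup>p\<close> then follows from
  Jensen's inequality and a form of dominated convergence with varying bound (\<open>mollify_Lp\<close>).
  Surface measure is given by cones, so a spherical integral is \<open>n\<close> times the integral
  over the ball of a function that is constant along rays. The divergence theorem
  (\<open>divergence_unit_ball\<close>) is obtained from this by integrating by parts against a radial cutoff that
  decays linearly in a thin shell and letting the thickness of the shell tend to 0. Applied to the
  vector field \<open>norm (v y) *\<^sub>R y\<close> it yields the trace inequality, and with mollification of \<open>u\<close>
  the existence of traces on all spheres that bound a closed ball inside the domain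
  (\<open>has_sphere_trace_exists\<close>).

  The formula for operators is a product rule for weak derivatives. Multiplying test functions by
  the entries of the smooth coefficients gives test functions again, so the distribution that defines
  the operator is represented by the pointwise expression (\<open>has_weak_image_first_order\<close>), and
  the fundamental lemma of the calculus of variations shows that the representative is unique almost
  everywhere.\<close>

section \<open>Affine substitutions\<close>

lemma lebesgue_affine:
  fixes t :: "'a::euclidean_space"
  assumes "c \<noteq> 0"
  shows "lebesgue = density (distr lebesgue lebesgue (\<lambda>x. t + c *\<^sub>R x)) (\<lambda>_. \<bar>c\<bar>^DIM('a))"
    and measurable_lebesgue_affine: "(\<lambda>x. t + c *\<^sub>R x) \<in> lebesgue \<rightarrow>\<^sub>M lebesgue"
proof -
  have T: "(\<lambda>x. t + (\<Sum>j\<in>Basis. (c * (x \<bullet> j)) *\<^sub>R j)) = (\<lambda>x. t + c *\<^sub>R x)"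
    unfolding scaleR_scaleR[symmetric] scaleR_sum_right[symmetric] euclidean_representation ..
  show "lebesgue = density (distr lebesgue lebesgue (\<lambda>x. t + c *\<^sub>R x)) (\<lambda>_. \<bar>c\<bar>^DIM('a))"
    by (rule lebesgue_affine_euclidean[where c="\<lambda>_::'a. c" and t=t, unfolded T prod_constant]) (rule assms)
  show "(\<lambda>x. t + c *\<^sub>R x) \<in> lebesgue \<rightarrow>\<^sub>M lebesgue"
    by (rule lebesgue_affine_measurable[where c="\<lambda>_::'a. c" and t=t, unfolded T]) (rule assms)
qed

lemma integrable_lebesgue_affine:
  fixes f :: "'a::euclidean_space \<Rightarrow> 'b::{banach, second_countable_topology}"
  assumes f: "integrable lebesgue f" and c: "c \<noteq> 0"
  shows "integrable lebesgue (\<lambda>x. f (t + c *\<^sub>R x))"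
proof -
  have m [measurable]: "(\<lambda>x. t + c *\<^sub>R x) \<in> lebesgue \<rightarrow>\<^sub>M lebesgue"
    by (rule measurable_lebesgue_affine[OF c])
  have fm [measurable]: "f \<in> borel_measurable lebesgue" using f by simp
  have "integrable (density (distr lebesgue lebesgue (\<lambda>x. t + c *\<^sub>R x)) (\<lambda>_. ennreal (\<bar>c\<bar>^DIM('a)))) f"
    using f by (subst lebesgue_affine(1)[OF c, of t, symmetric])
  then have "integrable (distr lebesgue lebesgue (\<lambda>x. t + c *\<^sub>R x)) (\<lambda>x. (\<bar>c\<bar>^DIM('a)) *\<^sub>R f x)"
    by (subst (asm) integrable_density) auto
  then have "integrable (distr lebesgue lebesgue (\<lambda>x. t + c *\<^sub>R x))
      (\<lambda>x. (1 / \<bar>c\<bar>^DIM('a)) *\<^sub>R (\<bar>c\<bar>^DIM('a)) *\<^sub>R f x)"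
    by (rule integrable_scaleR_right)
  then have "integrable (distr lebesgue lebesgue (\<lambda>x. t + c *\<^sub>R x)) f"
    using c by simp
  then show ?thesis
    by (subst (asm) integrable_distr_eq) simp_all
qed

lemma integrable_lebesgue_affine_iff:
  fixes f :: "'a::euclidean_space \<Rightarrow> 'b::{banach, second_countable_topology}"
  assumes c: "c \<noteq> 0"
  shows "integrable lebesgue (\<lambda>x. f (t + c *\<^sub>R x)) \<longleftrightarrow> integrable lebesgue f"
proof
  assume "integrable lebesgue (\<lambda>x. f (t + c *\<^sub>R x))"
  then have "integrable lebesgue (\<lambda>x. f (t + c *\<^sub>R ((- t /\<^sub>R c) + (1/c) *\<^sub>R x)))"
    by (rule integrable_lebesgue_affine) (use c in simp)
  then show "integrable lebesgue f" using c by (simp add: scaleR_add_right scaleR_diff_right)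
qed (use c integrable_lebesgue_affine in auto)

lemma integral_lebesgue_affine:
  fixes f :: "'a::euclidean_space \<Rightarrow> 'b::{banach, second_countable_topology}"
  assumes c: "c \<noteq> 0"
  shows "(LINT x|lebesgue. f x) = \<bar>c\<bar>^DIM('a) *\<^sub>R (LINT x|lebesgue. f (t + c *\<^sub>R x))"
proof (cases "integrable lebesgue f")
  case True
  have m [measurable]: "(\<lambda>x. t + c *\<^sub>R x) \<in> lebesgue \<rightarrow>\<^sub>M lebesgue"
    by (rule measurable_lebesgue_affine[OF c])
  have fm [measurable]: "f \<in> borel_measurable lebesgue" using True by simp
  have "(LINT x|lebesgue. f x) =
    integral\<^sup>L (density (distr lebesgue lebesgue (\<lambda>x. t + c *\<^sub>R x)) (\<lambda>_. ennreal (\<bar>c\<bar>^DIM('a)))) f"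
    by (subst lebesgue_affine(1)[OF c, of t, symmetric]) rule
  also have "\<dots> = (LINT x|distr lebesgue lebesgue (\<lambda>x. t + c *\<^sub>R x). \<bar>c\<bar>^DIM('a) *\<^sub>R f x)"
    by (subst integral_density) auto
  also have "\<dots> = \<bar>c\<bar>^DIM('a) *\<^sub>R (LINT x|lebesgue. f (t + c *\<^sub>R x))"
    by (subst integral_distr) auto
  finally show ?thesis .
next
  case False
  then show ?thesis using integrable_lebesgue_affine_iff[OF c, of f t] by (simp add: not_integrable_integral_eq)
qed

lemma integrable_indicator_scaleR:
  fixes f :: "'a::euclidean_space \<Rightarrow> 'b::{banach, second_countable_topology}"
  assumes "integrable M f" "A \<in> sets M"
  shows "integrable M (\<lambda>x. indicator A x *\<^sub>R f x)"
  using assms integrable_mult_indicator by blast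

section \<open>Density of continuous functions\<close>

definition L1_approximable :: "('a::euclidean_space \<Rightarrow> 'b::{banach, second_countable_topology}) \<Rightarrow> bool"
  where "L1_approximable f \<longleftrightarrow> (\<forall>e>0. \<exists>g. continuous_on UNIV g \<and> integrable lebesgue g \<and>
    (LINT x|lebesgue. norm (f x - g x)) < e)"

lemma integral_norm_triangle:
  assumes "integrable M f" "integrable M g" "integrable M h"
  shows "(LINT x|M. norm (f x - h x :: 'b::{banach, second_countable_topology}))
    \<le> (LINT x|M. norm (f x - g x)) + (LINT x|M. norm (g x - h x))"
proof -
  have "(LINT x|M. norm (f x - h x)) \<le> (LINT x|M. norm (f x - g x) + norm (g x - h x))"
    using assms by (intro integral_mono) (auto intro: norm_triangle_ineq[of "f x - g x" "g x - h x" for x, simplified])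
  also have "\<dots> = (LINT x|M. norm (f x - g x)) + (LINT x|M. norm (g x - h x))"
    using assms by (intro Bochner_Integration.integral_add) auto
  finally show ?thesis .
qed

lemma L1_approximable_limit:
  assumes f: "integrable lebesgue f" and s: "\<And>i. integrable lebesgue (s i)" "\<And>i. L1_approximable (s i)"
    and lim: "(\<lambda>i. LINT x|lebesgue. norm (f x - s i x)) \<longlonglongrightarrow> 0"
  shows "L1_approximable f"
  unfolding L1_approximable_def
proof (intro allI impI)
  fix e :: real assume "e > 0"
  then have "e / 2 > 0" by simp
  then have "\<forall>\<^sub>F i in sequentially. (LINT x|lebesgue. norm (f x - s i x)) < e / 2"
    by (rule order_tendstoD(2)[OF lim])
  then obtain i where i: "(LINT x|lebesgue. norm (f x - s i x)) < e / 2"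
    using eventually_happens sequentially_bot by blast
  obtain g where g: "continuous_on UNIV g" "integrable lebesgue g"
    "(LINT x|lebesgue. norm (s i x - g x)) < e / 2"
    using s(2)[of i] \<open>e / 2 > 0\<close> unfolding L1_approximable_def by blast
  have "(LINT x|lebesgue. norm (f x - g x)) < e"
    using integral_norm_triangle[OF f s(1)[of i] g(2)] i g(3) by linarith
  with g show "\<exists>g. continuous_on UNIV g \<and> integrable lebesgue g \<and> (LINT x|lebesgue. norm (f x - g x)) < e"
    by blast
qed

text \<open>The functions \<open>min 1 (i * infdist x (- U))\<close> are continuous and increase to the indicator of
  \<open>U\<close>; this is where openness enters, since the distance to the complement is then positive
  on \<open>U\<close>.\<close>

lemma L1_approximable_open:
  fixes U :: "'a::euclidean_space set" and c :: "'b::{banach, second_countable_topology}"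
  assumes U: "open U" "emeasure lebesgue U < \<infinity>"
  shows "L1_approximable (\<lambda>x. indicator U x *\<^sub>R c)"
proof (cases "U = UNIV")
  case True
  then show ?thesis using U by simp
next
  case False
  then have ne: "- U \<noteq> {}" by auto
  have Us: "U \<in> sets lebesgue" using U(1) by simp
  define s where "s i x = min 1 (real i * infdist x (- U)) *\<^sub>R c" for i x
  have cont: "continuous_on UNIV (s i)" for i unfolding s_def by (intro continuous_intros)
  have meas: "s i \<in> borel_measurable lebesgue" for i
    using cont by (simp add: borel_measurable_continuous_onI measurable_completion)
  have Uc: "integrable lebesgue (\<lambda>x. indicator U x *\<^sub>R c)"
    using U Us by (intro integrable_scaleR_left integrable_real_indicator) auto
  have bd: "norm (s i x) \<le> norm (indicator U x *\<^sub>R c)" for i x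
  proof (cases "x \<in> U")
    case True
    have "\<bar>min 1 (real i * infdist x (- U))\<bar> \<le> 1" using mult_nonneg_nonneg[OF of_nat_0_le_iff[of i] infdist_nonneg[of x "-U"]] by linarith
    then show ?thesis using True by (auto simp: s_def mult_left_le_one_le)
  next
    case False
    then have "infdist x (- U) = 0" by simp
    then show ?thesis using False by (simp add: s_def)
  qed
  have si: "integrable lebesgue (s i)" for i
    by (rule Bochner_Integration.integrable_bound[OF Uc meas]) (use bd in auto)
  have conv: "(\<lambda>i. s i x) \<longlonglongrightarrow> indicator U x *\<^sub>R c" for x
  proof (cases "x \<in> U")
    case True
    then have "infdist x (- U) > 0"
      using U(1) ne in_closed_iff_infdist_zero[of "- U" x] infdist_nonneg[of x "-U"] by (auto simp: order_less_le)
    then obtain N :: nat where N: "1 / infdist x (- U) \<le> real N" using real_arch_simple by blast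
    have "s i x = c" if "i \<ge> N" for i
    proof -
      have "1 / infdist x (- U) \<le> real i" using N that by linarith
      then have "1 \<le> real i * infdist x (- U)" using \<open>infdist x (- U) > 0\<close> by (simp add: divide_le_eq)
      then show ?thesis by (simp add: s_def)
    qed
    then show ?thesis using True by (intro tendsto_eventually eventually_sequentiallyI[of N]) simp
  next
    case False
    then have "infdist x (- U) = 0" by simp
    then show ?thesis using False by (simp add: s_def)
  qed
  have "(\<lambda>i. LINT x|lebesgue. norm (indicator U x *\<^sub>R c - s i x)) \<longlonglongrightarrow> (LINT x|(lebesgue :: 'a measure). 0)"
  proof (rule integral_dominated_convergence[where w="\<lambda>x. 2 * norm (indicator U x *\<^sub>R c)"])
    show "AE x in lebesgue. (\<lambda>i. norm (indicator U x *\<^sub>R c - s i x)) \<longlonglongrightarrow> 0"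
    proof (rule AE_I2)
      fix x
      have "(\<lambda>i. norm (indicator U x *\<^sub>R c - s i x)) \<longlonglongrightarrow> norm (indicator U x *\<^sub>R c - indicator U x *\<^sub>R c)"
        by (intro tendsto_intros conv)
      then show "(\<lambda>i. norm (indicator U x *\<^sub>R c - s i x)) \<longlonglongrightarrow> 0" by simp
    qed
    show "AE x in lebesgue. norm (norm (indicator U x *\<^sub>R c - s i x)) \<le> 2 * norm (indicator U x *\<^sub>R c)" for i
    proof (rule AE_I2)
      fix x show "norm (norm (indicator U x *\<^sub>R c - s i x)) \<le> 2 * norm (indicator U x *\<^sub>R c)"
        using norm_triangle_ineq4[of "indicator U x *\<^sub>R c" "s i x"] bd[of i x] by simp
    qed
    show "(\<lambda>x. norm (indicator U x *\<^sub>R c - s i x)) \<in> borel_measurable lebesgue" for i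
      by (rule borel_measurable_integrable[OF integrable_norm[OF Bochner_Integration.integrable_diff[OF Uc si]]])
    show "integrable lebesgue (\<lambda>x. 2 * norm (indicator U x *\<^sub>R c))"
      by (intro integrable_mult_right integrable_norm Uc)
  qed simp
  then have "(\<lambda>i. LINT x|lebesgue. norm (indicator U x *\<^sub>R c - s i x)) \<longlonglongrightarrow> 0" by simp
  moreover have "L1_approximable (s i)" for i
    unfolding L1_approximable_def using cont[of i] si[of i] by (intro allI impI exI[of _ "s i"]) auto
  ultimately show ?thesis by (intro L1_approximable_limit[OF Uc si])
qed

text \<open>Outer regularity of Lebesgue measure reduces a set of finite measure to the open case.\<close>

lemma L1_approximable_indicator:
  fixes A :: "'a::euclidean_space set" and c :: "'b::{banach, second_countable_topology}"
  assumes A: "A \<in> sets lebesgue" "emeasure lebesgue A < \<infinity>"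
  shows "L1_approximable (\<lambda>x. indicator A x *\<^sub>R c)"
proof -
  have "\<exists>T. open T \<and> A \<subseteq> T \<and> (T - A) \<in> lmeasurable \<and> emeasure lebesgue (T - A) < ennreal (1 / real (Suc i))" for i
    by (rule sets_lebesgue_outer_open[OF A(1), of "1 / real (Suc i)"]) auto
  then obtain T where T: "\<And>i. open (T i)" "\<And>i. A \<subseteq> T i" "\<And>i. T i - A \<in> lmeasurable"
    "\<And>i. emeasure lebesgue (T i - A) < ennreal (1 / real (Suc i))" by metis
  have A': "A \<in> lmeasurable" using A by (simp add: fmeasurable_def)
  have Tl: "T i \<in> lmeasurable" for i
  proof -
    have "A \<union> (T i - A) \<in> lmeasurable" using A' T(3) by (rule fmeasurable.Un)
    then show ?thesis using T(2)[of i] by (simp add: Un_absorb1)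
  qed
  have Ai: "integrable lebesgue (\<lambda>x. indicator S x *\<^sub>R c)" if "S \<in> lmeasurable" for S :: "'a set"
    using that by (intro integrable_scaleR_left integrable_real_indicator) (auto simp: fmeasurable_def)
  have eq: "(LINT x|lebesgue. norm (indicator A x *\<^sub>R c - indicator (T i) x *\<^sub>R c)) = measure lebesgue (T i - A) * norm c" for i
  proof -
    have "(LINT x|lebesgue. norm (indicator A x *\<^sub>R c - indicator (T i) x *\<^sub>R c)) = (LINT x|lebesgue. indicat_real (T i - A) x * norm c)"
      using T(2)[of i] by (intro Bochner_Integration.integral_cong) (auto simp: indicator_def)
    also have "\<dots> = measure lebesgue (T i - A) * norm c" by (simp del: measure_completion)
    finally show ?thesis .
  qed
  have le: "measure lebesgue (T i - A) \<le> 1 / real (Suc i)" for i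
    using T(4)[of i] by (simp add: measure_def enn2real_leI less_imp_le del: measure_completion emeasure_completion)
  have "(\<lambda>i. measure lebesgue (T i - A)) \<longlonglongrightarrow> 0"
    by (rule tendsto_sandwich[OF _ _ tendsto_const LIMSEQ_Suc[OF lim_1_over_n]])
      (use le in \<open>auto simp del: measure_completion\<close>)
  then have "(\<lambda>i. measure lebesgue (T i - A) * norm c) \<longlonglongrightarrow> 0" by (rule tendsto_mult_left_zero)
  then have lim: "(\<lambda>i. LINT x|lebesgue. norm (indicator A x *\<^sub>R c - indicator (T i) x *\<^sub>R c)) \<longlonglongrightarrow> 0"
    unfolding eq .
  have T_appr: "L1_approximable (\<lambda>x. indicator (T i) x *\<^sub>R c)" for i
  proof (rule L1_approximable_open[OF T(1)])
    show "emeasure lebesgue (T i) < \<infinity>" using Tl[of i] unfolding fmeasurable_def by (simp del: emeasure_completion)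
  qed
  show ?thesis
    by (rule L1_approximable_limit[where s="\<lambda>i x. indicator (T i) x *\<^sub>R c", OF Ai[OF A'] Ai[OF Tl] T_appr lim])
qed

lemma integrable_L1_approximable:
  fixes f :: "'a::euclidean_space \<Rightarrow> 'b::{banach, second_countable_topology}"
  assumes "integrable lebesgue f"
  shows "L1_approximable f"
  using assms
proof (induction rule: integrable_induct)
  case (base A c)
  then show ?case by (rule L1_approximable_indicator)
next
  case (add f g)
  show ?case unfolding L1_approximable_def
  proof (intro allI impI)
    fix e :: real assume "e > 0"
    then have "e / 2 > 0" by simp
    then obtain f' g' where f': "continuous_on UNIV f'" "integrable lebesgue f'" "(LINT x|lebesgue. norm (f x - f' x)) < e / 2"
      and g': "continuous_on UNIV g'" "integrable lebesgue g'" "(LINT x|lebesgue. norm (g x - g' x)) < e / 2"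
      using add unfolding L1_approximable_def by meson
    have "(LINT x|lebesgue. norm (f x + g x - (f' x + g' x))) \<le> (LINT x|lebesgue. norm (f x - f' x) + norm (g x - g' x))"
      using add f' g' by (intro integral_mono) (auto intro: norm_diff_triangle_ineq)
    also have "\<dots> = (LINT x|lebesgue. norm (f x - f' x)) + (LINT x|lebesgue. norm (g x - g' x))"
      using add f' g' by (intro Bochner_Integration.integral_add) auto
    finally have "(LINT x|lebesgue. norm (f x + g x - (f' x + g' x))) < e" using f'(3) g'(3) by linarith
    then show "\<exists>h. continuous_on UNIV h \<and> integrable lebesgue h \<and> (LINT x|lebesgue. norm (f x + g x - h x)) < e"
      using f' g' by (intro exI[of _ "\<lambda>x. f' x + g' x"]) (auto intro: continuous_intros)
  qed
next
  case (lim f s)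
  have "(\<lambda>i. LINT x|lebesgue. norm (f x - s i x)) \<longlonglongrightarrow> (LINT x|(lebesgue :: 'a measure). 0)"
  proof (rule integral_dominated_convergence[where w="\<lambda>x. 3 * norm (f x)"])
    show "AE x in lebesgue. (\<lambda>i. norm (f x - s i x)) \<longlonglongrightarrow> 0"
    proof (rule AE_I2)
      fix x :: 'a
      have "(\<lambda>i. s i x) \<longlonglongrightarrow> f x" using lim by simp
      then have "(\<lambda>i. norm (f x - s i x)) \<longlonglongrightarrow> norm (f x - f x)" by (intro tendsto_intros)
      then show "(\<lambda>i. norm (f x - s i x)) \<longlonglongrightarrow> 0" by simp
    qed
    show "AE x in lebesgue. norm (norm (f x - s i x)) \<le> 3 * norm (f x)" for i
    proof (rule AE_I2)
      fix x :: 'a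
      have "norm (s i x) \<le> 2 * norm (f x)" using lim by simp
      then show "norm (norm (f x - s i x)) \<le> 3 * norm (f x)"
        using norm_triangle_ineq4[of "f x" "s i x"] by simp
    qed
  qed (use lim in auto)
  then show ?case using lim by (intro L1_approximable_limit[of f s]) auto
qed

section \<open>Lebesgue points\<close>

text \<open>As a rewrite rule this theorem replaces Lebesgue measure by Borel measure of a main part of the
  set, after which facts about Lebesgue measurable sets no longer apply.\<close>

declare emeasure_completion [simp del]

text \<open>The weak type estimate for the Hardy-Littlewood maximal function, with the exceptional set
  enlarged to a measurable one. Each bad point is the centre of a ball on which the mean of
  \<open>norm h\<close> exceeds \<open>a\<close>; Vitali's lemma selects disjoint balls among them whose fivefold
  enlargements cover everything, and on disjoint balls the integrals of \<open>norm h\<close> add up to at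
  most its total integral.\<close>

lemma weak_type_maximal:
  fixes h :: "'a::euclidean_space \<Rightarrow> 'b::{banach, second_countable_topology}"
  assumes h: "integrable lebesgue h" and a: "a > 0"
  obtains U where "U \<in> lmeasurable" 
    "measure lebesgue U \<le> 5 ^ DIM('a) / a * (LINT z|lebesgue. norm (h z))"
    "\<And>x r. \<lbrakk>0 < r; r \<le> 1; x \<notin> U\<rbrakk> \<Longrightarrow>
      (LINT z|lebesgue. indicator (ball x r) z * norm (h z)) \<le> a * measure lebesgue (ball x r)"
proof -
  define K where "K = {(x, r). 0 < r \<and> r \<le> 1 \<and>
    a * measure lebesgue (ball x r) < (LINT z|lebesgue. indicator (ball x r) z * norm (h z))}"
  have K: "0 < snd i \<and> snd i \<le> 1" if "i \<in> K" for i using that by (auto simp: K_def)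
  obtain C where C: "countable C" "C \<subseteq> K"
    and disj: "pairwise (\<lambda>i j. disjnt (ball (fst i) (snd i)) (ball (fst j) (snd j))) C"
    and cov: "(\<Union>i\<in>K. ball (fst i) (snd i)) \<subseteq> (\<Union>i\<in>C. ball (fst i) (5 * snd i))"
    by (rule Vitali_covering_lemma_balls[OF subset_refl K]) auto
  define U where "U = (\<Union>i\<in>C. ball (fst i) (5 * snd i))"
  have int_ind: "integrable lebesgue (\<lambda>z. indicator (ball x r) z * norm (h z))" for x :: 'a and r
    using integrable_indicator_scaleR[OF integrable_norm[OF h], of "ball x r"] by simp
  have bound: "measure lebesgue (\<Union>i\<in>I. ball (fst i) (5 * snd i)) \<le> 5 ^ DIM('a) / a * (LINT z|lebesgue. norm (h z))"
    if I: "I \<subseteq> C" "finite I" for I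
  proof -
    have le: "(LINT z|lebesgue. (\<Sum>i\<in>I. indicator (ball (fst i) (snd i)) z * norm (h z))) \<le> (LINT z|lebesgue. norm (h z))"
    proof (rule integral_mono)
      have df: "disjoint_family_on (\<lambda>i. ball (fst i) (snd i)) I"
        unfolding disjoint_family_on_def
      proof (intro ballI impI)
        fix i j assume "i \<in> I" "j \<in> I" "i \<noteq> j"
        then have "disjnt (ball (fst i) (snd i)) (ball (fst j) (snd j))"
          using I(1) by (intro pairwiseD[OF disj]) blast+
        then show "ball (fst i) (snd i) \<inter> ball (fst j) (snd j) = {}" by (simp add: disjnt_def)
      qed
      show "integrable lebesgue (\<lambda>z. \<Sum>i\<in>I. indicator (ball (fst i) (snd i)) z * norm (h z))"
        by (intro Bochner_Integration.integrable_sum int_ind)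
      show "integrable lebesgue (\<lambda>z. norm (h z))" by (rule integrable_norm[OF h])
      fix z
      have "(\<Sum>i\<in>I. indicator (ball (fst i) (snd i)) z * norm (h z)) = (\<Sum>i\<in>I. indicat_real (ball (fst i) (snd i)) z) * norm (h z)"
        by (rule sum_distrib_right[symmetric])
      also have "(\<Sum>i\<in>I. indicat_real (ball (fst i) (snd i)) z) = indicator (\<Union>i\<in>I. ball (fst i) (snd i)) z"
        by (rule indicator_UN_disjoint[OF I(2) df, symmetric])
      also have "\<dots> * norm (h z) \<le> norm (h z)" by (auto simp: indicator_def)
      finally show "(\<Sum>i\<in>I. indicator (ball (fst i) (snd i)) z * norm (h z)) \<le> norm (h z)" .
    qed
    have IK: "i \<in> K" if "i \<in> I" for i using I C that by auto
    have "measure lebesgue (\<Union>i\<in>I. ball (fst i) (5 * snd i)) \<le> (\<Sum>i\<in>I. measure lebesgue (ball (fst i) (5 * snd i)))"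
      using I by (intro measure_UNION_le) auto
    also have "\<dots> \<le> (\<Sum>i\<in>I. 5 ^ DIM('a) / a * (LINT z|lebesgue. indicator (ball (fst i) (snd i)) z * norm (h z)))"
    proof (rule sum_mono)
      fix i assume "i \<in> I"
      then have i: "i \<in> K" by (rule IK)
      have "measure lebesgue (ball (fst i) (5 * snd i)) = 5 ^ DIM('a) * measure lebesgue (ball (fst i) (snd i))"
        using K[OF i] content_ball_conv_unit_ball[of "5 * snd i" "fst i"] content_ball_conv_unit_ball[of "snd i" "fst i"]
        by (simp add: power_mult_distrib)
      also have "\<dots> \<le> 5 ^ DIM('a) * ((LINT z|lebesgue. indicator (ball (fst i) (snd i)) z * norm (h z)) / a)"
        using i a by (intro mult_left_mono) (auto simp: K_def field_simps)
      finally show "measure lebesgue (ball (fst i) (5 * snd i)) \<le> 5 ^ DIM('a) / a * (LINT z|lebesgue. indicator (ball (fst i) (snd i)) z * norm (h z))"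
        by simp
    qed
    also have "\<dots> = 5 ^ DIM('a) / a * (LINT z|lebesgue. (\<Sum>i\<in>I. indicator (ball (fst i) (snd i)) z * norm (h z)))"
      using int_ind by (subst Bochner_Integration.integral_sum) (auto simp: sum_distrib_left)
    also have "\<dots> \<le> 5 ^ DIM('a) / a * (LINT z|lebesgue. norm (h z))"
      using le a by (intro mult_left_mono) auto
    finally show ?thesis .
  qed
  show thesis
  proof
    show "U \<in> lmeasurable"
      unfolding U_def by (rule fmeasurable_UN_bound[OF C(1) _ bound]) auto
    show "measure lebesgue U \<le> 5 ^ DIM('a) / a * (LINT z|lebesgue. norm (h z))"
      unfolding U_def by (rule measure_UN_bound[OF C(1) _ bound]) auto
    fix x r assume r: "(0::real) < r" "r \<le> 1" and x: "x \<notin> U"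
    show "(LINT z|lebesgue. indicator (ball x r) z * norm (h z)) \<le> a * measure lebesgue (ball x r)"
    proof (rule ccontr)
      assume "\<not> ?thesis"
      then have "(x, r) \<in> K" using r by (simp add: K_def)
      then have "x \<in> (\<Union>i\<in>K. ball (fst i) (snd i))" using r by force
      then show False using cov x unfolding U_def by blast
    qed
  qed
qed

text \<open>The norm stands inside the mean. This is stronger than convergence of the means of \<open>f\<close> and
  is what kernels that are not constant on balls require.\<close>

definition Lebesgue_point :: "('a::euclidean_space \<Rightarrow> 'b::{banach, second_countable_topology}) \<Rightarrow> 'a \<Rightarrow> bool"
  where "Lebesgue_point f x \<longleftrightarrow>
    ((\<lambda>r. (LINT z|lebesgue. indicator (ball x r) z * norm (f z - f x)) / measure lebesgue (ball x r)) \<longlongrightarrow> 0) (at_right 0)"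

lemma integrable_indicator_ball: "integrable lebesgue (indicat_real (ball x r))"
  using lmeasurable_ball[of x r] unfolding fmeasurable_def by (intro integrable_real_indicator) auto

lemma integrable_indicator_ball_diff:
  fixes f :: "'a::euclidean_space \<Rightarrow> 'b::{banach, second_countable_topology}"
  assumes f: "integrable lebesgue f"
  shows "integrable lebesgue (\<lambda>z. indicator (ball x r) z * norm (f z - c))"
proof -
  have "integrable lebesgue (\<lambda>z. indicator (ball x r) z *\<^sub>R f z - indicator (ball x r) z *\<^sub>R c)"
    by (intro Bochner_Integration.integrable_diff integrable_indicator_scaleR[OF f] integrable_scaleR_left integrable_indicator_ball) simp
  then have "integrable lebesgue (\<lambda>z. norm (indicator (ball x r) z *\<^sub>R f z - indicator (ball x r) z *\<^sub>R c))"
    by (rule integrable_norm)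
  then show ?thesis
    by (rule Bochner_Integration.integrable_cong[THEN iffD1, rotated -1]) (auto simp: indicator_def)
qed

text \<open>Split \<open>f = g + (f - g)\<close> with \<open>g\<close> continuous and \<open>f - g\<close> small in \<open>L\<^sup>1\<close>. The means of \<open>g\<close>
  cause no trouble, and the maximal inequality and Markov's inequality confine the points at which
  \<open>f - g\<close> spoils the convergence by more than \<open>a\<close> to a set of arbitrarily small measure.\<close>

lemma Lebesgue_differentiation:
  fixes f :: "'a::euclidean_space \<Rightarrow> 'b::{banach, second_countable_topology}"
  assumes f: "integrable lebesgue f"
  shows "AE x in lebesgue. Lebesgue_point f x"
proof -
  define A where "A r x = (LINT z|lebesgue. indicator (ball x r) z * norm (f z - f x)) / measure lebesgue (ball x r)" for r x
  define E where "E a = {x. \<not> (\<forall>\<^sub>F r in at_right 0. A r x \<le> a)}" for a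
  have Epos: "negligible (E a)" if a: "a > 0" for a
    unfolding negligible_outer_le
  proof (intro allI impI)
    fix e :: real assume e: "e > 0"
    \<comment> \<open>Maximal inequality with \<open>a / 3\<close> plus Markov's inequality give total measure \<open>3 * (5 ^ n + 1) / a * \<eta> = e\<close>.\<close>
    define \<eta> where "\<eta> = e * a / (3 * (5 ^ DIM('a) + 1))"
    have den: "3 * (5 ^ DIM('a) + 1) > (0::real)" by (simp add: add_pos_pos)
    then have "\<eta> > 0" using e a by (simp add: \<eta>_def)
    then obtain g where g: "continuous_on UNIV g" "integrable lebesgue g" "(LINT x|lebesgue. norm (f x - g x)) < \<eta>"
      using integrable_L1_approximable[OF f] unfolding L1_approximable_def by blast
    have fg: "integrable lebesgue (\<lambda>x. f x - g x)" using f g by simp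
    have "a / 3 > 0" using a by simp
    then obtain U where U: "U \<in> lmeasurable" 
      "measure lebesgue U \<le> 5 ^ DIM('a) / (a / 3) * (LINT z|lebesgue. norm (f z - g z))"
      "\<And>x r. \<lbrakk>0 < r; r \<le> 1; x \<notin> U\<rbrakk> \<Longrightarrow>
        (LINT z|lebesgue. indicator (ball x r) z * norm (f z - g z)) \<le> a / 3 * measure lebesgue (ball x r)"
      by (rule weak_type_maximal[OF fg]) blast
    define V where "V = {x \<in> space lebesgue. norm (f x - g x) \<ge> a / 3}"
    have fgm: "(\<lambda>x. norm (f x - g x)) \<in> borel_measurable lebesgue" using fg by simp
    have Vs: "V \<in> sets lebesgue" unfolding V_def using fgm by measurable
    have Vle: "emeasure lebesgue V \<le> ennreal (1 / (a / 3) * (LINT z|lebesgue. norm (f z - g z)))"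
      unfolding V_def
      by (rule integral_Markov_inequality[where M=lebesgue]) (use fg \<open>a / 3 > 0\<close> in auto)
    then have V: "V \<in> lmeasurable" using Vs unfolding fmeasurable_def using order_le_less_trans[OF Vle ennreal_less_top] by simp
    have Vm: "measure lebesgue V \<le> 1 / (a / 3) * (LINT z|lebesgue. norm (f z - g z))"
      unfolding measure_def using Vle \<open>a / 3 > 0\<close> by (intro enn2real_leI) auto
    have "E a \<subseteq> U \<union> V"
    proof
      fix x assume x: "x \<in> E a"
      show "x \<in> U \<union> V"
      proof (rule ccontr)
        assume "x \<notin> U \<union> V"
        then have xU: "x \<notin> U" and xV: "norm (f x - g x) < a / 3" by (auto simp: V_def)
        have "isCont g x" using g(1) by (simp add: continuous_on_eq_continuous_at)
        then obtain d where d: "d > 0" "\<And>z. dist z x < d \<Longrightarrow> dist (g z) (g x) < a / 3"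
          using \<open>a / 3 > 0\<close> unfolding continuous_at_eps_delta by metis
        have "A r x \<le> a" if r: "0 < r" "r < min 1 d" for r
        proof -
          have B: "measure lebesgue (ball x r) > 0" using r by simp
          note iB = integrable_indicator_ball[of x r]
          have "(LINT z|lebesgue. indicator (ball x r) z * norm (f z - f x))
            \<le> (LINT z|lebesgue. indicator (ball x r) z * norm (f z - g z) + indicator (ball x r) z * (2 * a / 3))"
          proof (rule integral_mono)
            show "integrable lebesgue (\<lambda>z. indicator (ball x r) z * norm (f z - f x))"
              by (rule integrable_indicator_ball_diff[OF f])
            show "integrable lebesgue (\<lambda>z. indicator (ball x r) z * norm (f z - g z) + indicator (ball x r) z * (2 * a / 3))"
              using integrable_indicator_scaleR[OF integrable_norm[OF fg], of "ball x r"] iB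
              by (intro Bochner_Integration.integrable_add integrable_mult_left) auto
            fix z
            show "indicator (ball x r) z * norm (f z - f x) \<le> indicator (ball x r) z * norm (f z - g z) + indicator (ball x r) z * (2 * a / 3)"
            proof (cases "z \<in> ball x r")
              case True
              then have "dist (g z) (g x) < a / 3" using r by (intro d(2)) (auto simp: dist_commute)
              \<comment> \<open>Three errors: \<open>f - g\<close> near \<open>x\<close>, the oscillation of \<open>g\<close>, and \<open>f - g\<close> at \<open>x\<close>.\<close>
              moreover have "norm (f z - f x) \<le> norm (f z - g z) + norm (g z - g x) + norm (f x - g x)"
                using norm_triangle_ineq[of "f z - g z" "g z - g x"] norm_triangle_ineq4[of "f z - g x" "f x - g x"] by simp
              ultimately show ?thesis using True xV by (simp add: dist_norm)
            qed simp
          qed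
          also have "\<dots> = (LINT z|lebesgue. indicator (ball x r) z * norm (f z - g z)) + measure lebesgue (ball x r) * (2 * a / 3)"
            using integrable_indicator_scaleR[OF integrable_norm[OF fg], of "ball x r"] iB
            by (subst Bochner_Integration.integral_add) auto
          also have "\<dots> \<le> a / 3 * measure lebesgue (ball x r) + measure lebesgue (ball x r) * (2 * a / 3)"
            using U(3)[OF _ _ xU, of r] r by (intro add_mono) auto
          also have "\<dots> = a * measure lebesgue (ball x r)" by (simp add: algebra_simps)
          finally show ?thesis using B unfolding A_def by (simp only: divide_le_eq) simp
        qed
        then have "\<forall>\<^sub>F r in at_right 0. A r x \<le> a"
          unfolding eventually_at_right[OF zero_less_one] using d(1)
          by (intro exI[of _ "min 1 d"]) auto
        then show False using x by (simp add: E_def)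
      qed
    qed
    moreover have "U \<union> V \<in> lmeasurable" using U(1) V by (rule fmeasurable.Un)
    moreover have "measure lebesgue (U \<union> V) \<le> e"
    proof -
      have "measure lebesgue (U \<union> V) \<le> measure lebesgue U + measure lebesgue V"
        using U V by (intro measure_Un_le) auto
      also have "\<dots> \<le> (3 * (5 ^ DIM('a) + 1)) / a * (LINT z|lebesgue. norm (f z - g z))"
        using U(2) Vm by (simp add: algebra_simps add_divide_distrib)
      also have "\<dots> \<le> (3 * (5 ^ DIM('a) + 1)) / a * \<eta>"
        using g(3) a den by (intro mult_left_mono) (auto intro!: divide_nonneg_pos)
      also have "\<dots> = e" using a den by (simp add: \<eta>_def)
      finally show ?thesis .
    qed
    ultimately show "\<exists>T. E a \<subseteq> T \<and> T \<in> lmeasurable \<and> measure lebesgue T \<le> e" by blast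
  qed
  have "negligible (\<Union>m::nat. E (1 / real (Suc m)))"
    using Epos by (intro negligible_countable_Union) auto
  then have N: "(\<Union>m::nat. E (1 / real (Suc m))) \<in> null_sets lebesgue" by (simp add: negligible_iff_null_sets)
  show ?thesis
  proof (rule AE_I'[OF N], rule subsetI, rule ccontr)
    fix x assume x: "x \<in> {x \<in> space lebesgue. \<not> Lebesgue_point f x}" "x \<notin> (\<Union>m. E (1 / real (Suc m)))"
    have "((\<lambda>r. A r x) \<longlongrightarrow> 0) (at_right 0)"
    proof (rule tendstoI)
      fix e :: real assume "e > 0"
      then obtain m where m: "1 / real (Suc m) < e" using reals_Archimedean[of e] by (auto simp: inverse_eq_divide)
      have "\<forall>\<^sub>F r in at_right 0. A r x \<le> 1 / real (Suc m)" using x by (auto simp: E_def)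
      then show "\<forall>\<^sub>F r in at_right 0. dist (A r x) 0 < e"
      proof (rule eventually_mono)
        fix r assume "A r x \<le> 1 / real (Suc m)"
        moreover have "A r x \<ge> 0" unfolding A_def by (intro divide_nonneg_nonneg integral_nonneg) auto
        ultimately show "dist (A r x) 0 < e" using m by (simp add: dist_real_def)
      qed
    qed
    then show False using x unfolding Lebesgue_point_def A_def by simp
  qed
qed

section \<open>Approximate identities\<close>

text \<open>Dominated convergence in which the dominating function may vary with \<open>k\<close>, provided that its
  integrals converge. It follows from the usual theorem because
  \<open>a k \<le> min (a k) b0 + (b k - b0) + max (b0 - b k) 0\<close>, where the first and the last summand are
  dominated by \<open>b0\<close> and the middle one has small integral.\<close>

lemma generalized_dominated_convergence:
  fixes a b :: "nat \<Rightarrow> 'a \<Rightarrow> real"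
  assumes a: "\<And>k. a k \<in> borel_measurable M" and b: "\<And>k. integrable M (b k)" "integrable M b0"
    and ab: "\<And>k. AE x in M. 0 \<le> a k x \<and> a k x \<le> b k x"
    and alim: "AE x in M. (\<lambda>k. a k x) \<longlonglongrightarrow> 0" and blim: "AE x in M. (\<lambda>k. b k x) \<longlonglongrightarrow> b0 x"
    and b0: "AE x in M. 0 \<le> b0 x"
    and ilim: "(\<lambda>k. LINT x|M. b k x) \<longlonglongrightarrow> (LINT x|M. b0 x)"
  shows "(\<lambda>k. LINT x|M. a k x) \<longlonglongrightarrow> 0"
proof -
  have ai: "integrable M (a k)" for k
    by (rule Bochner_Integration.integrable_bound[OF b(1)[of k] a]) (use ab[of k] in auto)
  have b0m: "b0 \<in> borel_measurable M" and bm: "b k \<in> borel_measurable M" for k using b by auto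
  have 1: "(\<lambda>k. LINT x|M. min (a k x) (b0 x)) \<longlonglongrightarrow> (LINT x|M. 0)"
  proof (rule integral_dominated_convergence[where w=b0])
    show "AE x in M. (\<lambda>k. min (a k x) (b0 x)) \<longlonglongrightarrow> 0"
      using alim b0
    proof eventually_elim
      fix x assume "(\<lambda>k. a k x) \<longlonglongrightarrow> 0" "0 \<le> b0 x"
      then have "(\<lambda>k. min (a k x) (b0 x)) \<longlonglongrightarrow> min 0 (b0 x)" by (intro tendsto_intros)
      then show "(\<lambda>k. min (a k x) (b0 x)) \<longlonglongrightarrow> 0" using \<open>0 \<le> b0 x\<close> by simp
    qed
    show "AE x in M. norm (min (a k x) (b0 x)) \<le> b0 x" for k using ab[of k] b0 by eventually_elim auto
  qed (use a b0m b(2) in auto)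
  have 2: "(\<lambda>k. LINT x|M. max (b0 x - b k x) 0) \<longlonglongrightarrow> (LINT x|M. 0)"
  proof (rule integral_dominated_convergence[where w=b0])
    show "AE x in M. (\<lambda>k. max (b0 x - b k x) 0) \<longlonglongrightarrow> 0"
      using blim
    proof eventually_elim
      fix x assume "(\<lambda>k. b k x) \<longlonglongrightarrow> b0 x"
      then have "(\<lambda>k. max (b0 x - b k x) 0) \<longlonglongrightarrow> max (b0 x - b0 x) 0" by (intro tendsto_intros)
      then show "(\<lambda>k. max (b0 x - b k x) 0) \<longlonglongrightarrow> 0" by simp
    qed
    show "AE x in M. norm (max (b0 x - b k x) 0) \<le> b0 x" for k using ab[of k] b0 by eventually_elim auto
  qed (use bm b0m b(2) in auto)
  have le: "(LINT x|M. a k x) \<le> (LINT x|M. min (a k x) (b0 x)) + ((LINT x|M. b k x) - (LINT x|M. b0 x)) + (LINT x|M. max (b0 x - b k x) 0)" for k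
  proof -
    have i1: "integrable M (\<lambda>x. min (a k x) (b0 x))" using ai b by (intro integrable_min)
    have i2: "integrable M (\<lambda>x. max (b0 x - b k x) 0)" using b by (intro integrable_max) auto
    have "(LINT x|M. a k x) \<le> (LINT x|M. min (a k x) (b0 x) + (b k x - b0 x) + max (b0 x - b k x) 0)"
      using ab[of k] by (intro integral_mono_AE ai Bochner_Integration.integrable_add Bochner_Integration.integrable_diff i1 i2 b) auto
    also have "\<dots> = (LINT x|M. min (a k x) (b0 x)) + ((LINT x|M. b k x) - (LINT x|M. b0 x)) + (LINT x|M. max (b0 x - b k x) 0)"
      using i1 i2 b by simp
    finally show ?thesis .
  qed
  have "(\<lambda>k. (LINT x|M. min (a k x) (b0 x)) + ((LINT x|M. b k x) - (LINT x|M. b0 x)) + (LINT x|M. max (b0 x - b k x) 0))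
    \<longlonglongrightarrow> 0 + ((LINT x|M. b0 x) - (LINT x|M. b0 x)) + 0"
    using 1 2 by (intro tendsto_intros ilim) simp_all
  then have up: "(\<lambda>k. (LINT x|M. min (a k x) (b0 x)) + ((LINT x|M. b k x) - (LINT x|M. b0 x)) + (LINT x|M. max (b0 x - b k x) 0))
    \<longlonglongrightarrow> 0" by simp
  show ?thesis
  proof (rule tendsto_sandwich[OF _ _ tendsto_const up])
    show "\<forall>\<^sub>F k in sequentially. 0 \<le> (LINT x|M. a k x)"
      by (intro always_eventually allI integral_nonneg_AE eventually_mono[OF ab]) auto
  qed (use le in auto)
qed

text \<open>The graph of \<open>t \<mapsto> t powr p\<close> lies above its tangent at \<open>s\<close>. Integrated against a probability
  density this is Jensen's inequality.\<close>

lemma powr_tangent: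
  assumes "1 \<le> p" "0 \<le> s" "0 \<le> (t::real)"
  shows "s powr p + p * s powr (p - 1) * (t - s) \<le> t powr p"
proof (cases "s = 0 \<or> t = 0")
  case True
  then show ?thesis
  proof
    assume "t = 0"
    then show ?thesis using assms powr_mult_base[of s "p - 1"] mult_right_mono[of 1 p "s powr p"]
      by (auto simp: algebra_simps)
  qed (use assms in auto)
next
  case False
  then have s: "s > 0" and t: "t > 0" using assms by auto
  have "(t powr p) - (s powr p) \<ge> p * s powr (p - 1) * (t - s)"
    by (rule convex_on_imp_above_tangent[OF powr_convex[OF assms(1)]])
      (use s t in \<open>auto intro!: has_field_derivative_at_within[OF has_real_derivative_powr] simp: interior_open\<close>)
  then show ?thesis by simp
qed

lemma borel_measurable_lebesgue_continuous:
  "continuous_on UNIV f \<Longrightarrow> f \<in> borel_measurable lebesgue"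
  by (simp add: borel_measurable_continuous_onI measurable_completion)

definition mollify :: "('a::euclidean_space \<Rightarrow> real) \<Rightarrow> real \<Rightarrow> ('a \<Rightarrow> 'b::{banach, second_countable_topology}) \<Rightarrow> 'a \<Rightarrow> 'b"
  where "mollify k \<epsilon> f x = (LINT z|lebesgue. (k ((x - z) /\<^sub>R \<epsilon>) / \<epsilon> ^ DIM('a)) *\<^sub>R f z)"

text \<open>Two kernels are needed: a smooth one, which produces smooth approximations and test functions,
  and the normalised indicator of the unit ball, which produces means over balls. The latter is
  discontinuous on the unit sphere, so continuity is required only almost everywhere.\<close>

locale mollifier =
  fixes k :: "'a::euclidean_space \<Rightarrow> real" and C :: real
  assumes k_borel [measurable]: "k \<in> borel_measurable borel"
    and k_nonneg: "0 \<le> k y" and k_le: "k y \<le> C"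
    and k_support: "1 \<le> norm y \<Longrightarrow> k y = 0"
    and k_integral: "(LINT y|lebesgue. k y) = 1"
    and k_cont: "negligible {y. \<not> isCont k y}"
begin

definition K :: "real \<Rightarrow> 'a \<Rightarrow> 'a \<Rightarrow> real"
  where "K \<epsilon> x z = k ((x - z) /\<^sub>R \<epsilon>) / \<epsilon> ^ DIM('a)"

lemma mollify_K: "mollify k \<epsilon> f x = (LINT z|lebesgue. K \<epsilon> x z *\<^sub>R f z)"
  by (simp add: mollify_def K_def)

lemma K_nonneg: "\<epsilon> > 0 \<Longrightarrow> 0 \<le> K \<epsilon> x z"
  using k_nonneg by (simp add: K_def)

lemma K_le: "\<epsilon> > 0 \<Longrightarrow> K \<epsilon> x z \<le> C / \<epsilon> ^ DIM('a) * indicator (ball x \<epsilon>) z"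
proof (cases "z \<in> ball x \<epsilon>")
  case True
  assume "\<epsilon> > 0"
  then show ?thesis using True k_le by (simp add: K_def divide_right_mono)
next
  case False
  assume e: "\<epsilon> > 0"
  then have "1 \<le> norm ((x - z) /\<^sub>R \<epsilon>)" using False by (simp add: dist_norm divide_simps)
  then show ?thesis using False k_support by (simp add: K_def)
qed

lemma K_le': "\<epsilon> > 0 \<Longrightarrow> K \<epsilon> x z \<le> C / \<epsilon> ^ DIM('a)"
  using k_le by (simp add: K_def divide_right_mono)

lemma K_borel: "K \<epsilon> x \<in> borel_measurable borel" "(\<lambda>x. K \<epsilon> x z) \<in> borel_measurable borel"
  "(\<lambda>(x, z). K \<epsilon> x z) \<in> borel_measurable (borel \<Otimes>\<^sub>M borel)"
  unfolding K_def[abs_def] by measurable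

lemma K_lebesgue [measurable]: "K \<epsilon> x \<in> borel_measurable lebesgue" "(\<lambda>x. K \<epsilon> x z) \<in> borel_measurable lebesgue"
  using K_borel(1,2) by (auto intro: measurable_completion)

lemma integrable_k: "integrable lebesgue k"
  using k_integral not_integrable_integral_eq by fastforce

lemma K_integral:
  assumes e: "\<epsilon> > 0"
  shows "integrable lebesgue (K \<epsilon> x)" "(LINT z|lebesgue. K \<epsilon> x z) = 1"
    and "integrable lebesgue (\<lambda>x. K \<epsilon> x z)" "(LINT x|lebesgue. K \<epsilon> x z) = 1"
proof -
  have e': "- (1 / \<epsilon>) \<noteq> 0" "1 / \<epsilon> \<noteq> 0" using e by auto
  have eq: "(\<lambda>z. k ((x /\<^sub>R \<epsilon>) + (- (1 / \<epsilon>)) *\<^sub>R z)) = (\<lambda>z. k ((x - z) /\<^sub>R \<epsilon>))" for x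
    by (rule ext, rule arg_cong[of _ _ k]) (simp add: scaleR_diff_right inverse_eq_divide)
  have eq2: "(\<lambda>x. k ((- z /\<^sub>R \<epsilon>) + (1 / \<epsilon>) *\<^sub>R x)) = (\<lambda>x. k ((x - z) /\<^sub>R \<epsilon>))" for z
    by (rule ext, rule arg_cong[of _ _ k]) (simp add: scaleR_diff_right inverse_eq_divide)
  show "integrable lebesgue (K \<epsilon> x)"
    unfolding K_def[abs_def]
    using integrable_lebesgue_affine[OF integrable_k e'(1), of "x /\<^sub>R \<epsilon>"] unfolding eq by simp
  show "integrable lebesgue (\<lambda>x. K \<epsilon> x z)"
    unfolding K_def[abs_def]
    using integrable_lebesgue_affine[OF integrable_k e'(2), of "- z /\<^sub>R \<epsilon>"] unfolding eq2 by simp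
  have "1 = \<bar>- (1 / \<epsilon>)\<bar> ^ DIM('a) *\<^sub>R (LINT z|lebesgue. k ((x - z) /\<^sub>R \<epsilon>))"
    using integral_lebesgue_affine[OF e'(1), of k "x /\<^sub>R \<epsilon>"] unfolding eq k_integral .
  then show "(LINT z|lebesgue. K \<epsilon> x z) = 1"
    using e by (simp add: K_def power_inverse divide_inverse mult.commute)
  have "1 = \<bar>1 / \<epsilon>\<bar> ^ DIM('a) *\<^sub>R (LINT x|lebesgue. k ((x - z) /\<^sub>R \<epsilon>))"
    using integral_lebesgue_affine[OF e'(2), of k "- z /\<^sub>R \<epsilon>"] unfolding eq2 k_integral .
  then show "(LINT x|lebesgue. K \<epsilon> x z) = 1"
    using e by (simp add: K_def power_inverse divide_inverse mult.commute)
qed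

lemma integrable_K_scaleR:
  fixes f :: "'a \<Rightarrow> 'b::{banach, second_countable_topology}"
  assumes e: "\<epsilon> > 0" and f: "integrable lebesgue f"
  shows "integrable lebesgue (\<lambda>z. K \<epsilon> x z *\<^sub>R f z)"
proof (rule Bochner_Integration.integrable_bound[OF integrable_scaleR_right[OF f, of "C / \<epsilon> ^ DIM('a)"]])
  show "(\<lambda>z. K \<epsilon> x z *\<^sub>R f z) \<in> borel_measurable lebesgue"
    by (intro borel_measurable_scaleR K_lebesgue borel_measurable_integrable[OF f])
  show "AE z in lebesgue. norm (K \<epsilon> x z *\<^sub>R f z) \<le> norm ((C / \<epsilon> ^ DIM('a)) *\<^sub>R f z)"
  proof (rule AE_I2)
    fix z
    have "\<bar>K \<epsilon> x z\<bar> \<le> \<bar>C / \<epsilon> ^ DIM('a)\<bar>" using K_nonneg[OF e, of x z] K_le'[OF e, of x z] by linarith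
    then show "norm (K \<epsilon> x z *\<^sub>R f z) \<le> norm ((C / \<epsilon> ^ DIM('a)) *\<^sub>R f z)"
      unfolding norm_scaleR by (rule mult_right_mono) simp
  qed
qed

lemma mollify_Lebesgue_point:
  fixes f :: "'a \<Rightarrow> 'b::{banach, second_countable_topology}"
  assumes f: "integrable lebesgue f" and x: "Lebesgue_point f x"
  shows "((\<lambda>\<epsilon>. mollify k \<epsilon> f x) \<longlongrightarrow> f x) (at_right 0)"
proof (rule Lim_null_comparison[where g="\<lambda>\<epsilon>. (C * measure lebesgue (ball (0::'a) 1)) *
    ((LINT z|lebesgue. indicator (ball x \<epsilon>) z * norm (f z - f x)) / measure lebesgue (ball x \<epsilon>))", THEN LIM_zero_cancel])
  show "((\<lambda>\<epsilon>. (C * measure lebesgue (ball (0::'a) 1)) *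
    ((LINT z|lebesgue. indicator (ball x \<epsilon>) z * norm (f z - f x)) / measure lebesgue (ball x \<epsilon>))) \<longlongrightarrow> 0) (at_right 0)"
    using x unfolding Lebesgue_point_def by (rule tendsto_mult_right_zero)
  have "norm (mollify k \<epsilon> f x - f x) \<le> (C * measure lebesgue (ball (0::'a) 1)) *
    ((LINT z|lebesgue. indicator (ball x \<epsilon>) z * norm (f z - f x)) / measure lebesgue (ball x \<epsilon>))" if e: "\<epsilon> > 0" for \<epsilon>
  proof -
    have iK: "integrable lebesgue (\<lambda>z. K \<epsilon> x z *\<^sub>R f x)" by (intro integrable_scaleR_left K_integral e)
    have "mollify k \<epsilon> f x - f x = (LINT z|lebesgue. K \<epsilon> x z *\<^sub>R f z) - (LINT z|lebesgue. K \<epsilon> x z *\<^sub>R f x)"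
      using K_integral(1,2)[OF e, of x] by (simp add: mollify_K integral_scaleR_left)
    also have "\<dots> = (LINT z|lebesgue. K \<epsilon> x z *\<^sub>R (f z - f x))"
      by (subst Bochner_Integration.integral_diff[OF integrable_K_scaleR[OF e f] iK, symmetric]) (simp add: scaleR_diff_right)
    also have "norm \<dots> \<le> (LINT z|lebesgue. norm (K \<epsilon> x z *\<^sub>R (f z - f x)))" by (rule integral_norm_bound)
    also have "\<dots> \<le> (LINT z|lebesgue. C / \<epsilon> ^ DIM('a) * (indicator (ball x \<epsilon>) z * norm (f z - f x)))"
    proof (rule integral_mono)
      show "integrable lebesgue (\<lambda>z. norm (K \<epsilon> x z *\<^sub>R (f z - f x)))"
        using Bochner_Integration.integrable_diff[OF integrable_K_scaleR[OF e f] iK]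
        by (intro integrable_norm) (simp add: scaleR_diff_right)
      show "integrable lebesgue (\<lambda>z. C / \<epsilon> ^ DIM('a) * (indicator (ball x \<epsilon>) z * norm (f z - f x)))"
        by (intro integrable_mult_right integrable_indicator_ball_diff f)
      fix z
      have "norm (K \<epsilon> x z *\<^sub>R (f z - f x)) = K \<epsilon> x z * norm (f z - f x)" using K_nonneg[OF e] by simp
      also have "\<dots> \<le> C / \<epsilon> ^ DIM('a) * indicator (ball x \<epsilon>) z * norm (f z - f x)"
        by (rule mult_right_mono[OF K_le[OF e]]) simp
      finally show "norm (K \<epsilon> x z *\<^sub>R (f z - f x)) \<le> C / \<epsilon> ^ DIM('a) * (indicator (ball x \<epsilon>) z * norm (f z - f x))"
        by (simp add: mult.assoc)
    qed
    also have "\<dots> = C / \<epsilon> ^ DIM('a) * (LINT z|lebesgue. indicator (ball x \<epsilon>) z * norm (f z - f x))"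
      by (rule integral_mult_right_zero)
    also have "C / \<epsilon> ^ DIM('a) = (C * measure lebesgue (ball (0::'a) 1)) / measure lebesgue (ball x \<epsilon>)"
      using content_ball_conv_unit_ball[of \<epsilon> x] e content_ball_gt_0_iff[of "0::'a" 1] by simp
    finally show ?thesis by simp
  qed
  then show "\<forall>\<^sub>F \<epsilon> in at_right 0. norm (mollify k \<epsilon> f x - f x) \<le> (C * measure lebesgue (ball (0::'a) 1)) *
    ((LINT z|lebesgue. indicator (ball x \<epsilon>) z * norm (f z - f x)) / measure lebesgue (ball x \<epsilon>))"
    by (intro eventually_at_rightI[of 0 1]) auto
qed

lemma mollify_AE:
  fixes f :: "'a \<Rightarrow> 'b::{banach, second_countable_topology}"
  assumes f: "integrable lebesgue f"
  shows "AE x in lebesgue. ((\<lambda>\<epsilon>. mollify k \<epsilon> f x) \<longlongrightarrow> f x) (at_right 0)"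
  using Lebesgue_differentiation[OF f] by eventually_elim (rule mollify_Lebesgue_point[OF f])

text \<open>The integrands converge at every \<open>z\<close> for which \<open>k\<close> is continuous at \<open>(x - z) / \<epsilon>\<close>. The other
  \<open>z\<close> form an affine image of the discontinuity set of \<open>k\<close>.\<close>

lemma mollify_continuous:
  fixes f :: "'a \<Rightarrow> 'b::{banach, second_countable_topology}"
  assumes e: "\<epsilon> > 0" and f: "integrable lebesgue f"
  shows "continuous_on UNIV (mollify k \<epsilon> f)"
  unfolding continuous_on_sequentially
proof (intro allI ballI impI)
  fix X :: "nat \<Rightarrow> 'a" and x assume X: "(\<forall>n. X n \<in> UNIV) \<and> X \<longlonglongrightarrow> x"
  have neg: "negligible ((\<lambda>y. x + (- \<epsilon>) *\<^sub>R y) ` {y. \<not> isCont k y})"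
    by (rule negligible_differentiable_image_negligible[OF order_refl k_cont])
      (auto simp: differentiable_on_def intro!: derivative_intros)
  have "AE z in lebesgue. isCont k ((x - z) /\<^sub>R \<epsilon>)"
  proof (rule AE_I'[OF neg[unfolded negligible_iff_null_sets]], rule subsetI)
    fix z assume "z \<in> {z \<in> space lebesgue. \<not> isCont k ((x - z) /\<^sub>R \<epsilon>)}"
    moreover have "z = x + (- \<epsilon>) *\<^sub>R ((x - z) /\<^sub>R \<epsilon>)" using e by simp
    ultimately show "z \<in> (\<lambda>y. x + (- \<epsilon>) *\<^sub>R y) ` {y. \<not> isCont k y}" by blast
  qed
  then have lim: "AE z in lebesgue. (\<lambda>n. K \<epsilon> (X n) z *\<^sub>R f z) \<longlonglongrightarrow> K \<epsilon> x z *\<^sub>R f z"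
  proof eventually_elim
    fix z assume "isCont k ((x - z) /\<^sub>R \<epsilon>)"
    moreover have "(\<lambda>n. (X n - z) /\<^sub>R \<epsilon>) \<longlonglongrightarrow> (x - z) /\<^sub>R \<epsilon>" using X by (intro tendsto_intros) auto
    ultimately have "(\<lambda>n. k ((X n - z) /\<^sub>R \<epsilon>)) \<longlonglongrightarrow> k ((x - z) /\<^sub>R \<epsilon>)" by (rule isCont_tendsto_compose)
    then show "(\<lambda>n. K \<epsilon> (X n) z *\<^sub>R f z) \<longlonglongrightarrow> K \<epsilon> x z *\<^sub>R f z"
      unfolding K_def using e by (intro tendsto_intros) auto
  qed
  have "(\<lambda>n. LINT z|lebesgue. K \<epsilon> (X n) z *\<^sub>R f z) \<longlonglongrightarrow> (LINT z|lebesgue. K \<epsilon> x z *\<^sub>R f z)"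
  proof (rule integral_dominated_convergence[where w="\<lambda>z. C / \<epsilon> ^ DIM('a) * norm (f z)", OF _ _ _ lim])
    show "AE z in lebesgue. norm (K \<epsilon> (X n) z *\<^sub>R f z) \<le> C / \<epsilon> ^ DIM('a) * norm (f z)" for n
    proof (rule AE_I2)
      fix z
      have "\<bar>K \<epsilon> (X n) z\<bar> \<le> C / \<epsilon> ^ DIM('a)" using K_nonneg[OF e, of "X n" z] K_le'[OF e, of "X n" z] by linarith
      then show "norm (K \<epsilon> (X n) z *\<^sub>R f z) \<le> C / \<epsilon> ^ DIM('a) * norm (f z)"
        unfolding norm_scaleR by (rule mult_right_mono) simp
    qed
    show "integrable lebesgue (\<lambda>z. C / \<epsilon> ^ DIM('a) * norm (f z))"
      by (intro integrable_mult_right integrable_norm f)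
  qed (intro borel_measurable_scaleR K_lebesgue borel_measurable_integrable[OF f])+
  then show "((mollify k \<epsilon> f) \<circ> X) \<longlonglongrightarrow> mollify k \<epsilon> f x" unfolding mollify_K comp_def .
qed

text \<open>Tonelli's theorem needs joint measurability on the product of two copies of Lebesgue-Borel
  measure, so \<open>g\<close> is first exchanged for a nonnegative Borel function that agrees with it almost
  everywhere.\<close>

lemma mollify_integral:
  fixes g :: "'a \<Rightarrow> real"
  assumes e: "\<epsilon> > 0" and g: "integrable lebesgue g" and pos: "\<And>x. 0 \<le> g x"
  shows "integrable lebesgue (mollify k \<epsilon> g)" "(LINT x|lebesgue. mollify k \<epsilon> g x) = (LINT x|lebesgue. g x)"
proof -
  obtain g' where g': "g' \<in> borel_measurable borel" "AE x in lborel. g x = g' x"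
    using completion_ex_borel_measurable_real[OF borel_measurable_integrable[OF g]] by auto
  define G where "G x = max 0 (g' x)" for x
  have G [measurable]: "G \<in> borel_measurable borel" unfolding G_def using g'(1) by measurable
  have Gn: "0 \<le> G x" for x by (simp add: G_def)
  have "AE x in lborel. g x = G x" using g'(2)
  proof eventually_elim
    fix x assume "g x = g' x" then show "g x = G x" using pos[of x] by (simp add: G_def)
  qed
  then have gG: "AE x in lebesgue. g x = G x" by (rule AE_completion)
  have nonneg: "0 \<le> mollify k \<epsilon> g x" for x
    unfolding mollify_K using K_nonneg[OF e] pos by (intro Bochner_Integration.integral_nonneg) simp
  note [measurable] = K_borel(3)
  have "ennreal (mollify k \<epsilon> g x) = (\<integral>\<^sup>+z. ennreal (K \<epsilon> x z) * ennreal (G z) \<partial>lborel)" for x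
  proof -
    have "ennreal (mollify k \<epsilon> g x) = (\<integral>\<^sup>+z. ennreal (K \<epsilon> x z *\<^sub>R g z) \<partial>lebesgue)"
      unfolding mollify_K using integrable_K_scaleR[OF e g, of x] K_nonneg[OF e] pos
      by (intro nn_integral_eq_integral[symmetric]) auto
    also have "\<dots> = (\<integral>\<^sup>+z. ennreal (K \<epsilon> x z) * ennreal (G z) \<partial>lebesgue)"
      by (rule nn_integral_cong_AE, use gG in eventually_elim) (use K_nonneg[OF e] Gn in \<open>simp add: ennreal_mult\<close>)
    also have "\<dots> = (\<integral>\<^sup>+z. ennreal (K \<epsilon> x z) * ennreal (G z) \<partial>lborel)" by (rule nn_integral_completion)
    finally show ?thesis .
  qed
  then have "(\<integral>\<^sup>+x. ennreal (mollify k \<epsilon> g x) \<partial>lebesgue) = (\<integral>\<^sup>+x. \<integral>\<^sup>+z. ennreal (K \<epsilon> x z) * ennreal (G z) \<partial>lborel \<partial>lborel)"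
    by (simp add: nn_integral_completion)
  also have "\<dots> = (\<integral>\<^sup>+z. \<integral>\<^sup>+x. ennreal (K \<epsilon> x z) * ennreal (G z) \<partial>lborel \<partial>lborel)"
    by (rule lborel_pair.Fubini') measurable
  also have "\<dots> = (\<integral>\<^sup>+z. ennreal (G z) \<partial>lborel)"
  proof (rule nn_integral_cong)
    fix z
    have "(\<integral>\<^sup>+x. ennreal (K \<epsilon> x z) \<partial>lborel) = (\<integral>\<^sup>+x. ennreal (K \<epsilon> x z) \<partial>lebesgue)" by (rule nn_integral_completion[symmetric])
    also have "\<dots> = 1" using K_integral(3,4)[OF e, of z] K_nonneg[OF e] by (subst nn_integral_eq_integral) auto
    finally show "(\<integral>\<^sup>+x. ennreal (K \<epsilon> x z) * ennreal (G z) \<partial>lborel) = ennreal (G z)"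
      using K_borel(2) by (subst nn_integral_multc) auto
  qed
  also have "\<dots> = (\<integral>\<^sup>+z. ennreal (G z) \<partial>lebesgue)" by (rule nn_integral_completion[symmetric])
  also have "\<dots> = (\<integral>\<^sup>+z. ennreal (g z) \<partial>lebesgue)"
    by (rule nn_integral_cong_AE) (use gG in auto)
  also have "\<dots> = ennreal (LINT z|lebesgue. g z)" using g pos by (intro nn_integral_eq_integral) auto
  finally have eq: "(\<integral>\<^sup>+x. ennreal (mollify k \<epsilon> g x) \<partial>lebesgue) = ennreal (LINT z|lebesgue. g z)" .
  have meas: "mollify k \<epsilon> g \<in> borel_measurable lebesgue"
    by (rule borel_measurable_lebesgue_continuous[OF mollify_continuous[OF e g]])
  show int: "integrable lebesgue (mollify k \<epsilon> g)"
    by (rule integrableI_nonneg[OF meas]) (use nonneg eq in auto)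
  have "ennreal (LINT x|lebesgue. mollify k \<epsilon> g x) = ennreal (LINT x|lebesgue. g x)"
    using eq int nonneg by (subst (asm) nn_integral_eq_integral) auto
  then show "(LINT x|lebesgue. mollify k \<epsilon> g x) = (LINT x|lebesgue. g x)"
    using nonneg pos by (subst (asm) ennreal_inj) (auto intro!: Bochner_Integration.integral_nonneg)
qed

lemma mollify_powr_le:
  fixes f :: "'a \<Rightarrow> 'b::{banach, second_countable_topology}"
  assumes e: "\<epsilon> > 0" and p: "1 \<le> p" and f: "integrable lebesgue f" and fp: "integrable lebesgue (\<lambda>x. norm (f x) powr p)"
  shows "norm (mollify k \<epsilon> f x) powr p \<le> mollify k \<epsilon> (\<lambda>z. norm (f z) powr p) x"
proof -
  define s where "s = (LINT z|lebesgue. K \<epsilon> x z *\<^sub>R norm (f z))"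
  have s0: "s \<ge> 0" unfolding s_def using K_nonneg[OF e] by (intro Bochner_Integration.integral_nonneg) auto
  have "norm (mollify k \<epsilon> f x) \<le> (LINT z|lebesgue. norm (K \<epsilon> x z *\<^sub>R f z))"
    unfolding mollify_K by (rule integral_norm_bound)
  also have "\<dots> = s" unfolding s_def using K_nonneg[OF e] by (intro Bochner_Integration.integral_cong) auto
  finally have "norm (mollify k \<epsilon> f x) \<le> s" .
  then have "norm (mollify k \<epsilon> f x) powr p \<le> s powr p" using p by (intro powr_mono2) auto
  \<comment> \<open>The kernel is a probability density against which \<open>norm f\<close> has mean \<open>s\<close>, so the tangent at \<open>s\<close> integrates to its value \<open>s powr p\<close> at \<open>s\<close>.\<close>
  also have "s powr p = (LINT z|lebesgue. K \<epsilon> x z * (s powr p - p * s powr (p - 1) * s) + p * s powr (p - 1) * (K \<epsilon> x z *\<^sub>R norm (f z)))"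
    using K_integral(1,2)[OF e, of x] integrable_K_scaleR[OF e integrable_norm[OF f], of x]
    by (subst Bochner_Integration.integral_add) (auto simp: s_def)
  also have "\<dots> \<le> (LINT z|lebesgue. K \<epsilon> x z *\<^sub>R (norm (f z) powr p))"
  proof (rule integral_mono)
    show "integrable lebesgue (\<lambda>z. K \<epsilon> x z * (s powr p - p * s powr (p - 1) * s) + p * s powr (p - 1) * (K \<epsilon> x z *\<^sub>R norm (f z)))"
      by (intro Bochner_Integration.integrable_add integrable_mult_left integrable_mult_right K_integral(1)[OF e]
        integrable_K_scaleR[OF e integrable_norm[OF f]])
    show "integrable lebesgue (\<lambda>z. K \<epsilon> x z *\<^sub>R (norm (f z) powr p))" by (rule integrable_K_scaleR[OF e fp])
    fix z
    have "K \<epsilon> x z * (s powr p + p * s powr (p - 1) * (norm (f z) - s)) \<le> K \<epsilon> x z * (norm (f z) powr p)"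
      by (intro mult_left_mono powr_tangent p s0 K_nonneg[OF e]) simp
    then show "K \<epsilon> x z * (s powr p - p * s powr (p - 1) * s) + p * s powr (p - 1) * (K \<epsilon> x z *\<^sub>R norm (f z))
      \<le> K \<epsilon> x z *\<^sub>R (norm (f z) powr p)" by (simp add: algebra_simps)
  qed
  finally show ?thesis unfolding mollify_K .
qed

text \<open>With \<open>g = norm f powr p\<close>, Jensen's inequality bounds the integrand by
  \<open>2 powr p * (mollify k \<epsilon> g + g)\<close>. This bound depends on \<open>\<epsilon>\<close>, but it converges almost everywhere
  and its integral does not depend on \<open>\<epsilon>\<close>. So almost everywhere convergence of
  \<open>mollify k \<epsilon> f\<close> upgrades to convergence in \<open>L\<^sup>p\<close>.\<close>

lemma mollify_Lp:
  fixes f :: "'a \<Rightarrow> 'b::{banach, second_countable_topology}"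
  assumes p: "1 \<le> p" and f: "integrable lebesgue f" and fp: "integrable lebesgue (\<lambda>x. norm (f x) powr p)"
  shows "\<epsilon> > 0 \<Longrightarrow> integrable lebesgue (\<lambda>x. norm (mollify k \<epsilon> f x) powr p)"
    and "\<epsilon> > 0 \<Longrightarrow> integrable lebesgue (\<lambda>x. norm (mollify k \<epsilon> f x - f x) powr p)"
    and "((\<lambda>\<epsilon>. LINT x|lebesgue. norm (mollify k \<epsilon> f x - f x) powr p) \<longlongrightarrow> 0) (at_right 0)"
proof -
  define g where "g x = norm (f x) powr p" for x
  have g: "integrable lebesgue g" "\<And>x. 0 \<le> g x" using fp by (auto simp: g_def[abs_def])
  have meas: "mollify k \<epsilon> f \<in> borel_measurable lebesgue" if "\<epsilon> > 0" for \<epsilon>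
    by (rule borel_measurable_lebesgue_continuous[OF mollify_continuous[OF that f]])
  have bound1: "norm (mollify k \<epsilon> f x) powr p \<le> mollify k \<epsilon> g x" if "\<epsilon> > 0" for \<epsilon> x
    unfolding g_def[abs_def] by (rule mollify_powr_le[OF that p f fp])
  show i1: "integrable lebesgue (\<lambda>x. norm (mollify k \<epsilon> f x) powr p)" if e: "\<epsilon> > 0" for \<epsilon>
  proof (rule Bochner_Integration.integrable_bound[OF mollify_integral(1)[OF e g]])
    show "(\<lambda>x. norm (mollify k \<epsilon> f x) powr p) \<in> borel_measurable lebesgue" using meas[OF e] by measurable
    show "AE x in lebesgue. norm (norm (mollify k \<epsilon> f x) powr p) \<le> norm (mollify k \<epsilon> g x)"
      using bound1[OF e] by (intro AE_I2) (simp add: order_trans[OF _ abs_ge_self])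
  qed
  define b where "b \<epsilon> x = 2 powr p * (mollify k \<epsilon> g x + g x)" for \<epsilon> x
  have bound: "norm (mollify k \<epsilon> f x - f x) powr p \<le> b \<epsilon> x" if e: "\<epsilon> > 0" for \<epsilon> x
  proof -
    have "norm (mollify k \<epsilon> f x - f x) \<le> 2 * max (norm (mollify k \<epsilon> f x)) (norm (f x))"
      using norm_triangle_ineq4[of "mollify k \<epsilon> f x" "f x"] by linarith
    then have "norm (mollify k \<epsilon> f x - f x) powr p \<le> (2 * max (norm (mollify k \<epsilon> f x)) (norm (f x))) powr p"
      using p by (intro powr_mono2) auto
    also have "\<dots> = 2 powr p * (max (norm (mollify k \<epsilon> f x)) (norm (f x))) powr p" by (simp add: powr_mult)
    also have "\<dots> \<le> 2 powr p * (norm (mollify k \<epsilon> f x) powr p + norm (f x) powr p)"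
      by (intro mult_left_mono) (auto simp: max_def)
    also have "\<dots> \<le> b \<epsilon> x" unfolding b_def using bound1[OF e, of x] by (intro mult_left_mono add_mono) (auto simp: g_def)
    finally show ?thesis .
  qed
  have bi: "integrable lebesgue (b \<epsilon>)" if "\<epsilon> > 0" for \<epsilon>
    unfolding b_def by (intro integrable_mult_right Bochner_Integration.integrable_add g(1) mollify_integral(1)[OF that g])
  have dm: "(\<lambda>x. norm (mollify k \<epsilon> f x - f x) powr p) \<in> borel_measurable lebesgue" if "\<epsilon> > 0" for \<epsilon>
    using meas[OF that] borel_measurable_integrable[OF f] by measurable
  show "integrable lebesgue (\<lambda>x. norm (mollify k \<epsilon> f x - f x) powr p)" if e: "\<epsilon> > 0" for \<epsilon>
    by (rule Bochner_Integration.integrable_bound[OF bi[OF e] dm[OF e]])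
      (use bound[OF e] in \<open>intro AE_I2, simp add: order_trans[OF _ abs_ge_self]\<close>)
  show "((\<lambda>\<epsilon>. LINT x|lebesgue. norm (mollify k \<epsilon> f x - f x) powr p) \<longlongrightarrow> 0) (at_right 0)"
    unfolding tendsto_at_iff_sequentially
  proof (intro allI impI)
    fix X :: "nat \<Rightarrow> real" assume X: "\<forall>i. X i \<in> {0<..} - {0}" "X \<longlonglongrightarrow> 0"
    then have Xpos: "X n > 0" for n by auto
    have Xlim: "filterlim X (at_right 0) sequentially"
      using X(2) Xpos by (simp add: filterlim_at less_imp_neq[OF Xpos, symmetric])
    have "(\<lambda>n. LINT x|lebesgue. norm (mollify k (X n) f x - f x) powr p) \<longlonglongrightarrow> 0"
    proof (rule generalized_dominated_convergence[where b="\<lambda>n. b (X n)" and ?b0.0="\<lambda>x. 2 powr p * (g x + g x)"])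
      show "AE x in lebesgue. (\<lambda>n. norm (mollify k (X n) f x - f x) powr p) \<longlonglongrightarrow> 0"
        using mollify_AE[OF f]
      proof eventually_elim
        fix x assume "((\<lambda>\<epsilon>. mollify k \<epsilon> f x) \<longlongrightarrow> f x) (at_right 0)"
        then have "(\<lambda>n. mollify k (X n) f x) \<longlonglongrightarrow> f x" using Xlim by (rule filterlim_compose)
        then have "(\<lambda>n. norm (mollify k (X n) f x - f x)) \<longlonglongrightarrow> norm (f x - f x)" by (intro tendsto_intros)
        then have "(\<lambda>n. norm (mollify k (X n) f x - f x)) \<longlonglongrightarrow> 0" by simp
        then show "(\<lambda>n. norm (mollify k (X n) f x - f x) powr p) \<longlonglongrightarrow> 0"
          using p by (intro tendsto_zero_powrI[where b=p]) auto
      qed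
      show "AE x in lebesgue. (\<lambda>n. b (X n) x) \<longlonglongrightarrow> 2 powr p * (g x + g x)"
        using mollify_AE[OF g(1)]
      proof eventually_elim
        fix x assume "((\<lambda>\<epsilon>. mollify k \<epsilon> g x) \<longlongrightarrow> g x) (at_right 0)"
        then have "(\<lambda>n. mollify k (X n) g x) \<longlonglongrightarrow> g x" using Xlim by (rule filterlim_compose)
        then show "(\<lambda>n. b (X n) x) \<longlonglongrightarrow> 2 powr p * (g x + g x)" unfolding b_def by (intro tendsto_intros)
      qed
      have "(LINT x|lebesgue. b (X n) x) = (LINT x|lebesgue. 2 powr p * (g x + g x))" for n
        unfolding b_def using mollify_integral[OF Xpos[of n] g] g(1) by simp
      then show "(\<lambda>n. LINT x|lebesgue. b (X n) x) \<longlonglongrightarrow> (LINT x|lebesgue. 2 powr p * (g x + g x))" by simp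
      show "integrable lebesgue (\<lambda>x. 2 powr p * (g x + g x))"
        by (intro integrable_mult_right Bochner_Integration.integrable_add g(1))
    qed (use dm bi Xpos bound g(2) in auto)
    then show "((\<lambda>\<epsilon>. LINT x|lebesgue. norm (mollify k \<epsilon> f x - f x) powr p) \<circ> X) \<longlonglongrightarrow> 0" by (simp add: comp_def)
  qed
qed

end

section \<open>The algebra of continuously differentiable functions\<close>

lemma has_derivative_frechet: "f differentiable (at x) \<Longrightarrow> (f has_derivative frechet_derivative f (at x)) (at x)"
  by (simp add: frechet_derivative_works)

lemma frechet_eq: "(f has_derivative f') (at x) \<Longrightarrow> frechet_derivative f (at x) = f'"
  using frechet_derivative_at by metis

text \<open>Openness makes the derivatives at points of \<open>S\<close> depend on the values on \<open>S\<close> only.\<close>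

lemma Ck_on_cong_open:
  assumes "open S" "\<And>x. x \<in> S \<Longrightarrow> f x = g x" "Ck_on k f S"
  shows "Ck_on k g S"
  using assms(2,3)
proof (induction k arbitrary: f g)
  case 0
  then show ?case using continuous_on_cong[of S S f g] by simp
next
  case (Suc k)
  have d: "(g has_derivative frechet_derivative f (at x)) (at x)" if "x \<in> S" for x
    using has_derivative_frechet[of f x] Suc.prems that assms(1)
    by (intro has_derivative_transform_within_open[of f _ x UNIV S g]) auto
  have eq: "frechet_derivative g (at x) = frechet_derivative f (at x)" if "x \<in> S" for x
    by (rule frechet_eq[OF d[OF that]])
  have "Ck_on k (\<lambda>x. frechet_derivative g (at x) (axis j 1)) S" for j
  proof (rule Suc.IH)
    show "Ck_on k (\<lambda>x. frechet_derivative f (at x) (axis j 1)) S"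
      using Suc.prems(2) unfolding Ck_on.simps by blast
  qed (simp only: eq)
  then show ?case unfolding Ck_on.simps by (intro conjI ballI allI differentiableI[OF d])
qed

text \<open>To show smoothness it suffices to exhibit some derivative whose values on the axes are again
  of class \<open>C\<^sup>k\<close>; every closure property below is proved this way by induction on \<open>k\<close>.\<close>

lemma Ck_on_SucI:
  assumes "open S" "\<And>x. x \<in> S \<Longrightarrow> (f has_derivative f' x) (at x)"
    and "\<And>j. Ck_on k (\<lambda>x. f' x (axis j 1)) S"
  shows "Ck_on (Suc k) f S"
proof -
  have "Ck_on k (\<lambda>x. frechet_derivative f (at x) (axis j 1)) S" for j
    by (rule Ck_on_cong_open[OF assms(1) _ assms(3)[of j]]) (simp add: frechet_eq[OF assms(2)])
  then show ?thesis unfolding Ck_on.simps by (intro conjI ballI allI differentiableI[OF assms(2)])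
qed

lemma Ck_on_SucD: "Ck_on (Suc k) f S \<Longrightarrow> Ck_on k f S"
proof (induction k arbitrary: f)
  case 0
  then have "\<forall>x\<in>S. f differentiable (at x)" by simp
  then show ?case unfolding Ck_on.simps
    by (intro continuous_at_imp_continuous_on ballI differentiable_imp_continuous_within) blast
next
  case (Suc k)
  then have "\<forall>x\<in>S. f differentiable (at x)"
    and "Ck_on (Suc k) (\<lambda>x. frechet_derivative f (at x) (axis j 1)) S" for j
    unfolding Ck_on.simps(2)[of "Suc k"] by blast+
  then show ?case unfolding Ck_on.simps(2)[of k f] using Suc.IH by blast
qed

lemma Ck_on_subset: "Ck_on k f S \<Longrightarrow> T \<subseteq> S \<Longrightarrow> Ck_on k f T"
proof (induction k arbitrary: f)
  case 0
  then show ?case unfolding Ck_on.simps by (rule continuous_on_subset)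
next
  case (Suc k)
  then show ?case unfolding Ck_on.simps by blast
qed

lemma Ck_on_local:
  assumes "\<And>x. x \<in> S \<Longrightarrow> \<exists>U. open U \<and> x \<in> U \<and> Ck_on k f U"
  shows "Ck_on k f S"
  using assms
proof (induction k arbitrary: f)
  case 0
  show ?case unfolding Ck_on.simps
  proof (rule continuous_at_imp_continuous_on, rule ballI)
    fix x assume "x \<in> S"
    then obtain U where "open U" "x \<in> U" "continuous_on U f" using 0[OF \<open>x \<in> S\<close>] unfolding Ck_on.simps by blast
    then show "isCont f x" using continuous_on_eq_continuous_at by blast
  qed
next
  case (Suc k)
  have "Ck_on k (\<lambda>x. frechet_derivative f (at x) (axis j 1)) S" for j
  proof (rule Suc.IH)
    fix x assume "x \<in> S"
    then show "\<exists>U. open U \<and> x \<in> U \<and> Ck_on k (\<lambda>x. frechet_derivative f (at x) (axis j 1)) U"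
      using Suc.prems[of x] unfolding Ck_on.simps by blast
  qed
  moreover have "f differentiable (at x)" if "x \<in> S" for x using Suc.prems[OF that] unfolding Ck_on.simps by blast
  ultimately show ?case unfolding Ck_on.simps by blast
qed

lemma Ck_on_const: "Ck_on k (\<lambda>x. c) S"
proof (induction k arbitrary: c)
  case (Suc k)
  show ?case unfolding Ck_on.simps using Suc.IH[of 0] by (simp add: frechet_derivative_const)
qed simp

lemma Ck_on_add:
  assumes "open S" "Ck_on k f S" "Ck_on k g S"
  shows "Ck_on k (\<lambda>x. f x + g x) S"
  using assms(2,3)
proof (induction k arbitrary: f g)
  case (Suc k)
  show ?case
    by (rule Ck_on_SucI[OF assms(1), where f'="\<lambda>x h. frechet_derivative f (at x) h + frechet_derivative g (at x) h"])
      (use Suc.prems in \<open>auto intro!: has_derivative_add has_derivative_frechet Suc.IH\<close>)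
qed (simp add: continuous_on_add)

lemma Ck_on_bilinear:
  fixes prod :: "'b::real_normed_vector \<Rightarrow> 'c::real_normed_vector \<Rightarrow> 'd::real_normed_vector"
  assumes "open S" and bb: "bounded_bilinear prod" and "Ck_on k f S" "Ck_on k g S"
  shows "Ck_on k (\<lambda>x. prod (f x) (g x)) S"
  using assms(3,4)
proof (induction k arbitrary: f g)
  case 0
  then show ?case unfolding Ck_on.simps by (rule bounded_bilinear.continuous_on[OF bb])
next
  case (Suc k)
  show ?case
  proof (rule Ck_on_SucI[OF assms(1), where f'="\<lambda>x h. prod (f x) (frechet_derivative g (at x) h) + prod (frechet_derivative f (at x) h) (g x)"])
    show "((\<lambda>x. prod (f x) (g x)) has_derivative (\<lambda>h. prod (f x) (frechet_derivative g (at x) h) + prod (frechet_derivative f (at x) h) (g x))) (at x)"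
      if "x \<in> S" for x
      using Suc.prems that by (intro bounded_bilinear.FDERIV[OF bb] has_derivative_frechet) auto
    show "Ck_on k (\<lambda>x. prod (f x) (frechet_derivative g (at x) (axis j 1)) + prod (frechet_derivative f (at x) (axis j 1)) (g x)) S" for j
    proof (intro Ck_on_add[OF assms(1)] Suc.IH)
      show "Ck_on k f S" "Ck_on k g S" by (rule Ck_on_SucD[OF Suc.prems(1)], rule Ck_on_SucD[OF Suc.prems(2)])
      show "Ck_on k (\<lambda>x. frechet_derivative g (at x) (axis j 1)) S" "Ck_on k (\<lambda>x. frechet_derivative f (at x) (axis j 1)) S"
        using Suc.prems unfolding Ck_on.simps by blast+
    qed
  qed
qed

lemma Ck_on_bounded_linear:
  assumes "open S" and T: "bounded_linear T" and "Ck_on k f S"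
  shows "Ck_on k (\<lambda>x. T (f x)) S"
  using assms(3)
proof (induction k arbitrary: f)
  case 0
  then show ?case unfolding Ck_on.simps by (rule bounded_linear.continuous_on[OF T])
next
  case (Suc k)
  show ?case
    by (rule Ck_on_SucI[OF assms(1), where f'="\<lambda>x h. T (frechet_derivative f (at x) h)"])
      (use Suc.prems in \<open>auto intro!: bounded_linear.has_derivative[OF T] has_derivative_frechet Suc.IH\<close>)
qed

lemma Ck_on_linear:
  assumes "open S" "bounded_linear T"
  shows "Ck_on k T S"
proof (cases k)
  case 0
  show ?thesis unfolding 0 Ck_on.simps by (rule linear_continuous_on[OF assms(2)])
next
  case (Suc m)
  show ?thesis unfolding Suc
    by (rule Ck_on_SucI[OF assms(1), where f'="\<lambda>x. T"]) (auto intro: bounded_linear_imp_has_derivative assms Ck_on_const)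
qed

lemma Ck_on_affine:
  assumes "Ck_on k f UNIV"
  shows "Ck_on k (\<lambda>y. f (b + a *\<^sub>R y)) UNIV"
  using assms
proof (induction k arbitrary: f)
  case 0
  then show ?case unfolding Ck_on.simps
    by (rule continuous_on_compose2[of UNIV f]) (auto intro!: continuous_intros)
next
  case (Suc k)
  have lin: "linear (frechet_derivative f (at y))" for y
    using Suc.prems has_derivative_linear[OF has_derivative_frechet[of f y]] by simp
  show ?case
  proof (rule Ck_on_SucI[OF open_UNIV, where f'="\<lambda>y h. frechet_derivative f (at (b + a *\<^sub>R y)) (a *\<^sub>R h)"])
    fix y
    have "((\<lambda>y. b + a *\<^sub>R y) has_derivative (\<lambda>h. a *\<^sub>R h)) (at y)" by (auto intro!: derivative_eq_intros)
    moreover have "(f has_derivative frechet_derivative f (at (b + a *\<^sub>R y))) (at (b + a *\<^sub>R y))"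
      using Suc.prems by (intro has_derivative_frechet) auto
    ultimately show "((\<lambda>y. f (b + a *\<^sub>R y)) has_derivative (\<lambda>h. frechet_derivative f (at (b + a *\<^sub>R y)) (a *\<^sub>R h))) (at y)"
      by (rule has_derivative_compose)
  next
    fix j
    have "Ck_on k (\<lambda>y. a *\<^sub>R frechet_derivative f (at (b + a *\<^sub>R y)) (axis j 1)) UNIV"
      using Suc.prems unfolding Ck_on.simps by (intro Ck_on_bounded_linear[OF open_UNIV bounded_linear_scaleR_right] Suc.IH) blast
    then show "Ck_on k (\<lambda>y. frechet_derivative f (at (b + a *\<^sub>R y)) (a *\<^sub>R axis j 1)) UNIV"
      by (simp add: linear_scale[OF lin])
  qed
qed

lemma linear_axis_expansion:
  fixes T :: "real^'n \<Rightarrow> 'b::real_vector"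
  assumes "linear T"
  shows "T h = (\<Sum>j\<in>UNIV. (h $ j) *\<^sub>R T (axis j 1))"
proof -
  have "T h = T (\<Sum>j\<in>UNIV. (h $ j) *\<^sub>R axis j 1)"
    using basis_expansion[of h] by (simp add: scalar_mult_eq_scaleR)
  then show ?thesis using assms by (simp add: linear_sum linear_scale)
qed

section \<open>A smooth bump function\<close>

text \<open>The factor \<open>poly p (1 / s)\<close> makes this family closed under differentiation, so that all
  derivatives of \<open>exp (- 1 / s)\<close> are treated by one induction.\<close>

definition flat_exp :: "real poly \<Rightarrow> real \<Rightarrow> real"
  where "flat_exp p s = (if 0 < s then poly p (1 / s) * exp (- (1 / s)) else 0)"

lemma poly_exp_tendsto_0: "((\<lambda>x::real. poly p x * exp (- x)) \<longlongrightarrow> 0) at_top"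
proof -
  have "((\<lambda>x. \<Sum>i\<le>degree p. coeff p i * (x ^ i / exp x)) \<longlongrightarrow> (\<Sum>i\<le>degree p. coeff p i * 0)) at_top"
    by (intro tendsto_intros tendsto_power_div_exp_0)
  then show ?thesis by (simp add: poly_altdef exp_minus divide_inverse sum_distrib_right mult.assoc)
qed

lemma flat_exp_tendsto_0: "(flat_exp p \<longlongrightarrow> 0) (at 0)"
proof (rule filterlim_split_at)
  have "(flat_exp p \<longlongrightarrow> 0) (at_right 0) \<longleftrightarrow> ((\<lambda>s. poly p (inverse s) * exp (- inverse s)) \<longlongrightarrow> 0) (at_right 0)"
    by (rule filterlim_cong) (auto simp: eventually_at_filter flat_exp_def inverse_eq_divide)
  also have "\<dots>"
    using filterlim_compose[OF poly_exp_tendsto_0[of p] filterlim_inverse_at_top_right] .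
  finally show "(flat_exp p \<longlongrightarrow> 0) (at_right 0)" .
  have "\<forall>\<^sub>F s in at_left 0. flat_exp p s = 0" by (auto simp: eventually_at_filter flat_exp_def)
  then show "(flat_exp p \<longlongrightarrow> 0) (at_left 0)" by (rule tendsto_eventually)
qed

text \<open>At \<open>s = 0\<close> the difference quotient of \<open>flat_exp p\<close> is \<open>flat_exp ([:0, 1:] * p)\<close>, which tends
  to 0; elsewhere the formula is the product rule.\<close>

lemma flat_exp_deriv:
  "(flat_exp p has_real_derivative flat_exp ([:0, 0, 1:] * (p - pderiv p)) s) (at s)"
proof (cases s "0::real" rule: linorder_cases)
  case less
  have "((\<lambda>s. 0) has_real_derivative 0) (at s)" by simp
  then have "(flat_exp p has_real_derivative 0) (at s)"
    by (rule DERIV_cong_ev[OF refl _ refl, THEN iffD1, rotated])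
      (use less eventually_nhds_in_open[of "{..<0}" s] in \<open>auto elim!: eventually_mono simp: flat_exp_def\<close>)
  then show ?thesis using less by (simp add: flat_exp_def)
next
  case greater
  have "((\<lambda>s. poly p (1 / s) * exp (- (1 / s))) has_real_derivative
      (poly (pderiv p) (1 / s) * (- (1 / s\<^sup>2))) * exp (- (1 / s)) + poly p (1 / s) * (exp (- (1 / s)) * (1 / s\<^sup>2))) (at s)"
    using greater by (auto intro!: derivative_eq_intros DERIV_chain2[OF poly_DERIV] simp: power2_eq_square)
  then have "(flat_exp p has_real_derivative
      (poly (pderiv p) (1 / s) * (- (1 / s\<^sup>2))) * exp (- (1 / s)) + poly p (1 / s) * (exp (- (1 / s)) * (1 / s\<^sup>2))) (at s)"
    by (rule DERIV_cong_ev[OF refl _ refl, THEN iffD1, rotated])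
      (use greater eventually_nhds_in_open[of "{0<..}" s] in \<open>auto elim!: eventually_mono simp: flat_exp_def\<close>)
  then show ?thesis using greater by (simp add: flat_exp_def algebra_simps power2_eq_square)
next
  case equal
  have eq: "flat_exp ([:0, 1:] * p) = (\<lambda>h. (flat_exp p (0 + h) - flat_exp p 0) / h)"
    by (rule ext) (simp add: flat_exp_def)
  have "((\<lambda>h. (flat_exp p (0 + h) - flat_exp p 0) / h) \<longlongrightarrow> 0) (at 0)"
    using flat_exp_tendsto_0[of "[:0, 1:] * p"] unfolding eq .
  then have "(flat_exp p has_real_derivative 0) (at 0)" unfolding DERIV_def .
  then show ?thesis using equal by (simp add: flat_exp_def)
qed

definition bump :: "real^'n \<Rightarrow> real"
  where "bump y = flat_exp 1 (1 - y \<bullet> y)"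

lemma Ck_on_flat_exp_ball: "Ck_on k (\<lambda>y::real^'n. flat_exp p (1 - y \<bullet> y)) UNIV"
proof (induction k arbitrary: p)
  case 0
  have "isCont (flat_exp p) s" for s by (rule DERIV_isCont[OF flat_exp_deriv])
  then have "continuous_on UNIV (flat_exp p)" by (simp add: continuous_on_eq_continuous_at)
  then show ?case unfolding Ck_on.simps
    by (rule continuous_on_compose2) (auto intro!: continuous_intros)
next
  case (Suc k)
  define q where "q = [:0, 0, 1:] * (p - pderiv p)"
  show ?case
  proof (rule Ck_on_SucI[OF open_UNIV, where f'="\<lambda>y h. flat_exp q (1 - y \<bullet> y) * ((- 2) * (y \<bullet> h))"])
    fix y :: "real^'n"
    have "((\<lambda>y. 1 - y \<bullet> y) has_derivative (\<lambda>h. - 2 * (y \<bullet> h))) (at y)"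
      by (auto intro!: derivative_eq_intros simp: inner_commute)
    moreover have "(flat_exp p has_derivative (\<lambda>t. flat_exp q (1 - y \<bullet> y) * t)) (at (1 - y \<bullet> y))"
      using flat_exp_deriv[of p "1 - y \<bullet> y"] unfolding q_def has_field_derivative_def .
    ultimately show "((\<lambda>y. flat_exp p (1 - y \<bullet> y)) has_derivative (\<lambda>h. flat_exp q (1 - y \<bullet> y) * ((- 2) * (y \<bullet> h)))) (at y)"
      by (rule has_derivative_compose)
  next
    fix j :: 'n
    show "Ck_on k (\<lambda>y. flat_exp q (1 - y \<bullet> y) * ((- 2) * (y \<bullet> axis j 1))) UNIV"
      by (intro Ck_on_bilinear[OF open_UNIV bounded_bilinear_mult] Suc.IH Ck_on_linear open_UNIV
        bounded_linear_const_mult bounded_linear_inner_left)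
  qed
qed

lemma smooth_bump: "smooth_on bump UNIV"
  unfolding smooth_on_def bump_def[abs_def] using Ck_on_flat_exp_ball by blast

lemma smooth_imp_continuous: "smooth_on f S \<Longrightarrow> continuous_on S f"
  unfolding smooth_on_def using Ck_on.simps(1) by blast

lemma bump_nonneg: "0 \<le> bump y" and bump_le: "bump y \<le> 1"
  by (auto simp: bump_def flat_exp_def)

lemma bump_pos: "norm y < 1 \<Longrightarrow> 0 < bump y"
  using power_less_one_iff[of "norm y" 2] by (simp add: bump_def flat_exp_def power2_norm_eq_inner)

lemma bump_support: "1 \<le> norm y \<Longrightarrow> bump y = 0"
  using one_le_power[of "norm y" 2] by (simp add: bump_def flat_exp_def power2_norm_eq_inner)

lemma integrable_bump: "integrable lebesgue (bump :: real^'n \<Rightarrow> real)"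
  by (rule Bochner_Integration.integrable_bound[OF integrable_indicator_ball[of 0 1]])
    (auto intro!: borel_measurable_lebesgue_continuous smooth_imp_continuous smooth_bump AE_I2
      simp: indicator_def abs_of_nonneg bump_nonneg bump_le bump_support)

definition bump_kernel :: "real^'n \<Rightarrow> real"
  where "bump_kernel y = bump y / (LINT z|lebesgue. bump (z :: real^'n))"

lemma integral_bump_pos: "0 < (LINT z|lebesgue. bump (z :: real^'n))"
proof -
  have "0 \<le> (LINT z|lebesgue. bump (z :: real^'n))" by (rule Bochner_Integration.integral_nonneg) (rule bump_nonneg)
  moreover have "(LINT z|lebesgue. bump (z :: real^'n)) \<noteq> 0"
  proof
    assume "(LINT z|lebesgue. bump (z :: real^'n)) = 0"
    then have "AE z in lebesgue. bump (z :: real^'n) = 0"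
      using integral_nonneg_eq_0_iff_AE[OF integrable_bump] bump_nonneg by auto
    then have "AE z in lebesgue. z \<notin> ball (0::real^'n) 1"
      by eventually_elim (use bump_pos in force)
    then have "negligible (ball (0::real^'n) 1)"
      using negligible_iff_null_sets AE_iff_null_sets[of "ball (0::real^'n) 1" lebesgue] by auto
    then show False using open_not_negligible[of "ball (0::real^'n) 1"] by simp
  qed
  ultimately show ?thesis by linarith
qed

lemma smooth_bump_kernel: "smooth_on bump_kernel UNIV"
proof -
  have "Ck_on k (\<lambda>y. bump y / (LINT z|lebesgue. bump (z :: real^'n))) UNIV" for k
    using smooth_bump unfolding smooth_on_def
    by (intro Ck_on_bounded_linear[OF open_UNIV bounded_linear_divide]) auto
  then show ?thesis unfolding smooth_on_def bump_kernel_def[abs_def] by blast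
qed

interpretation bump_kernel: mollifier "bump_kernel :: real^'n \<Rightarrow> real" "1 / (LINT z|lebesgue. bump (z :: real^'n))"
proof
  show "bump_kernel \<in> borel_measurable borel"
    by (rule borel_measurable_continuous_onI[OF smooth_imp_continuous[OF smooth_bump_kernel]])
  show "0 \<le> bump_kernel y" "bump_kernel y \<le> 1 / (LINT z|lebesgue. bump (z :: real^'n))" for y :: "real^'n"
    using bump_nonneg[of y] bump_le[of y] integral_bump_pos[where 'n='n] by (auto simp: bump_kernel_def divide_right_mono)
  show "bump_kernel y = 0" if "1 \<le> norm y" for y :: "real^'n" using bump_support[OF that] by (simp add: bump_kernel_def)
  show "(LINT y|lebesgue. bump_kernel (y :: real^'n)) = 1"
    unfolding bump_kernel_def using integral_bump_pos[where 'n='n] by simp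
  have "isCont bump_kernel y" for y :: "real^'n"
  proof -
    have "continuous_on (UNIV :: (real^'n) set) bump_kernel" by (rule smooth_imp_continuous[OF smooth_bump_kernel])
    then show ?thesis by (simp add: continuous_on_eq_continuous_at)
  qed
  then show "negligible {y :: real^'n. \<not> isCont bump_kernel y}" by simp
qed

section \<open>Convolution with a smooth kernel\<close>

definition conv :: "(real^'n \<Rightarrow> real) \<Rightarrow> (real^'n \<Rightarrow> 'b::{banach, second_countable_topology}) \<Rightarrow> real^'n \<Rightarrow> 'b"
  where "conv \<kappa> f x = (LINT z|lebesgue. \<kappa> (x - z) *\<^sub>R f z)"

definition partial :: "'n \<Rightarrow> (real^'n \<Rightarrow> 'b::real_normed_vector) \<Rightarrow> real^'n \<Rightarrow> 'b"
  where "partial j f x = frechet_derivative f (at x) (axis j 1)"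

definition smooth_supp :: "real \<Rightarrow> (real^'n \<Rightarrow> real) \<Rightarrow> bool"
  where "smooth_supp R \<kappa> \<longleftrightarrow> smooth_on \<kappa> UNIV \<and> (\<forall>y. R < norm y \<longrightarrow> \<kappa> y = 0)"

lemma smooth_on_differentiable: "smooth_on f S \<Longrightarrow> x \<in> S \<Longrightarrow> f differentiable (at x)"
  unfolding smooth_on_def using Ck_on.simps(2) by blast

lemma smooth_on_partial: "smooth_on f S \<Longrightarrow> smooth_on (partial j f) S"
  unfolding smooth_on_def partial_def[abs_def] using Ck_on.simps(2) by blast

lemma smooth_supp_partial:
  assumes "smooth_supp R \<kappa>"
  shows "smooth_supp R (partial j \<kappa>)"
  unfolding smooth_supp_def
proof (intro conjI allI impI)
  show "smooth_on (partial j \<kappa>) UNIV" using assms smooth_on_partial unfolding smooth_supp_def by blast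
  fix y :: "real^'a" assume "R < norm y"
  have "((\<lambda>x. 0) has_derivative (\<lambda>h. 0)) (at y)" by simp
  then have "(\<kappa> has_derivative (\<lambda>h. 0)) (at y)"
    by (rule has_derivative_transform_within_open[of "\<lambda>x. 0" _ y UNIV "- cball 0 R"])
      (use assms \<open>R < norm y\<close> in \<open>auto simp: smooth_supp_def\<close>)
  then show "partial j \<kappa> y = 0" unfolding partial_def by (subst frechet_eq) auto
qed

lemma smooth_supp_continuous: "smooth_supp R \<kappa> \<Longrightarrow> continuous_on UNIV \<kappa>"
  unfolding smooth_supp_def using smooth_imp_continuous by blast

lemma smooth_supp_bounded:
  assumes "smooth_supp R \<kappa>"
  obtains B where "0 \<le> B" "\<And>y. \<bar>\<kappa> y\<bar> \<le> B"
proof -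
  have "compact (\<kappa> ` cball 0 R)"
    by (rule compact_continuous_image[OF continuous_on_subset[OF smooth_supp_continuous[OF assms]]]) auto
  then obtain B where B: "\<And>y. y \<in> cball 0 R \<Longrightarrow> \<bar>\<kappa> y\<bar> \<le> B"
    using compact_imp_bounded[OF \<open>compact (\<kappa> ` cball 0 R)\<close>] unfolding bounded_iff by (metis imageI real_norm_def)
  have "\<bar>\<kappa> y\<bar> \<le> max B 0" for y
  proof (cases "norm y \<le> R")
    case True
    then show ?thesis using B[of y] by simp
  next
    case False
    then have "\<kappa> y = 0" using assms by (simp add: smooth_supp_def)
    then show ?thesis by simp
  qed
  then show thesis by (intro that[of "max B 0"]) auto
qed

lemma smooth_supp_derivative_bound:
  assumes "smooth_supp R \<kappa>"
  obtains L where "0 \<le> L" "\<And>y h. norm (frechet_derivative \<kappa> (at y) h) \<le> L * norm h"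
    "\<And>x y. norm (\<kappa> x - \<kappa> y) \<le> L * norm (x - y)"
proof -
  have "\<exists>B. 0 \<le> B \<and> (\<forall>y. \<bar>partial j \<kappa> y\<bar> \<le> B)" for j
    using smooth_supp_bounded[OF smooth_supp_partial[OF assms]] by metis
  then obtain B where B: "\<And>j. 0 \<le> B j" "\<And>j y. \<bar>partial j \<kappa> y\<bar> \<le> B j" by metis
  have d: "(\<kappa> has_derivative frechet_derivative \<kappa> (at y)) (at y)" for y
    using assms unfolding smooth_supp_def by (intro has_derivative_frechet smooth_on_differentiable[of _ UNIV]) auto
  define L where "L = (\<Sum>j\<in>UNIV. B j)"
  have bd: "norm (frechet_derivative \<kappa> (at y) h) \<le> L * norm h" for y h
  proof -
    have "frechet_derivative \<kappa> (at y) h = (\<Sum>j\<in>UNIV. (h $ j) *\<^sub>R partial j \<kappa> y)"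
      unfolding partial_def by (rule linear_axis_expansion[OF has_derivative_linear[OF d]])
    also have "norm \<dots> \<le> (\<Sum>j\<in>UNIV. norm h * B j)"
    proof (rule order_trans[OF norm_sum sum_mono])
      fix j
      show "norm ((h $ j) *\<^sub>R partial j \<kappa> y) \<le> norm h * B j"
        unfolding norm_scaleR using B(2)[of j y] component_le_norm_cart[of h j] by (intro mult_mono) auto
    qed
    also have "\<dots> = L * norm h" by (simp add: L_def sum_distrib_left mult.commute)
    finally show ?thesis .
  qed
  have L0: "0 \<le> L" unfolding L_def by (intro sum_nonneg B)
  have "norm (\<kappa> x - \<kappa> y) \<le> L * norm (x - y)" for x y
  proof (rule differentiable_bound[of UNIV \<kappa> "\<lambda>y. frechet_derivative \<kappa> (at y)"])
    show "(\<kappa> has_derivative frechet_derivative \<kappa> (at x)) (at x within UNIV)" for x using d by simp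
    show "onorm (frechet_derivative \<kappa> (at x)) \<le> L" for x
      by (rule onorm_bound[OF L0 bd])
  qed auto
  with L0 bd show thesis by (intro that) auto
qed

lemma integrable_smooth_supp_scaleR:
  fixes f :: "real^'n \<Rightarrow> 'b::{banach, second_countable_topology}"
  assumes \<kappa>: "smooth_supp R \<kappa>" and f: "integrable lebesgue f"
  shows "integrable lebesgue (\<lambda>z. \<kappa> (x - z) *\<^sub>R f z)"
proof -
  obtain B where B: "0 \<le> B" "\<And>y. \<bar>\<kappa> y\<bar> \<le> B" by (rule smooth_supp_bounded[OF \<kappa>]) blast
  have "continuous_on UNIV (\<lambda>z. \<kappa> (x - z))"
    by (rule continuous_on_compose2[OF smooth_supp_continuous[OF \<kappa>]]) (auto intro!: continuous_intros)
  then have m: "(\<lambda>z. \<kappa> (x - z)) \<in> borel_measurable lebesgue" by (rule borel_measurable_lebesgue_continuous)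
  show ?thesis
  proof (rule Bochner_Integration.integrable_bound[OF integrable_scaleR_right[OF f, of B]])
    show "(\<lambda>z. \<kappa> (x - z) *\<^sub>R f z) \<in> borel_measurable lebesgue"
      by (rule borel_measurable_scaleR[OF m borel_measurable_integrable[OF f]])
    show "AE z in lebesgue. norm (\<kappa> (x - z) *\<^sub>R f z) \<le> norm (B *\<^sub>R f z)"
      using B by (intro AE_I2) (auto intro!: mult_right_mono)
  qed
qed

text \<open>Differentiation under the integral sign. The remainder quotients of \<open>\<kappa>\<close> tend to 0 pointwise and
  are bounded by twice its Lipschitz constant, so dominated convergence applies along every
  sequence.\<close>

lemma conv_has_derivative:
  assumes \<kappa>: "smooth_supp R \<kappa>" and f: "integrable lebesgue f"
  shows "(conv \<kappa> f has_derivative (\<lambda>h. \<Sum>j\<in>UNIV. (h $ j) *\<^sub>R conv (partial j \<kappa>) f x)) (at x)"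
proof -
  obtain L where L: "0 \<le> L" "\<And>y h. norm (frechet_derivative \<kappa> (at y) h) \<le> L * norm h"
    "\<And>x y. norm (\<kappa> x - \<kappa> y) \<le> L * norm (x - y)" by (rule smooth_supp_derivative_bound[OF \<kappa>]) blast
  have d: "(\<kappa> has_derivative frechet_derivative \<kappa> (at y)) (at y)" for y
    using \<kappa> unfolding smooth_supp_def by (intro has_derivative_frechet smooth_on_differentiable[of _ UNIV]) auto
  have fd: "frechet_derivative \<kappa> (at y) h = (\<Sum>j\<in>UNIV. (h $ j) * partial j \<kappa> y)" for y h
    unfolding partial_def using linear_axis_expansion[OF has_derivative_linear[OF d[of y]], of h] by simp
  have int: "integrable lebesgue (\<lambda>z. frechet_derivative \<kappa> (at (x - z)) h *\<^sub>R f z)" for h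
    unfolding fd scaleR_sum_left scaleR_scaleR[symmetric]
    by (intro Bochner_Integration.integrable_sum integrable_scaleR_right integrable_smooth_supp_scaleR[OF smooth_supp_partial[OF \<kappa>] f])
  have eq: "(\<Sum>j\<in>UNIV. (h $ j) *\<^sub>R conv (partial j \<kappa>) f x) = (LINT z|lebesgue. frechet_derivative \<kappa> (at (x - z)) h *\<^sub>R f z)" for h
    unfolding fd scaleR_sum_left scaleR_scaleR[symmetric] conv_def
    by (subst Bochner_Integration.integral_sum,
        intro integrable_scaleR_right integrable_smooth_supp_scaleR[OF smooth_supp_partial[OF \<kappa>] f], simp only: integral_scaleR_right)
  have bl: "bounded_linear (\<lambda>h. \<Sum>j\<in>UNIV. (h $ j) *\<^sub>R conv (partial j \<kappa>) f x)"
    by (intro bounded_linear_sum bounded_linear_scaleR_const bounded_linear_vec_nth)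
  have "((\<lambda>y. norm (conv \<kappa> f y - conv \<kappa> f x - (\<Sum>j\<in>UNIV. ((y - x) $ j) *\<^sub>R conv (partial j \<kappa>) f x)) / norm (y - x)) \<longlongrightarrow> 0) (at x)"
    unfolding tendsto_at_iff_sequentially
  proof (intro allI impI)
    fix X assume X: "\<forall>i. X i \<in> UNIV - {x}" "X \<longlonglongrightarrow> x"
    then have ne: "norm (X n - x) > 0" for n by auto
    define q where "q n z = (\<kappa> (X n - z) - \<kappa> (x - z) - frechet_derivative \<kappa> (at (x - z)) (X n - x)) / norm (X n - x)" for n z
    have qint: "integrable lebesgue (\<lambda>z. q n z *\<^sub>R f z)" for n
    proof -
      have "integrable lebesgue (\<lambda>z. (1 / norm (X n - x)) *\<^sub>R (\<kappa> (X n - z) *\<^sub>R f z - \<kappa> (x - z) *\<^sub>R f z - frechet_derivative \<kappa> (at (x - z)) (X n - x) *\<^sub>R f z))"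
        by (intro integrable_scaleR_right Bochner_Integration.integrable_diff int integrable_smooth_supp_scaleR[OF \<kappa> f])
      then show ?thesis unfolding q_def by (simp add: scaleR_diff_left[symmetric])
    qed
    have qle: "norm (q n z *\<^sub>R f z) \<le> 2 * L * norm (f z)" for n z
    proof -
      have "\<bar>\<kappa> (X n - z) - \<kappa> (x - z) - frechet_derivative \<kappa> (at (x - z)) (X n - x)\<bar> \<le> 2 * L * norm (X n - x)"
        using L(3)[of "X n - z" "x - z"] L(2)[of "x - z" "X n - x"] by (simp add: abs_le_iff)
      then have "\<bar>q n z\<bar> \<le> 2 * L" unfolding q_def abs_divide using ne[of n] by (simp add: divide_le_eq)
      then show ?thesis unfolding norm_scaleR by (intro mult_right_mono) auto
    qed
    have q0: "(\<lambda>n. q n z *\<^sub>R f z) \<longlonglongrightarrow> 0" for z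
    proof -
      have "((\<lambda>y. norm (\<kappa> y - \<kappa> (x - z) - frechet_derivative \<kappa> (at (x - z)) (y - (x - z))) / norm (y - (x - z))) \<longlongrightarrow> 0) (at (x - z))"
        using d[of "x - z"] unfolding has_derivative_iff_norm by simp
      moreover have "filterlim (\<lambda>n. X n - z) (at (x - z)) sequentially"
        unfolding filterlim_at using X by (auto intro!: tendsto_intros)
      ultimately have "(\<lambda>n. norm (\<kappa> (X n - z) - \<kappa> (x - z) - frechet_derivative \<kappa> (at (x - z)) (X n - z - (x - z))) / norm (X n - z - (x - z))) \<longlonglongrightarrow> 0"
        by (rule filterlim_compose)
      then have "(\<lambda>n. norm (q n z)) \<longlonglongrightarrow> 0" by (simp add: q_def)
      then have q0: "(\<lambda>n. q n z) \<longlonglongrightarrow> 0" by (rule tendsto_norm_zero_cancel)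
      then show ?thesis using tendsto_scaleR[OF q0 tendsto_const[of "f z"]] by simp
    qed
    have "(\<lambda>n. LINT z|lebesgue. q n z *\<^sub>R f z) \<longlonglongrightarrow> (LINT z|(lebesgue :: (real^'a) measure). 0)"
    proof (rule integral_dominated_convergence[where w="\<lambda>z. 2 * L * norm (f z)"])
      show "integrable lebesgue (\<lambda>z. 2 * L * norm (f z))" by (intro integrable_mult_right integrable_norm f)
      show "(\<lambda>z. q n z *\<^sub>R f z) \<in> borel_measurable lebesgue" for n by (rule borel_measurable_integrable[OF qint])
      show "AE z in lebesgue. (\<lambda>n. q n z *\<^sub>R f z) \<longlonglongrightarrow> 0" by (rule AE_I2) (rule q0)
      show "AE z in lebesgue. norm (q n z *\<^sub>R f z) \<le> 2 * L * norm (f z)" for n by (rule AE_I2) (rule qle)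
    qed simp
    then have "(\<lambda>n. norm (LINT z|lebesgue. q n z *\<^sub>R f z)) \<longlonglongrightarrow> 0" using tendsto_norm_zero by fastforce
    moreover have "norm (LINT z|lebesgue. q n z *\<^sub>R f z) =
      norm (conv \<kappa> f (X n) - conv \<kappa> f x - (\<Sum>j\<in>UNIV. ((X n - x) $ j) *\<^sub>R conv (partial j \<kappa>) f x)) / norm (X n - x)" for n
    proof -
      have "conv \<kappa> f (X n) - conv \<kappa> f x - (\<Sum>j\<in>UNIV. ((X n - x) $ j) *\<^sub>R conv (partial j \<kappa>) f x)
        = (LINT z|lebesgue. \<kappa> (X n - z) *\<^sub>R f z - \<kappa> (x - z) *\<^sub>R f z - frechet_derivative \<kappa> (at (x - z)) (X n - x) *\<^sub>R f z)"
        unfolding eq unfolding conv_def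
        by (subst Bochner_Integration.integral_diff, (intro Bochner_Integration.integrable_diff int integrable_smooth_supp_scaleR[OF \<kappa> f])+)+ rule
      also have "\<dots> = (LINT z|lebesgue. norm (X n - x) *\<^sub>R q n z *\<^sub>R f z)"
        unfolding q_def using ne[of n] by (simp add: scaleR_diff_left)
      also have "\<dots> = norm (X n - x) *\<^sub>R (LINT z|lebesgue. q n z *\<^sub>R f z)" by (rule integral_scaleR_right)
      finally show ?thesis using ne[of n] by simp
    qed
    ultimately show "((\<lambda>y. norm (conv \<kappa> f y - conv \<kappa> f x - (\<Sum>j\<in>UNIV. ((y - x) $ j) *\<^sub>R conv (partial j \<kappa>) f x)) / norm (y - x)) \<circ> X) \<longlonglongrightarrow> 0"
      by (simp add: comp_def)
  qed
  then show ?thesis unfolding has_derivative_iff_norm using bl by simp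
qed

lemma partial_conv:
  assumes "smooth_supp R \<kappa>" "integrable lebesgue f"
  shows "partial j (conv \<kappa> f) x = conv (partial j \<kappa>) f x"
proof -
  have "partial j (conv \<kappa> f) x = (\<Sum>i\<in>UNIV. (axis j 1 $ i) *\<^sub>R conv (partial i \<kappa>) f x)"
    unfolding partial_def frechet_eq[OF conv_has_derivative[OF assms]] ..
  also have "\<dots> = (\<Sum>i\<in>UNIV. if i = j then conv (partial i \<kappa>) f x else 0)"
    by (intro sum.cong) (auto simp: axis_def)
  finally show ?thesis by simp
qed

lemma smooth_conv:
  assumes "smooth_supp R \<kappa>" "integrable lebesgue f"
  shows "smooth_on (conv \<kappa> f) UNIV"
proof -
  have "Ck_on k (conv \<kappa> f) UNIV" for k
    using assms(1)
  proof (induction k arbitrary: \<kappa>)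
    case 0
    show ?case unfolding Ck_on.simps
      using has_derivative_continuous[OF conv_has_derivative[OF 0 assms(2)]]
      by (simp add: continuous_on_eq_continuous_at)
  next
    case (Suc k)
    have "frechet_derivative (conv \<kappa> f) (at x) (axis j 1) = conv (partial j \<kappa>) f x" for x j
      using partial_conv[OF Suc.prems assms(2), of j x] unfolding partial_def .
    then show ?case
      using conv_has_derivative[OF Suc.prems assms(2)] Suc.IH[OF smooth_supp_partial[OF Suc.prems]]
      by (auto simp: differentiable_def)
  qed
  then show ?thesis by (simp add: smooth_on_def)
qed

definition scaled_bump :: "real \<Rightarrow> real^'n \<Rightarrow> real"
  where "scaled_bump \<epsilon> y = bump_kernel (y /\<^sub>R \<epsilon>) / \<epsilon> ^ CARD('n)"

lemma mollify_conv: "mollify bump_kernel \<epsilon> f = conv (scaled_bump \<epsilon>) f"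
  by (simp add: fun_eq_iff mollify_def conv_def scaled_bump_def)

lemma smooth_supp_scaled_bump:
  assumes "\<epsilon> > 0"
  shows "smooth_supp \<epsilon> (scaled_bump \<epsilon> :: real^'n \<Rightarrow> real)"
  unfolding smooth_supp_def smooth_on_def
proof (intro conjI allI impI)
  fix k
  have "Ck_on k (\<lambda>y. bump_kernel (0 + inverse \<epsilon> *\<^sub>R y) / \<epsilon> ^ CARD('n)) (UNIV :: (real^'n) set)"
    using smooth_bump_kernel unfolding smooth_on_def
    by (intro Ck_on_bounded_linear[OF open_UNIV bounded_linear_divide] Ck_on_affine) auto
  then show "Ck_on k (scaled_bump \<epsilon>) (UNIV :: (real^'n) set)" by (simp add: scaled_bump_def[abs_def])
next
  fix y :: "real^'n" assume "\<epsilon> < norm y"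
  then have "1 \<le> norm (y /\<^sub>R \<epsilon>)" using assms by (simp add: divide_simps)
  from bump_kernel.k_support[OF this] show "scaled_bump \<epsilon> y = 0" unfolding scaled_bump_def by simp
qed

section \<open>Integration over the sphere\<close>

text \<open>Scaling by a constant is rewritten as a density, for which integration rules are available.\<close>

lemma sphere_measure_density:
  "(sphere_measure :: (real^'n) measure) = density (distr (restrict_space lborel (ball 0 1 - {0}))
    (restrict_space borel (sphere 0 1)) sgn) (\<lambda>_. ennreal (real CARD('n)))"
  unfolding sphere_measure_def
  by (rule measure_eqI) (auto simp: emeasure_density_const ennreal_of_nat_eq_real_of_nat)

lemma sgn_sphere_measurable:
  "sgn \<in> restrict_space lborel (ball (0::real^'n) 1 - {0}) \<rightarrow>\<^sub>M restrict_space borel (sphere 0 1)"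
  by (rule measurable_restrict_space2) (auto simp: space_restrict_space norm_sgn intro!: measurable_restrict_space1)

lemma integrable_scaleR_iff:
  fixes f :: "'a \<Rightarrow> 'b::{banach, second_countable_topology}"
  assumes "c \<noteq> 0"
  shows "integrable M (\<lambda>x. c *\<^sub>R f x) \<longleftrightarrow> integrable M f"
proof
  assume "integrable M (\<lambda>x. c *\<^sub>R f x)"
  then have "integrable M (\<lambda>x. (1 / c) *\<^sub>R c *\<^sub>R f x)" by (rule integrable_scaleR_right)
  then show "integrable M f" using assms by simp
qed (rule integrable_scaleR_right)

lemma AE_lebesgue_neq: "AE y in lebesgue. y \<noteq> (a::'a::euclidean_space)"
  by (rule AE_completion) (rule AE_lborel_singleton)

text \<open>An integral over the sphere is \<open>n\<close> times the integral over the unit ball of the extension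
  that is constant along rays. This reduction takes the place of polar coordinates.\<close>

lemma
  fixes h :: "real^'n \<Rightarrow> 'b::{banach, second_countable_topology}"
  assumes h [measurable]: "h \<in> borel_measurable borel"
  shows integrable_sphere_measure_iff:
      "integrable sphere_measure h \<longleftrightarrow> integrable lebesgue (\<lambda>y. indicator (ball 0 1) y *\<^sub>R h (sgn y))" (is ?A)
    and integral_sphere_measure:
      "(LINT \<eta>|sphere_measure. h \<eta>) = real CARD('n) *\<^sub>R (LINT y|lebesgue. indicator (ball 0 1) y *\<^sub>R h (sgn y))" (is ?B)
proof -
  let ?M = "restrict_space lborel (ball (0::real^'n) 1 - {0})"
  let ?N = "restrict_space borel (sphere (0::real^'n) 1)"
  have hN: "h \<in> borel_measurable ?N" by (intro measurable_restrict_space1 h)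
  have hD: "h \<in> borel_measurable (distr ?M ?N sgn)" using hN by simp
  have s: "(ball (0::real^'n) 1 - {0}) \<inter> space lborel \<in> sets lborel" by simp
  have hs: "(\<lambda>y. h (sgn y)) \<in> borel_measurable borel" by (rule measurable_compose[OF borel_measurable_sgn h])
  have eq: "(\<lambda>y. indicator (ball 0 1 - {0}) y *\<^sub>R h (sgn y)) \<in> borel_measurable lborel"
    "(\<lambda>y. indicator (ball 0 1) y *\<^sub>R h (sgn y)) \<in> borel_measurable lborel"
    unfolding measurable_lborel1 by (intro borel_measurable_scaleR borel_measurable_indicator hs; simp)+
  have ae: "AE y in lborel. indicator (ball 0 1 - {0}) y *\<^sub>R h (sgn y) = indicator (ball 0 1) y *\<^sub>R h (sgn y)"
    using AE_lborel_singleton[of "0::real^'n"] by eventually_elim (auto simp: indicator_def)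
  have "integrable sphere_measure h \<longleftrightarrow> integrable (distr ?M ?N sgn) (\<lambda>y. real CARD('n) *\<^sub>R h y)"
    unfolding sphere_measure_density by (rule integrable_density[OF hD]) auto
  also have "\<dots> \<longleftrightarrow> integrable ?M (\<lambda>y. real CARD('n) *\<^sub>R h (sgn y))"
    by (rule integrable_distr_eq[OF sgn_sphere_measurable]) (intro borel_measurable_scaleR borel_measurable_const hN)
  also have "\<dots> \<longleftrightarrow> integrable ?M (\<lambda>y. h (sgn y))" by (rule integrable_scaleR_iff) simp
  also have "\<dots> \<longleftrightarrow> integrable lborel (\<lambda>y. indicator (ball 0 1 - {0}) y *\<^sub>R h (sgn y))"
    by (rule integrable_restrict_space[OF s])
  also have "\<dots> \<longleftrightarrow> integrable lborel (\<lambda>y. indicator (ball 0 1) y *\<^sub>R h (sgn y))"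
    by (rule integrable_cong_AE[OF eq ae])
  also have "\<dots> \<longleftrightarrow> integrable lebesgue (\<lambda>y. indicator (ball 0 1) y *\<^sub>R h (sgn y))"
    by (rule integrable_completion[OF eq(2), symmetric])
  finally show ?A .
  have "(LINT \<eta>|sphere_measure. h \<eta>) = (LINT y|distr ?M ?N sgn. real CARD('n) *\<^sub>R h y)"
    unfolding sphere_measure_density by (rule integral_density[OF hD]) auto
  also have "\<dots> = (LINT y|?M. real CARD('n) *\<^sub>R h (sgn y))"
    by (rule integral_distr[OF sgn_sphere_measurable]) (intro borel_measurable_scaleR borel_measurable_const hN)
  also have "\<dots> = real CARD('n) *\<^sub>R (LINT y|?M. h (sgn y))" by (rule integral_scaleR_right)
  also have "(LINT y|?M. h (sgn y)) = (LINT y|lborel. indicator (ball 0 1 - {0}) y *\<^sub>R h (sgn y))"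
    by (rule integral_restrict_space[OF s])
  also have "\<dots> = (LINT y|lborel. indicator (ball 0 1) y *\<^sub>R h (sgn y))"
    by (rule integral_cong_AE[OF eq ae])
  also have "\<dots> = (LINT y|lebesgue. indicator (ball 0 1) y *\<^sub>R h (sgn y))"
    by (rule integral_completion[OF eq(2), symmetric])
  finally show ?B .
qed

lemma integrable_indicator_bounded:
  fixes h :: "'a::euclidean_space \<Rightarrow> 'b::{banach, second_countable_topology}"
  assumes "h \<in> borel_measurable lebesgue" "A \<in> lmeasurable" "\<And>y. y \<in> A \<Longrightarrow> norm (h y) \<le> B"
  shows "integrable lebesgue (\<lambda>y. indicator A y *\<^sub>R h y)"
proof (rule Bochner_Integration.integrable_bound)
  have A: "A \<in> sets lebesgue" "emeasure lebesgue A < \<infinity>" using assms(2) unfolding fmeasurable_def by auto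
  show "integrable lebesgue (\<lambda>y. indicat_real A y * B)" using A by (intro integrable_mult_left integrable_real_indicator) auto
  show "(\<lambda>y. indicator A y *\<^sub>R h y) \<in> borel_measurable lebesgue" by (intro borel_measurable_scaleR borel_measurable_indicator A assms(1))
  show "AE y in lebesgue. norm (indicator A y *\<^sub>R h y) \<le> norm (indicator A y * B)"
    using assms(3) by (intro AE_I2) (auto simp: indicator_def intro: order_trans[OF _ abs_ge_self])
qed

lemma continuous_compact_bound:
  fixes h :: "'a::topological_space \<Rightarrow> 'b::real_normed_vector"
  assumes "continuous_on S h" "compact S"
  shows "\<exists>B. \<forall>y\<in>S. norm (h y) \<le> B"
proof -
  have "bounded (h ` S)" by (rule compact_imp_bounded[OF compact_continuous_image[OF assms]])
  then obtain B where "\<forall>x\<in>h ` S. norm x \<le> B" unfolding bounded_iff ..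
  then show ?thesis by (intro exI[of _ B]) simp
qed

lemma integrable_indicator_continuous:
  fixes h :: "'a::euclidean_space \<Rightarrow> 'b::{banach, second_countable_topology}"
  assumes h: "continuous_on UNIV h" and A: "A \<in> lmeasurable" "bounded A"
  shows "integrable lebesgue (\<lambda>y. indicator A y *\<^sub>R h y)"
proof -
  have "compact (closure A)" using A(2) by simp
  from continuous_compact_bound[OF continuous_on_subset[OF h subset_UNIV] this]
  obtain B where "\<forall>y\<in>closure A. norm (h y) \<le> B" ..
  then have B: "norm (h y) \<le> B" if "y \<in> closure A" for y using that by (rule bspec)
  show ?thesis
    by (rule integrable_indicator_bounded[OF borel_measurable_lebesgue_continuous[OF h] A(1) B])
      (rule subsetD[OF closure_subset])
qed

lemma integrable_sphere_measure_continuous: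
  fixes h :: "real^'n \<Rightarrow> 'b::{banach, second_countable_topology}"
  assumes h: "continuous_on UNIV h"
  shows "integrable sphere_measure h"
    and integrable_ball_sgn: "integrable lebesgue (\<lambda>y. indicator (ball 0 s) y *\<^sub>R h (sgn y))"
proof -
  have hb: "h \<in> borel_measurable borel" by (rule borel_measurable_continuous_onI[OF h])
  from continuous_compact_bound[OF continuous_on_subset[OF h subset_UNIV] compact_cball[of 0 1]]
  obtain B where "\<forall>y\<in>cball 0 1. norm (h y) \<le> B" ..
  then have B: "norm (h y) \<le> B" if "y \<in> cball 0 1" for y using that by (rule bspec)
  show *: "integrable lebesgue (\<lambda>y. indicator (ball 0 s) y *\<^sub>R h (sgn y))" for s
  proof (rule integrable_indicator_bounded)
    have "(\<lambda>y. h (sgn y)) \<in> borel_measurable borel" by (rule measurable_compose[OF borel_measurable_sgn hb])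
    then show "(\<lambda>y. h (sgn y)) \<in> borel_measurable lebesgue" by (simp add: measurable_completion)
    show "norm (h (sgn y)) \<le> B" for y :: "real^'n" by (rule B) (simp add: norm_sgn)
  qed simp
  show "integrable sphere_measure h" unfolding integrable_sphere_measure_iff[OF hb] by (rule *)
qed

text \<open>The integrand is constant along rays, so shrinking the ball only changes the volume factor.\<close>

lemma integral_ball_sgn:
  fixes h :: "real^'n \<Rightarrow> 'b::{banach, second_countable_topology}"
  assumes s: "0 < s"
  shows "(LINT y|lebesgue. indicator (ball 0 s) y *\<^sub>R h (sgn y)) = s ^ CARD('n) *\<^sub>R (LINT y|lebesgue. indicator (ball 0 1) y *\<^sub>R h (sgn y))"
proof -
  have "indicator (ball 0 s) (s *\<^sub>R y) *\<^sub>R h (sgn (s *\<^sub>R y)) = indicator (ball 0 1) y *\<^sub>R h (sgn y)" for y :: "real^'n"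
    using s by (auto simp: indicator_def sgn_scaleR)
  then show ?thesis
    using integral_lebesgue_affine[of s "\<lambda>y. indicator (ball 0 s) y *\<^sub>R h (sgn y)" 0] s by simp
qed

section \<open>The divergence theorem on balls\<close>

text \<open>By translation invariance each difference quotient of \<open>G\<close> in direction \<open>e\<close> has integral 0. They
  are bounded by the Lipschitz constant on a fixed bounded set and converge almost everywhere to
  the derivative. The null set on which \<open>G\<close> may fail to be differentiable makes room for cutoffs with
  kinks.\<close>

lemma integral_partial_Lipschitz:
  fixes G G' :: "'a::euclidean_space \<Rightarrow> 'b::{banach, second_countable_topology}"
  assumes lip: "\<And>x y. norm (G x - G y) \<le> L * norm (x - y)" and supp: "\<And>y. R \<le> norm y \<Longrightarrow> G y = 0"
    and e: "norm e = 1"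
    and der: "AE y in lebesgue. \<exists>F. (G has_derivative F) (at y) \<and> F e = G' y"
    and meas: "G' \<in> borel_measurable lebesgue"
  shows "integrable lebesgue G'" "(LINT y|lebesgue. G' y) = 0"
proof -
  have L: "0 \<le> L" using lip[of e 0] e order_trans[OF norm_ge_zero] by auto
  have "L-lipschitz_on UNIV G" by (rule lipschitz_onI) (use lip L in \<open>auto simp: dist_norm\<close>)
  then have cont: "continuous_on UNIV G" by (rule lipschitz_on_continuous_on)
  have "integrable lebesgue (\<lambda>y. indicator (cball 0 R) y *\<^sub>R G y)"
    by (rule integrable_indicator_continuous[OF cont]) auto
  moreover have "(\<lambda>y. indicator (cball 0 R) y *\<^sub>R G y) = G"
    using supp by (auto simp: fun_eq_iff indicator_def)
  ultimately have Gint: "integrable lebesgue G" by simp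
  define t where "t n = 1 / real (Suc n)" for n
  have t: "0 < t n" "t n \<le> 1" for n by (auto simp: t_def)
  have tlim: "t \<longlonglongrightarrow> 0" unfolding t_def using LIMSEQ_Suc[OF lim_1_over_n[where 'a=real]] by simp
  define Q where "Q n y = (G (y + t n *\<^sub>R e) - G y) /\<^sub>R t n" for n y
  have Gt: "integrable lebesgue (\<lambda>y. G (y + t n *\<^sub>R e))" for n
    using integrable_lebesgue_affine[OF Gint, of 1 "t n *\<^sub>R e"] by (simp add: add.commute)
  have Qint: "integrable lebesgue (Q n)" for n
    unfolding Q_def by (intro integrable_scaleR_right Bochner_Integration.integrable_diff Gt Gint)
  have Q0: "(LINT y|lebesgue. Q n y) = 0" for n
  proof -
    have "(LINT y|lebesgue. G (y + t n *\<^sub>R e)) = (LINT y|lebesgue. G y)"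
      using integral_lebesgue_affine[of 1 G "t n *\<^sub>R e"] by (simp add: add.commute)
    then show ?thesis unfolding Q_def using Gt[of n] Gint by simp
  qed
  have Qlim: "AE y in lebesgue. (\<lambda>n. Q n y) \<longlonglongrightarrow> G' y"
    using der
  proof eventually_elim
    fix y assume "\<exists>F. (G has_derivative F) (at y) \<and> F e = G' y"
    then obtain F where F: "(G has_derivative F) (at y)" "F e = G' y" by blast
    have "((\<lambda>s. y + s *\<^sub>R e) has_derivative (\<lambda>s. s *\<^sub>R e)) (at 0)" by (auto intro!: derivative_eq_intros)
    moreover have "(G has_derivative F) (at (y + 0 *\<^sub>R e))" using F by simp
    ultimately have "((\<lambda>s. G (y + s *\<^sub>R e)) has_derivative (\<lambda>s. F (s *\<^sub>R e))) (at 0)" by (rule has_derivative_compose)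
    then have "((\<lambda>s. norm (G (y + s *\<^sub>R e) - G (y + 0 *\<^sub>R e) - F ((s - 0) *\<^sub>R e)) / norm (s - 0)) \<longlongrightarrow> 0) (at 0)"
      unfolding has_derivative_iff_norm by blast
    moreover have "filterlim t (at 0) sequentially"
      unfolding filterlim_at using tlim less_imp_neq[OF t(1), symmetric] by simp
    ultimately have "(\<lambda>n. norm (G (y + t n *\<^sub>R e) - G (y + 0 *\<^sub>R e) - F ((t n - 0) *\<^sub>R e)) / norm (t n - 0)) \<longlonglongrightarrow> 0"
      by (rule filterlim_compose)
    moreover have "norm (G (y + t n *\<^sub>R e) - G (y + 0 *\<^sub>R e) - F ((t n - 0) *\<^sub>R e)) / norm (t n - 0) = norm (Q n y - G' y)" for n
    proof -
      have "Q n y - G' y = (G (y + t n *\<^sub>R e) - G (y + 0 *\<^sub>R e) - F ((t n - 0) *\<^sub>R e)) /\<^sub>R t n"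
        using t(1)[of n] linear_scale[OF has_derivative_linear[OF F(1)], of "t n" e] F(2)
        by (simp add: Q_def scaleR_diff_right)
      then show ?thesis using t(1)[of n] by (simp add: divide_inverse mult.commute)
    qed
    ultimately have "(\<lambda>n. norm (Q n y - G' y)) \<longlonglongrightarrow> 0" by simp
    then show "(\<lambda>n. Q n y) \<longlonglongrightarrow> G' y" by (rule LIM_zero_cancel[OF tendsto_norm_zero_cancel])
  qed
  have Qle: "norm (Q n y) \<le> indicator (cball 0 (\<bar>R\<bar> + 1)) y * L" for n y
  proof (cases "y \<in> cball 0 (\<bar>R\<bar> + 1)")
    case True
    have "norm (G (y + t n *\<^sub>R e) - G y) \<le> L * t n" using lip[of "y + t n *\<^sub>R e" y] t(1)[of n] e by simp
    then show ?thesis using True t(1)[of n] by (simp add: Q_def divide_simps mult.commute)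
  next
    case False
    then have "R \<le> norm y" by auto
    moreover have "R \<le> norm (y + t n *\<^sub>R e)"
      using False norm_triangle_ineq4[of "y + t n *\<^sub>R e" "t n *\<^sub>R e"] t[of n] e by simp
    ultimately show ?thesis using L by (simp add: Q_def supp)
  qed
  have dom: "integrable lebesgue (\<lambda>y. indicat_real (cball 0 (\<bar>R\<bar> + 1)) y * L)"
    using integrable_indicator_continuous[of "\<lambda>_. L" "cball 0 (\<bar>R\<bar> + 1)"] by simp
  show "integrable lebesgue G'"
    by (rule integrable_dominated_convergence[OF meas borel_measurable_integrable[OF Qint] dom Qlim]) (use Qle in auto)
  have "(\<lambda>n. LINT y|lebesgue. Q n y) \<longlonglongrightarrow> (LINT y|lebesgue. G' y)"
    by (rule integral_dominated_convergence[OF meas borel_measurable_integrable[OF Qint] dom Qlim]) (use Qle in auto)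
  then show "(LINT y|lebesgue. G' y) = 0" unfolding Q0 using LIMSEQ_unique tendsto_const by blast
qed

lemma Ck1_partial_continuous: "Ck_on (Suc 0) w UNIV \<Longrightarrow> continuous_on UNIV (partial j w)"
  unfolding partial_def[abs_def] by simp

lemma Ck1_derivative: "Ck_on (Suc 0) w UNIV \<Longrightarrow> (w has_derivative frechet_derivative w (at y)) (at y)"
  by (intro has_derivative_frechet) simp

lemma Ck1_Lipschitz:
  fixes w :: "real^'n \<Rightarrow> 'b::{banach, second_countable_topology}"
  assumes w: "Ck_on (Suc 0) w UNIV"
  obtains L where "0 \<le> L" "\<And>x y. x \<in> cball 0 1 \<Longrightarrow> y \<in> cball 0 1 \<Longrightarrow> norm (w x - w y) \<le> L * norm (x - y)"
proof -
  have "\<exists>B. \<forall>y\<in>cball 0 1. norm (partial j w y) \<le> B" for j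
    by (rule continuous_compact_bound[OF continuous_on_subset[OF Ck1_partial_continuous[OF w] subset_UNIV] compact_cball])
  then obtain B where B: "\<And>j y. y \<in> cball 0 1 \<Longrightarrow> norm (partial j w y) \<le> B j" by metis
  have B0: "0 \<le> B j" for j using B[of 0 j] order_trans[OF norm_ge_zero] by auto
  define L where "L = (\<Sum>j\<in>UNIV. B j)"
  have L0: "0 \<le> L" unfolding L_def by (intro sum_nonneg B0)
  have "norm (w x - w y) \<le> L * norm (x - y)" if "x \<in> cball 0 1" "y \<in> cball 0 1" for x y
  proof (rule differentiable_bound[of "cball 0 1" w "\<lambda>y. frechet_derivative w (at y)"])
    show "(w has_derivative frechet_derivative w (at x)) (at x within cball 0 1)" for x
      by (rule has_derivative_at_withinI[OF Ck1_derivative[OF w]])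
    fix x :: "real^'n" assume x: "x \<in> cball 0 1"
    show "onorm (frechet_derivative w (at x)) \<le> L"
    proof (rule onorm_bound[OF L0])
      fix h
      have "frechet_derivative w (at x) h = (\<Sum>j\<in>UNIV. (h $ j) *\<^sub>R partial j w x)"
        unfolding partial_def by (rule linear_axis_expansion[OF has_derivative_linear[OF Ck1_derivative[OF w]]])
      also have "norm \<dots> \<le> (\<Sum>j\<in>UNIV. norm h * B j)"
      proof (rule order_trans[OF norm_sum sum_mono])
        fix j
        show "norm ((h $ j) *\<^sub>R partial j w x) \<le> norm h * B j"
          unfolding norm_scaleR using B[OF x] component_le_norm_cart[of h j] by (intro mult_mono) auto
      qed
      also have "\<dots> = L * norm h" by (simp add: L_def sum_distrib_left mult.commute)
      finally show "norm (frechet_derivative w (at x) h) \<le> L * norm h" .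
    qed
  qed (use that in auto)
  with L0 show thesis by (rule that)
qed

text \<open>Equal to 1 up to radius \<open>1 - \<delta>\<close>, equal to 0 from radius 1 on, and linear in the radius in
  between. Its derivative is \<open>- sgn y / \<delta>\<close> on the shell, so that integrals over the shell
  approximate integrals over the sphere.\<close>

definition cutoff :: "real \<Rightarrow> 'a::real_normed_vector \<Rightarrow> real"
  where "cutoff \<delta> y = max 0 (min 1 ((1 - norm y) / \<delta>))"

lemma norm_indicator_scaleR_le:
  "\<bar>a\<bar> \<le> 1 \<Longrightarrow> norm (indicator A y *\<^sub>R (a *\<^sub>R v)) \<le> norm (indicator A y *\<^sub>R v)"
  by (simp add: indicator_def mult_left_le_one_le)

lemma cutoff_bounds: "0 \<le> cutoff \<delta> y" "cutoff \<delta> y \<le> 1"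
  by (auto simp: cutoff_def)

lemma cutoff_inner: "0 < \<delta> \<Longrightarrow> norm y \<le> 1 - \<delta> \<Longrightarrow> cutoff \<delta> y = 1"
  by (simp add: cutoff_def le_divide_eq)

lemma cutoff_shell: "0 < \<delta> \<Longrightarrow> 1 - \<delta> \<le> norm y \<Longrightarrow> norm y \<le> 1 \<Longrightarrow> cutoff \<delta> y = (1 - norm y) / \<delta>"
  by (simp add: cutoff_def min_def max_def divide_le_eq zero_le_divide_iff)

lemma cutoff_outer: "0 < \<delta> \<Longrightarrow> 1 \<le> norm y \<Longrightarrow> cutoff \<delta> y = 0"
  unfolding cutoff_def by (intro max_absorb1 min.coboundedI2) (simp add: divide_nonpos_pos)

lemma cutoff_continuous: "\<delta> > 0 \<Longrightarrow> continuous_on UNIV (cutoff \<delta>)"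
  unfolding cutoff_def[abs_def] by (intro continuous_intros) auto

lemma cutoff_Lipschitz:
  assumes "0 < \<delta>"
  shows "\<bar>cutoff \<delta> x - cutoff \<delta> y\<bar> \<le> norm (x - y) / \<delta>"
proof -
  have "\<bar>cutoff \<delta> x - cutoff \<delta> y\<bar> \<le> \<bar>(1 - norm x) / \<delta> - (1 - norm y) / \<delta>\<bar>"
    unfolding cutoff_def by linarith
  also have "(1 - norm x) / \<delta> - (1 - norm y) / \<delta> = (norm y - norm x) / \<delta>"
    by (simp add: diff_divide_distrib)
  also have "\<bar>(norm y - norm x) / \<delta>\<bar> \<le> norm (x - y) / \<delta>"
    using assms norm_triangle_ineq3[of y x] by (simp add: divide_right_mono norm_minus_commute)
  finally show ?thesis .
qed

text \<open>Only the behaviour of \<open>w\<close> on the closed unit ball matters. If one of the two points lies outside,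
  the cut off function vanishes there and its size at the other point is controlled by the Lipschitz
  estimate of the cutoff.\<close>

lemma cutoff_scaleR_Lipschitz:
  fixes w :: "real^'n \<Rightarrow> 'b::{banach, second_countable_topology}"
  assumes w: "Ck_on (Suc 0) w UNIV" and d: "0 < \<delta>"
  obtains L where "\<And>x y. norm (cutoff \<delta> x *\<^sub>R w x - cutoff \<delta> y *\<^sub>R w y) \<le> L * norm (x - y)"
proof -
  obtain L where L: "0 \<le> L" "\<And>x y. x \<in> cball 0 1 \<Longrightarrow> y \<in> cball 0 1 \<Longrightarrow> norm (w x - w y) \<le> L * norm (x - y)"
    by (rule Ck1_Lipschitz[OF w]) blast
  have "continuous_on UNIV w" using Ck_on_SucD[OF w] by simp
  from continuous_compact_bound[OF continuous_on_subset[OF this subset_UNIV] compact_cball[of 0 1]]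
  obtain M where "\<forall>y\<in>cball 0 1. norm (w y) \<le> M" ..
  then have M: "norm (w y) \<le> M" if "y \<in> cball 0 1" for y using that by (rule bspec)
  have M0: "0 \<le> M" using order_trans[OF norm_ge_zero M[of 0]] by simp
  let ?G = "\<lambda>y. cutoff \<delta> y *\<^sub>R w y"
  have outside: "norm (?G x - ?G y) \<le> (M / \<delta> + L) * norm (x - y)" if "x \<in> cball 0 1" "y \<notin> cball 0 1" for x y
  proof -
    have "?G y = 0" using that d by (simp add: cutoff_outer)
    then have "norm (?G x - ?G y) = \<bar>cutoff \<delta> x - cutoff \<delta> y\<bar> * norm (w x)"
      using that d by (simp add: cutoff_outer)
    also have "\<dots> \<le> norm (x - y) / \<delta> * M"
      using that d by (intro mult_mono cutoff_Lipschitz M) auto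
    also have "\<dots> \<le> (M / \<delta> + L) * norm (x - y)"
      using L(1) mult_nonneg_nonneg[OF L(1) norm_ge_zero[of "x - y"]] by (simp add: algebra_simps)
    finally show ?thesis .
  qed
  have "norm (?G x - ?G y) \<le> (M / \<delta> + L) * norm (x - y)" for x y
  proof (cases "x \<in> cball 0 1"; cases "y \<in> cball 0 1")
    assume xy: "x \<in> cball 0 1" "y \<in> cball 0 1"
    have "?G x - ?G y = (cutoff \<delta> x - cutoff \<delta> y) *\<^sub>R w x + cutoff \<delta> y *\<^sub>R (w x - w y)"
      by (simp add: algebra_simps)
    also have "norm \<dots> \<le> \<bar>cutoff \<delta> x - cutoff \<delta> y\<bar> * norm (w x) + cutoff \<delta> y * norm (w x - w y)"
      using norm_triangle_ineq[of "(cutoff \<delta> x - cutoff \<delta> y) *\<^sub>R w x" "cutoff \<delta> y *\<^sub>R (w x - w y)"] cutoff_bounds(1)[of \<delta> y]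
      by simp
    also have "\<dots> \<le> norm (x - y) / \<delta> * M + 1 * (L * norm (x - y))"
      using xy d M0 by (intro add_mono mult_mono cutoff_Lipschitz M L cutoff_bounds) auto
    also have "\<dots> = (M / \<delta> + L) * norm (x - y)" by (simp add: algebra_simps)
    finally show ?thesis .
  next
    assume xy: "x \<notin> cball 0 1" "y \<in> cball 0 1"
    then show ?thesis using outside[of y x] by (simp add: norm_minus_commute)
  next
    assume xy: "x \<notin> cball 0 1" "y \<notin> cball 0 1"
    then show ?thesis using d L(1) M0 by (simp add: cutoff_outer)
  qed (rule outside)
  then show thesis by (rule that)
qed

lemma borel_measurable_lebesgue_sgn_nth: "(\<lambda>y::real^'n. sgn y $ j) \<in> borel_measurable lebesgue"
proof -
  have "(\<lambda>y::real^'n. sgn y $ j) \<in> borel_measurable borel"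
    by (rule borel_measurable_continuous_onI[THEN measurable_compose[OF borel_measurable_sgn, of "\<lambda>y. y $ j"]])
      (intro continuous_intros)
  then show ?thesis by (simp add: measurable_completion)
qed

lemma integrable_ball_sgn_scaleR:
  fixes w :: "real^'n \<Rightarrow> 'b::{banach, second_countable_topology}"
  assumes w: "continuous_on UNIV w"
  shows "integrable lebesgue (\<lambda>y. indicator (ball 0 s) y *\<^sub>R ((sgn y $ j) *\<^sub>R w y))"
proof (rule Bochner_Integration.integrable_bound)
  show "integrable lebesgue (\<lambda>y. indicator (ball 0 s) y *\<^sub>R w y)"
    by (rule integrable_indicator_continuous[OF w]) auto
  show "(\<lambda>y. indicator (ball 0 s) y *\<^sub>R ((sgn y $ j) *\<^sub>R w y)) \<in> borel_measurable lebesgue"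
    by (intro borel_measurable_scaleR borel_measurable_indicator borel_measurable_lebesgue_sgn_nth
      borel_measurable_lebesgue_continuous w) simp
  have "\<bar>sgn y $ j\<bar> \<le> 1" for y :: "real^'n"
    using component_le_norm_cart[of "sgn y" j] by (auto simp: norm_sgn split: if_splits)
  then show "AE y in lebesgue. norm (indicator (ball 0 s) y *\<^sub>R ((sgn y $ j) *\<^sub>R w y)) \<le> norm (indicator (ball 0 s) y *\<^sub>R w y)"
    by (intro AE_I2 norm_indicator_scaleR_le)
qed

text \<open>Integration by parts for \<open>cutoff \<delta> y *\<^sub>R w y\<close>: this function is Lipschitz with compact support and
  differentiable off the two spheres that bound the shell.\<close>

lemma shell_identity:
  fixes w :: "real^'n \<Rightarrow> 'b::{banach, second_countable_topology}"
  assumes w: "Ck_on (Suc 0) w UNIV" and d: "0 < \<delta>" "\<delta> < 1"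
  shows "(LINT y|lebesgue. indicator (ball 0 1) y *\<^sub>R (cutoff \<delta> y *\<^sub>R partial j w y)) =
    (1 / \<delta>) *\<^sub>R ((LINT y|lebesgue. indicator (ball 0 1) y *\<^sub>R ((sgn y $ j) *\<^sub>R w y)) -
      (LINT y|lebesgue. indicator (ball 0 (1 - \<delta>)) y *\<^sub>R ((sgn y $ j) *\<^sub>R w y)))"
proof -
  define G where "G y = cutoff \<delta> y *\<^sub>R w y" for y
  define P where "P y = indicator (ball 0 1) y *\<^sub>R (cutoff \<delta> y *\<^sub>R partial j w y)" for y
  define Q where "Q s y = indicator (ball 0 s) y *\<^sub>R ((sgn y $ j) *\<^sub>R w y)" for s y
  define G' where "G' y = P y - (1 / \<delta>) *\<^sub>R (Q 1 y - Q (1 - \<delta>) y)" for y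
  have cw: "continuous_on UNIV w" using Ck_on_SucD[OF w] by simp
  have cp: "continuous_on UNIV (\<lambda>y. cutoff \<delta> y *\<^sub>R partial j w y)"
    by (intro continuous_on_scaleR cutoff_continuous Ck1_partial_continuous w d)
  have Pi: "integrable lebesgue P"
    unfolding P_def by (rule integrable_indicator_continuous[OF cp]) auto
  have Qi: "integrable lebesgue (Q s)" for s
    unfolding Q_def by (rule integrable_ball_sgn_scaleR[OF cw])
  have G'i: "integrable lebesgue G'"
    unfolding G'_def by (intro Bochner_Integration.integrable_diff integrable_scaleR_right Pi Qi)
  obtain L where L: "\<And>x y. norm (G x - G y) \<le> L * norm (x - y)"
    unfolding G_def by (rule cutoff_scaleR_Lipschitz[OF w d(1)]) blast
  have dw: "(w has_derivative frechet_derivative w (at y)) (at y)" for y by (rule Ck1_derivative[OF w])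
  have der: "\<exists>F. (G has_derivative F) (at y) \<and> F (axis j 1) = G' y" if ne: "norm y \<noteq> 1 - \<delta>" "norm y \<noteq> 1" for y
  proof -
    consider "norm y < 1 - \<delta>" | "1 - \<delta> < norm y" "norm y < 1" | "1 < norm y" using ne by linarith
    then show ?thesis
    proof cases
      case 1
      have "(G has_derivative frechet_derivative w (at y)) (at y)"
      proof (rule has_derivative_transform_within_open[OF dw, of "ball 0 (1 - \<delta>)"])
        show "w x = G x" if "x \<in> ball 0 (1 - \<delta>)" for x
          using that d by (simp add: G_def cutoff_inner)
      qed (use 1 in auto)
      moreover have "frechet_derivative w (at y) (axis j 1) = G' y"
        using 1 d by (simp add: G'_def P_def Q_def cutoff_inner partial_def)
      ultimately show ?thesis by blast
    next
      case 2
      then have y0: "y \<noteq> 0" using d by auto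
      have "((\<lambda>x. (1 - norm x) / \<delta>) has_derivative (\<lambda>h. - (h \<bullet> sgn y) / \<delta>)) (at y)"
        using has_derivative_norm[OF y0] d by (auto intro!: derivative_eq_intros)
      from has_derivative_scaleR[OF this dw]
      have "((\<lambda>x. ((1 - norm x) / \<delta>) *\<^sub>R w x) has_derivative
        (\<lambda>h. ((1 - norm y) / \<delta>) *\<^sub>R frechet_derivative w (at y) h + (- (h \<bullet> sgn y) / \<delta>) *\<^sub>R w y)) (at y)" .
      then have "(G has_derivative
        (\<lambda>h. ((1 - norm y) / \<delta>) *\<^sub>R frechet_derivative w (at y) h + (- (h \<bullet> sgn y) / \<delta>) *\<^sub>R w y)) (at y)"
      proof (rule has_derivative_transform_within_open[of _ _ y UNIV "ball 0 1 \<inter> - cball 0 (1 - \<delta>)"])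
        show "((1 - norm x) / \<delta>) *\<^sub>R w x = G x" if "x \<in> ball 0 1 \<inter> - cball 0 (1 - \<delta>)" for x
          using that d by (simp add: G_def cutoff_shell)
      qed (use 2 in auto)
      moreover have "((1 - norm y) / \<delta>) *\<^sub>R frechet_derivative w (at y) (axis j 1) + (- (axis j 1 \<bullet> sgn y) / \<delta>) *\<^sub>R w y = G' y"
        using 2 d by (simp add: G'_def P_def Q_def cutoff_shell partial_def inner_axis')
      ultimately show ?thesis by blast
    next
      case 3
      have "((\<lambda>x. 0) has_derivative (\<lambda>h. 0)) (at y)" by simp
      then have "(G has_derivative (\<lambda>h. 0)) (at y)"
      proof (rule has_derivative_transform_within_open[of _ _ y UNIV "- cball 0 1"])
        show "0 = G x" if "x \<in> - cball 0 1" for x using that d by (simp add: G_def cutoff_outer)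
      qed (use 3 in auto)
      moreover have "0 = G' y" using 3 d by (simp add: G'_def P_def Q_def)
      ultimately show ?thesis by blast
    qed
  qed
  have "AE y in lebesgue. y \<notin> sphere (0::real^'n) (1 - \<delta>) \<and> y \<notin> sphere (0::real^'n) 1"
    using AE_not_in[OF negligible_sphere[of "0::real^'n" "1 - \<delta>", unfolded negligible_iff_null_sets]]
      AE_not_in[OF negligible_sphere[of "0::real^'n" 1, unfolded negligible_iff_null_sets]]
    by (rule AE_conjI)
  then have ae: "AE y in lebesgue. \<exists>F. (G has_derivative F) (at y) \<and> F (axis j 1) = G' y"
    by eventually_elim (rule der; simp)
  have "(LINT y|lebesgue. G' y) = 0"
  proof (rule integral_partial_Lipschitz(2)[OF L _ _ ae borel_measurable_integrable[OF G'i]])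
    show "G y = 0" if "1 \<le> norm y" for y using that d by (simp add: G_def cutoff_outer)
    show "norm (axis j 1 :: real^'n) = 1" by (simp add: norm_axis_1)
  qed
  moreover have "(LINT y|lebesgue. G' y) = (LINT y|lebesgue. P y) - (1 / \<delta>) *\<^sub>R ((LINT y|lebesgue. Q 1 y) - (LINT y|lebesgue. Q (1 - \<delta>) y))"
    unfolding G'_def using Pi Qi by simp
  ultimately show ?thesis unfolding P_def Q_def by simp
qed

lemma shell_ratio_tendsto:
  assumes "\<And>m. (0::real) < d m" "d \<longlonglongrightarrow> 0"
  shows "(\<lambda>m. (1 - (1 - d m) ^ n) / d m) \<longlonglongrightarrow> real n"
proof -
  have "((\<lambda>x::real. (1 - x) ^ n) has_real_derivative - real n) (at 0)"
    by (auto intro!: derivative_eq_intros)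
  then have "((\<lambda>h::real. ((1 - (0 + h)) ^ n - (1 - 0) ^ n) / h) \<longlongrightarrow> - real n) (at 0)" unfolding DERIV_def .
  moreover have "filterlim d (at 0) sequentially"
    unfolding filterlim_at using assms(2) less_imp_neq[OF assms(1), symmetric] by simp
  ultimately have "(\<lambda>m. ((1 - (0 + d m)) ^ n - (1 - 0) ^ n) / d m) \<longlonglongrightarrow> - real n" by (rule filterlim_compose)
  from tendsto_minus[OF this] show ?thesis by (simp add: minus_divide_left)
qed

text \<open>Let \<open>\<delta>\<close> tend to 0 in the shell identity. On the shell \<open>w y\<close> differs from \<open>w (sgn y)\<close> by
  \<open>O(\<delta>)\<close>; the shell integral of the radially constant function is
  \<open>(1 - (1 - \<delta>) ^ n) / \<delta>\<close> times its integral over the ball, and that factor tends to \<open>n\<close>.\<close>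

lemma divergence_unit_ball:
  fixes w :: "real^'n \<Rightarrow> 'b::{banach, second_countable_topology}"
  assumes w: "Ck_on (Suc 0) w UNIV"
  shows "(LINT \<eta>|sphere_measure. (\<eta> $ j) *\<^sub>R w \<eta>) = (LINT y|lebesgue. indicator (ball 0 1) y *\<^sub>R partial j w y)"
proof -
  have cw: "continuous_on UNIV w" using Ck_on_SucD[OF w] by simp
  have cjw: "continuous_on UNIV (\<lambda>y. (y $ j) *\<^sub>R w y)" by (intro continuous_intros cw)
  define I where "I = (LINT y|lebesgue. indicator (ball 0 1) y *\<^sub>R ((sgn y $ j) *\<^sub>R w (sgn y)))"
  define d where "d m = 1 / real (m + 2)" for m :: nat
  have d: "0 < d m" "d m < 1" for m by (auto simp: d_def)
  have dlim: "d \<longlonglongrightarrow> 0" unfolding d_def using LIMSEQ_ignore_initial_segment[OF lim_1_over_n[where 'a=real], of 2] by simp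
  define A where "A m = (LINT y|lebesgue. indicator (ball 0 1) y *\<^sub>R (cutoff (d m) y *\<^sub>R partial j w y))" for m
  have Alim: "A \<longlonglongrightarrow> (LINT y|lebesgue. indicator (ball 0 1) y *\<^sub>R partial j w y)"
    unfolding A_def
  proof (rule integral_dominated_convergence[where w="\<lambda>y. norm (indicator (ball 0 1) y *\<^sub>R partial j w y)"])
    have i: "integrable lebesgue (\<lambda>y. indicator (ball 0 1) y *\<^sub>R partial j w y)"
      by (rule integrable_indicator_continuous[OF Ck1_partial_continuous[OF w]]) auto
    then show "(\<lambda>y. indicator (ball 0 1) y *\<^sub>R partial j w y) \<in> borel_measurable lebesgue"
      "integrable lebesgue (\<lambda>y. norm (indicator (ball 0 1) y *\<^sub>R partial j w y))"
      by (rule borel_measurable_integrable, rule integrable_norm)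
    show "(\<lambda>y. indicator (ball 0 1) y *\<^sub>R (cutoff (d m) y *\<^sub>R partial j w y)) \<in> borel_measurable lebesgue" for m
      by (intro borel_measurable_scaleR borel_measurable_indicator borel_measurable_lebesgue_continuous
        cutoff_continuous Ck1_partial_continuous w d) simp
    show "AE y in lebesgue. norm (indicator (ball 0 1) y *\<^sub>R (cutoff (d m) y *\<^sub>R partial j w y)) \<le> norm (indicator (ball 0 1) y *\<^sub>R partial j w y)" for m
      by (intro AE_I2 norm_indicator_scaleR_le) (simp add: cutoff_bounds)
    show "AE y in lebesgue. (\<lambda>m. indicator (ball 0 1) y *\<^sub>R (cutoff (d m) y *\<^sub>R partial j w y)) \<longlonglongrightarrow> indicator (ball 0 1) y *\<^sub>R partial j w y"
    proof (rule AE_I2)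
      fix y
      show "(\<lambda>m. indicator (ball 0 1) y *\<^sub>R (cutoff (d m) y *\<^sub>R partial j w y)) \<longlonglongrightarrow> indicator (ball 0 1) y *\<^sub>R partial j w y"
      proof (cases "y \<in> ball 0 1")
        case True
        then have "0 < 1 - norm y" by simp
        from order_tendstoD(2)[OF dlim this]
        have "\<forall>\<^sub>F m in sequentially. cutoff (d m) y = 1"
          by eventually_elim (use d in \<open>simp add: cutoff_inner\<close>)
        then show ?thesis by (intro tendsto_eventually) (auto elim: eventually_mono)
      qed simp
    qed
  qed
  obtain L where L: "0 \<le> L" "\<And>x y. x \<in> cball 0 1 \<Longrightarrow> y \<in> cball 0 1 \<Longrightarrow> norm (w x - w y) \<le> L * norm (x - y)"
    by (rule Ck1_Lipschitz[OF w]) blast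
  define b where "b = measure lebesgue (ball (0::real^'n) 1)"
  define c where "c m = (1 - (1 - d m) ^ CARD('n)) / d m" for m
  have Abound: "norm (A m - c m *\<^sub>R I) \<le> L * b * (c m * d m)" for m
  proof -
    \<comment> \<open>Here \<open>q'\<close> is \<open>q\<close> with \<open>w\<close> frozen along rays.\<close>
    define q where "q s y = indicator (ball 0 s) y *\<^sub>R ((sgn y $ j) *\<^sub>R w y)" for s y
    define q' where "q' s y = indicator (ball 0 s) y *\<^sub>R ((sgn y $ j) *\<^sub>R w (sgn y))" for s y
    have qi: "integrable lebesgue (q s)" for s unfolding q_def by (rule integrable_ball_sgn_scaleR[OF cw])
    have q'i: "integrable lebesgue (q' s)" for s unfolding q'_def by (rule integrable_ball_sgn[OF cjw])
    have "(LINT y|lebesgue. q' (1 - d m) y) = (1 - d m) ^ CARD('n) *\<^sub>R I"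
      unfolding q'_def I_def using d[of m] by (intro integral_ball_sgn[where h="\<lambda>y. (y $ j) *\<^sub>R w y"]) simp
    moreover have "(LINT y|lebesgue. q' 1 y) = I" by (simp add: q'_def I_def)
    ultimately have "c m *\<^sub>R I = (1 / d m) *\<^sub>R ((LINT y|lebesgue. q' 1 y) - (LINT y|lebesgue. q' (1 - d m) y))"
      unfolding c_def by (simp add: scaleR_diff_left divide_inverse mult.commute flip: scaleR_scaleR)
    moreover have "A m = (1 / d m) *\<^sub>R ((LINT y|lebesgue. q 1 y) - (LINT y|lebesgue. q (1 - d m) y))"
      unfolding A_def q_def by (rule shell_identity[OF w d])
    ultimately have "A m - c m *\<^sub>R I = (1 / d m) *\<^sub>R (((LINT y|lebesgue. q 1 y) - (LINT y|lebesgue. q (1 - d m) y)) -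
        ((LINT y|lebesgue. q' 1 y) - (LINT y|lebesgue. q' (1 - d m) y)))"
      by (simp only: scaleR_diff_right)
    also have "((LINT y|lebesgue. q 1 y) - (LINT y|lebesgue. q (1 - d m) y)) - ((LINT y|lebesgue. q' 1 y) - (LINT y|lebesgue. q' (1 - d m) y))
      = (LINT y|lebesgue. (q 1 y - q (1 - d m) y) - (q' 1 y - q' (1 - d m) y))"
      using qi q'i by simp
    finally have "A m - c m *\<^sub>R I = (1 / d m) *\<^sub>R (LINT y|lebesgue. (q 1 y - q (1 - d m) y) - (q' 1 y - q' (1 - d m) y))" .
    then have "norm (A m - c m *\<^sub>R I) = (1 / d m) * norm (LINT y|lebesgue. (q 1 y - q (1 - d m) y) - (q' 1 y - q' (1 - d m) y))"
      using d[of m] by simp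
    also have "norm (LINT y|lebesgue. (q 1 y - q (1 - d m) y) - (q' 1 y - q' (1 - d m) y)) \<le>
      (LINT y|lebesgue. norm ((q 1 y - q (1 - d m) y) - (q' 1 y - q' (1 - d m) y)))" by (rule integral_norm_bound)
    also have "\<dots> \<le> (LINT y|lebesgue. (indicat_real (ball (0::real^'n) 1) y - indicator (ball 0 (1 - d m)) y) * (L * d m))"
    proof (rule integral_mono)
      show "integrable lebesgue (\<lambda>y. norm ((q 1 y - q (1 - d m) y) - (q' 1 y - q' (1 - d m) y)))"
        by (intro integrable_norm Bochner_Integration.integrable_diff qi q'i)
      show "integrable lebesgue (\<lambda>y. (indicat_real (ball (0::real^'n) 1) y - indicator (ball 0 (1 - d m)) y) * (L * d m))"
        by (intro integrable_mult_left Bochner_Integration.integrable_diff integrable_indicator_ball)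
      fix y :: "real^'n"
      show "norm ((q 1 y - q (1 - d m) y) - (q' 1 y - q' (1 - d m) y)) \<le> (indicat_real (ball (0::real^'n) 1) y - indicator (ball 0 (1 - d m)) y) * (L * d m)"
      proof (cases "1 - d m \<le> norm y \<and> norm y < 1")
        case True
        then have y0: "y \<noteq> 0" using d[of m] by auto
        have "(q 1 y - q (1 - d m) y) - (q' 1 y - q' (1 - d m) y) = (sgn y $ j) *\<^sub>R (w y - w (sgn y))"
          using True by (simp add: q_def q'_def scaleR_diff_right)
        also have "norm \<dots> \<le> 1 * (L * norm (y - sgn y))"
          unfolding norm_scaleR
        proof (rule mult_mono)
          show "\<bar>sgn y $ j\<bar> \<le> 1" using component_le_norm_cart[of "sgn y" j] y0 by (simp add: norm_sgn)
          show "norm (w y - w (sgn y)) \<le> L * norm (y - sgn y)"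
            by (rule L(2)) (use True in \<open>auto simp: norm_sgn\<close>)
        qed auto
        also have "y - sgn y = (norm y - 1) *\<^sub>R sgn y" using y0 by (simp add: sgn_div_norm left_diff_distrib scaleR_diff_left)
        also have "norm \<dots> = 1 - norm y" using True y0 by (simp add: norm_sgn)
        also have "1 * (L * (1 - norm y)) \<le> L * d m" using True L(1) by (simp add: mult_left_mono)
        finally show ?thesis using True by simp
      next
        case False
        then show ?thesis using d[of m] by (auto simp: q_def q'_def indicator_def)
      qed
    qed
    also have "\<dots> = (b - measure lebesgue (ball (0::real^'n) (1 - d m))) * (L * d m)"
      using integrable_indicator_ball[of "0::real^'n"] by (simp add: b_def)
    also have "measure lebesgue (ball (0::real^'n) (1 - d m)) = (1 - d m) ^ CARD('n) * b"
      using content_ball_conv_unit_ball[of "1 - d m" "0::real^'n"] d[of m] by (simp add: b_def)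
    also have "(b - (1 - d m) ^ CARD('n) * b) * (L * d m) = L * b * (c m * d m) * d m"
    proof -
      have "c m * d m = 1 - (1 - d m) ^ CARD('n)" using d[of m] by (simp add: c_def)
      then show ?thesis by (simp only:) (simp add: algebra_simps)
    qed
    finally show ?thesis using d[of m] by (simp add: divide_right_mono)
  qed
  have clim: "c \<longlonglongrightarrow> real CARD('n)" unfolding c_def by (rule shell_ratio_tendsto[OF d(1) dlim])
  have "(\<lambda>m. L * b * (c m * d m)) \<longlonglongrightarrow> L * b * (real CARD('n) * 0)" by (intro tendsto_intros clim dlim)
  then have "(\<lambda>m. L * b * (c m * d m)) \<longlonglongrightarrow> 0" by simp
  then have "(\<lambda>m. A m - c m *\<^sub>R I) \<longlonglongrightarrow> 0"
    by (rule Lim_null_comparison[OF always_eventually, rotated]) (use Abound in blast)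
  then have "(\<lambda>m. (A m - c m *\<^sub>R I) + c m *\<^sub>R I) \<longlonglongrightarrow> 0 + real CARD('n) *\<^sub>R I"
    by (intro tendsto_add tendsto_scaleR clim tendsto_const)
  then have "A \<longlonglongrightarrow> real CARD('n) *\<^sub>R I" by simp
  then have "(LINT y|lebesgue. indicator (ball 0 1) y *\<^sub>R partial j w y) = real CARD('n) *\<^sub>R I"
    using Alim LIMSEQ_unique by blast
  also have "\<dots> = (LINT \<eta>|sphere_measure. (\<eta> $ j) *\<^sub>R w \<eta>)"
    unfolding I_def by (rule integral_sphere_measure[OF borel_measurable_continuous_onI[OF cjw], symmetric])
  finally show ?thesis ..
qed

section \<open>The trace inequality\<close>

text \<open>The expression that occurs in the definition of the trace.\<close>

definition grad :: "(real^'n \<Rightarrow> 'b::real_normed_vector) \<Rightarrow> real^'n \<Rightarrow> ((real^'n) \<Rightarrow>\<^sub>L 'b)"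
  where "grad v y = Blinfun (frechet_derivative v (at y))"

lemma grad_apply: "Ck_on (Suc 0) v UNIV \<Longrightarrow> blinfun_apply (grad v y) h = frechet_derivative v (at y) h"
  unfolding grad_def by (simp add: bounded_linear_Blinfun_apply has_derivative_bounded_linear[OF Ck1_derivative])

lemma grad_continuous:
  fixes v :: "real^'n \<Rightarrow> 'b::real_normed_vector"
  assumes v: "Ck_on (Suc 0) v UNIV"
  shows "continuous_on UNIV (grad v)"
proof (rule continuous_on_blinfun_componentwise)
  fix i :: "real^'n" assume "i \<in> Basis"
  then obtain j where i: "i = axis j 1" by (auto simp: Basis_vec_def)
  show "continuous_on UNIV (\<lambda>y. blinfun_apply (grad v y) i)"
    unfolding grad_apply[OF v] i using Ck1_partial_continuous[OF v, of j] unfolding partial_def[abs_def] .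
qed

text \<open>Formally this is the divergence theorem for the vector field \<open>norm (v y) *\<^sub>R y\<close>, whose normal
  component on the sphere is \<open>norm (v y)\<close>. Since the norm is not differentiable at 0, it is replaced
  by \<open>sqrt (\<kappa>\<^sup>2 + v y \<bullet> v y)\<close>, which exceeds it by at most \<open>\<kappa>\<close> and still has gradient at most
  \<open>norm (grad v y)\<close>.\<close>

lemma trace_inequality_unit_ball:
  fixes v :: "real^'n \<Rightarrow> 'e::euclidean_space"
  assumes v: "Ck_on (Suc 0) v UNIV"
  shows "(LINT \<eta>|sphere_measure. norm (v \<eta>)) \<le>
    real CARD('n) * (LINT y|lebesgue. indicator (ball 0 1) y * norm (v y)) + (LINT y|lebesgue. indicator (ball 0 1) y * norm (grad v y))"
proof -
  have cv: "continuous_on UNIV v" using Ck_on_SucD[OF v] by simp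
  define b where "b = measure lebesgue (ball (0::real^'n) 1)"
  have i1: "integrable lebesgue (\<lambda>y. indicator (ball 0 1) y * norm (v y))"
    using integrable_indicator_continuous[OF continuous_on_norm[OF cv], of "ball 0 1"] by simp
  have i2: "integrable lebesgue (\<lambda>y. indicator (ball 0 1) y * norm (grad v y))"
    using integrable_indicator_continuous[OF continuous_on_norm[OF grad_continuous[OF v]], of "ball 0 1"] by simp
  have "(LINT \<eta>|sphere_measure. norm (v \<eta>)) \<le>
    real CARD('n) * (LINT y|lebesgue. indicator (ball 0 1) y * norm (v y)) + (LINT y|lebesgue. indicator (ball 0 1) y * norm (grad v y)) +
    \<kappa> * (real CARD('n) * b)" if \<kappa>: "\<kappa> > 0" for \<kappa>
  proof -
    define f where "f y = sqrt (\<kappa>\<^sup>2 + v y \<bullet> v y)" for y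
    have pos: "0 < \<kappa>\<^sup>2 + v y \<bullet> v y" for y using \<kappa> by (simp add: add_pos_nonneg)
    have fpos: "0 < f y" for y using pos by (simp add: f_def)
    have f0: "f y \<noteq> 0" for y using fpos[of y] by simp
    have vf: "norm (v y) \<le> f y" for y unfolding f_def norm_eq_sqrt_inner by simp
    have fv: "f y \<le> norm (v y) + \<kappa>" for y
    proof -
      have "f y \<le> sqrt ((norm (v y) + \<kappa>)\<^sup>2)" unfolding f_def
        using \<kappa> by (intro real_sqrt_le_mono) (simp add: power2_sum power2_norm_eq_inner)
      also have "\<dots> = norm (v y) + \<kappa>" using \<kappa> by simp
      finally show ?thesis .
    qed
    have cf: "continuous_on UNIV f" unfolding f_def by (intro continuous_intros cv)
    define f' where "f' y h = (v y \<bullet> frechet_derivative v (at y) h) / f y" for y h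
    have df: "(f has_derivative f' y) (at y)" for y
    proof -
      have "((\<lambda>y. \<kappa>\<^sup>2 + v y \<bullet> v y) has_derivative (\<lambda>h. 2 * (v y \<bullet> frechet_derivative v (at y) h))) (at y)"
        by (rule derivative_eq_intros Ck1_derivative[OF v] refl)+ (simp add: inner_commute)
      from has_derivative_real_sqrt[OF pos[of y] this]
      have "(f has_derivative (\<lambda>h. 2 * (v y \<bullet> frechet_derivative v (at y) h) * (inverse (f y) / 2))) (at y)"
        unfolding f_def[abs_def] .
      moreover have "(\<lambda>h. 2 * (v y \<bullet> frechet_derivative v (at y) h) * (inverse (f y) / 2)) = f' y"
        unfolding f'_def[abs_def] by (rule ext) (simp add: f0 divide_inverse[of _ "f y"])
      ultimately show ?thesis by simp
    qed
    \<comment> \<open>The components of the regularised vector field \<open>norm (v y) *\<^sub>R y\<close>.\<close>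
    define W where "W j y = (y $ j) * f y" for j and y :: "real^'n"
    have dW: "(W j has_derivative (\<lambda>h. y $ j * f' y h + h $ j * f y)) (at y)" for j y
      unfolding W_def[abs_def]
      by (intro has_derivative_mult df bounded_linear_imp_has_derivative bounded_linear_vec_nth)
    have W1: "Ck_on (Suc 0) (W j) UNIV" for j
    proof (rule Ck_on_SucI[OF open_UNIV dW])
      fix i
      have "continuous_on UNIV (\<lambda>y. frechet_derivative v (at y) (axis i 1))"
        using Ck1_partial_continuous[OF v, of i] unfolding partial_def[abs_def] .
      then show "Ck_on 0 (\<lambda>y. y $ j * f' y (axis i 1) + axis i 1 $ j * f y) UNIV"
        unfolding Ck_on.simps f'_def by (intro continuous_intros cv cf) (simp_all add: f0)
    qed
    have pW: "partial j (W j) y = y $ j * f' y (axis j 1) + f y" for j y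
      unfolding partial_def by (subst frechet_eq[OF dW]) simp
    have pWi: "integrable lebesgue (\<lambda>y. indicator (ball 0 1) y *\<^sub>R partial j (W j) y)" for j
      by (rule integrable_indicator_continuous[OF Ck1_partial_continuous[OF W1]]) auto
    have cWs: "continuous_on UNIV (\<lambda>y. (y $ j) *\<^sub>R W j y)" for j
      unfolding W_def by (intro continuous_intros cf)
    have Wsi: "integrable lebesgue (\<lambda>y. indicator (ball 0 1) y *\<^sub>R ((sgn y $ j) *\<^sub>R W j (sgn y)))" for j
      by (rule integrable_ball_sgn[OF cWs])
    have fint: "integrable lebesgue (\<lambda>y. indicator (ball 0 1) y *\<^sub>R f (sgn y))" by (rule integrable_ball_sgn[OF cf])
    have nint: "integrable lebesgue (\<lambda>y. indicator (ball 0 1) y *\<^sub>R norm (v (sgn y)))"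
      by (rule integrable_ball_sgn[OF continuous_on_norm[OF cv]])
    have "(LINT \<eta>|sphere_measure. norm (v \<eta>)) = real CARD('n) * (LINT y|lebesgue. indicator (ball 0 1) y *\<^sub>R norm (v (sgn y)))"
      by (subst integral_sphere_measure[OF borel_measurable_continuous_onI[OF continuous_on_norm[OF cv]]]) simp
    also have "\<dots> \<le> real CARD('n) * (LINT y|lebesgue. indicator (ball 0 1) y *\<^sub>R f (sgn y))"
      by (intro mult_left_mono integral_mono nint fint) (simp_all add: mult_left_mono vf)
    also have "(LINT y|lebesgue. indicator (ball 0 1) y *\<^sub>R f (sgn y)) =
      (LINT y|lebesgue. (\<Sum>j\<in>UNIV. indicator (ball 0 1) y *\<^sub>R ((sgn y $ j) *\<^sub>R W j (sgn y))))"
    proof (rule integral_cong_AE)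
      show "AE y in lebesgue. indicator (ball 0 1) y *\<^sub>R f (sgn y) = (\<Sum>j\<in>UNIV. indicator (ball 0 1) y *\<^sub>R ((sgn y $ j) *\<^sub>R W j (sgn y)))"
        using AE_lebesgue_neq[of "0::real^'n"]
      proof eventually_elim
        fix y :: "real^'n" assume "y \<noteq> 0"
        \<comment> \<open>The normal component of the field on the sphere is \<open>f\<close> itself.\<close>
        then have "sgn y \<bullet> sgn y = 1" by (simp add: dot_square_norm norm_sgn)
        then have one: "(\<Sum>j\<in>UNIV. (sgn y $ j) * (sgn y $ j)) = 1" by (simp add: inner_vec_def)
        have "(\<Sum>j\<in>UNIV. indicator (ball 0 1) y *\<^sub>R ((sgn y $ j) *\<^sub>R W j (sgn y)))
          = (\<Sum>j\<in>UNIV. (indicator (ball 0 1) y * f (sgn y)) * ((sgn y $ j) * (sgn y $ j)))"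
          by (intro sum.cong refl) (simp add: W_def)
        also have "\<dots> = indicator (ball 0 1) y * f (sgn y)" unfolding sum_distrib_left[symmetric] one by simp
        finally show "indicator (ball 0 1) y *\<^sub>R f (sgn y) = (\<Sum>j\<in>UNIV. indicator (ball 0 1) y *\<^sub>R ((sgn y $ j) *\<^sub>R W j (sgn y)))"
          by simp
      qed
    qed (intro borel_measurable_integrable fint Bochner_Integration.integrable_sum Wsi)+
    also have "\<dots> = (\<Sum>j\<in>UNIV. LINT y|lebesgue. indicator (ball 0 1) y *\<^sub>R ((sgn y $ j) *\<^sub>R W j (sgn y)))"
      by (rule Bochner_Integration.integral_sum[OF Wsi])
    also have "real CARD('n) * \<dots> = (\<Sum>j\<in>UNIV. LINT \<eta>|sphere_measure. (\<eta> $ j) *\<^sub>R W j \<eta>)"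
      by (simp add: integral_sphere_measure[OF borel_measurable_continuous_onI[OF cWs, simplified]] sum_distrib_left)
    also have "\<dots> = (\<Sum>j\<in>UNIV. LINT y|lebesgue. indicator (ball 0 1) y *\<^sub>R partial j (W j) y)"
      by (intro sum.cong refl divergence_unit_ball W1)
    also have "\<dots> = (LINT y|lebesgue. (\<Sum>j\<in>UNIV. indicator (ball 0 1) y *\<^sub>R partial j (W j) y))"
      by (rule Bochner_Integration.integral_sum[OF pWi, symmetric])
    also have "\<dots> \<le> (LINT y|lebesgue. real CARD('n) * (indicator (ball 0 1) y * norm (v y)) + indicator (ball 0 1) y * norm (grad v y) + indicator (ball 0 1) y * (real CARD('n) * \<kappa>))"
    proof (rule integral_mono)
      show "integrable lebesgue (\<lambda>y. \<Sum>j\<in>UNIV. indicator (ball 0 1) y *\<^sub>R partial j (W j) y)"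
        by (intro Bochner_Integration.integrable_sum pWi)
      show "integrable lebesgue (\<lambda>y. real CARD('n) * (indicator (ball 0 1) y * norm (v y)) + indicator (ball 0 1) y * norm (grad v y) + indicator (ball 0 1) y * (real CARD('n) * \<kappa>))"
        by (intro Bochner_Integration.integrable_add integrable_mult_right integrable_mult_left i1 i2 integrable_indicator_ball)
      fix y :: "real^'n"
      show "(\<Sum>j\<in>UNIV. indicator (ball 0 1) y *\<^sub>R partial j (W j) y) \<le>
        real CARD('n) * (indicator (ball 0 1) y * norm (v y)) + indicator (ball 0 1) y * norm (grad v y) + indicator (ball 0 1) y * (real CARD('n) * \<kappa>)"
      proof (cases "y \<in> ball 0 1")
        case True
        have "(\<Sum>j\<in>UNIV. partial j (W j) y) = (\<Sum>j\<in>UNIV. (y $ j) *\<^sub>R f' y (axis j 1)) + real CARD('n) * f y"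
          by (simp add: pW sum.distrib)
        also have "(\<Sum>j\<in>UNIV. (y $ j) *\<^sub>R f' y (axis j 1)) = f' y y"
          by (rule linear_axis_expansion[OF has_derivative_linear[OF df], symmetric])
        also have "f' y y = (v y \<bullet> blinfun_apply (grad v y) y) / f y"
          unfolding f'_def grad_apply[OF v] ..
        also have "\<dots> \<le> (f y * norm (grad v y)) / f y"
        proof (intro divide_right_mono)
          have "v y \<bullet> blinfun_apply (grad v y) y \<le> norm (v y) * norm (blinfun_apply (grad v y) y)" by (rule norm_cauchy_schwarz)
          also have "\<dots> \<le> f y * norm (grad v y)"
          proof (rule mult_mono[OF vf])
            have "norm (blinfun_apply (grad v y) y) \<le> norm (grad v y) * norm y" by (rule norm_blinfun)
            also have "\<dots> \<le> norm (grad v y) * 1" using True by (intro mult_left_mono) auto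
            finally show "norm (blinfun_apply (grad v y) y) \<le> norm (grad v y)" by simp
          qed (use fpos[of y] in auto)
          finally show "v y \<bullet> blinfun_apply (grad v y) y \<le> f y * norm (grad v y)" .
        qed (use fpos[of y] in simp)
        also have "\<dots> = norm (grad v y)" using fpos[of y] by simp
        also have "real CARD('n) * f y \<le> real CARD('n) * (norm (v y) + \<kappa>)" using fv by (intro mult_left_mono) auto
        finally have "(\<Sum>j\<in>UNIV. partial j (W j) y) \<le> norm (grad v y) + real CARD('n) * (norm (v y) + \<kappa>)" by simp
        then show ?thesis using True by (simp add: algebra_simps)
      qed simp
    qed
    also have "\<dots> = real CARD('n) * (LINT y|lebesgue. indicator (ball 0 1) y * norm (v y)) + (LINT y|lebesgue. indicator (ball 0 1) y * norm (grad v y)) + b * (real CARD('n) * \<kappa>)"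
    proof -
      have "(LINT y|lebesgue. indicat_real (ball (0::real^'n) 1) y * (real CARD('n) * \<kappa>)) = b * (real CARD('n) * \<kappa>)"
        unfolding b_def by simp
      then show ?thesis
        using i1 i2 integrable_mult_left[OF integrable_indicator_ball[of "0::real^'n" 1], of "real CARD('n) * \<kappa>"]
        by (subst Bochner_Integration.integral_add | simp)+
    qed
    finally show ?thesis by (simp add: algebra_simps)
  qed
  note * = this
  show ?thesis
  proof (rule field_le_epsilon)
    fix e :: real assume e: "e > 0"
    have b: "b > 0" by (simp add: b_def)
    have "0 < e / (real CARD('n) * b)" using e b by simp
    from *[OF this] show "(LINT \<eta>|sphere_measure. norm (v \<eta>)) \<le>
      real CARD('n) * (LINT y|lebesgue. indicator (ball 0 1) y * norm (v y)) + (LINT y|lebesgue. indicator (ball 0 1) y * norm (grad v y)) + e"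
      using b by simp
  qed
qed

lemma integral_ball_affine:
  fixes h :: "real^'n \<Rightarrow> 'b::{banach, second_countable_topology}"
  assumes r: "0 < r"
  shows "(LINT y|lebesgue. indicator (ball 0 1) y *\<^sub>R h (x + r *\<^sub>R y)) = (1 / r ^ CARD('n)) *\<^sub>R (LINT y|lebesgue. indicator (ball x r) y *\<^sub>R h y)"
proof -
  have "indicat_real (ball x r) (x + r *\<^sub>R y) = indicator (ball 0 1) y" for y
    using r by (auto simp: indicator_def dist_norm)
  with integral_lebesgue_affine[of r "\<lambda>y. indicator (ball x r) y *\<^sub>R h y" x] r show ?thesis by simp
qed

lemma frechet_affine:
  fixes v :: "real^'n \<Rightarrow> 'b::real_normed_vector"
  assumes v: "Ck_on (Suc 0) v UNIV"
  shows "frechet_derivative (\<lambda>y. v (x + r *\<^sub>R y)) (at y) = (\<lambda>h. r *\<^sub>R frechet_derivative v (at (x + r *\<^sub>R y)) h)"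
proof (rule frechet_eq)
  have "((\<lambda>y. x + r *\<^sub>R y) has_derivative (\<lambda>h. r *\<^sub>R h)) (at y)" by (auto intro!: derivative_eq_intros)
  from has_derivative_compose[OF this Ck1_derivative[OF v]]
  show "((\<lambda>y. v (x + r *\<^sub>R y)) has_derivative (\<lambda>h. r *\<^sub>R frechet_derivative v (at (x + r *\<^sub>R y)) h)) (at y)"
    by (simp add: linear_scale[OF has_derivative_linear[OF Ck1_derivative[OF v]]])
qed

lemma divergence_ball:
  fixes v :: "real^'n \<Rightarrow> 'b::{banach, second_countable_topology}"
  assumes v: "Ck_on (Suc 0) v UNIV" and r: "0 < r"
  shows "(LINT \<eta>|sphere_measure. (\<eta> $ j) *\<^sub>R v (x + r *\<^sub>R \<eta>)) =
    (r / r ^ CARD('n)) *\<^sub>R (LINT y|lebesgue. indicator (ball x r) y *\<^sub>R partial j v y)"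
proof -
  have "(LINT \<eta>|sphere_measure. (\<eta> $ j) *\<^sub>R v (x + r *\<^sub>R \<eta>)) =
    (LINT y|lebesgue. indicator (ball 0 1) y *\<^sub>R partial j (\<lambda>y. v (x + r *\<^sub>R y)) y)"
    by (rule divergence_unit_ball[OF Ck_on_affine[OF v]])
  also have "\<dots> = (LINT y|lebesgue. indicator (ball 0 1) y *\<^sub>R (r *\<^sub>R partial j v (x + r *\<^sub>R y)))"
    by (simp add: partial_def frechet_affine[OF v])
  also have "\<dots> = (1 / r ^ CARD('n)) *\<^sub>R (LINT y|lebesgue. indicator (ball x r) y *\<^sub>R (r *\<^sub>R partial j v y))"
    by (rule integral_ball_affine[OF r, of "\<lambda>y. r *\<^sub>R partial j v y"])
  also have "\<dots> = (r / r ^ CARD('n)) *\<^sub>R (LINT y|lebesgue. indicator (ball x r) y *\<^sub>R partial j v y)"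
    by (simp only: scaleR_left_commute[of _ r] integral_scaleR_right) simp
  finally show ?thesis .
qed

lemma trace_inequality_ball:
  fixes v :: "real^'n \<Rightarrow> 'e::euclidean_space"
  assumes v: "Ck_on (Suc 0) v UNIV" and r: "0 < r"
  shows "(LINT \<eta>|sphere_measure. norm (v (x + r *\<^sub>R \<eta>))) \<le>
    (real CARD('n) / r ^ CARD('n)) * (LINT y|lebesgue. indicator (ball x r) y * norm (v y)) +
    (r / r ^ CARD('n)) * (LINT y|lebesgue. indicator (ball x r) y * norm (grad v y))"
proof -
  have g: "norm (grad (\<lambda>y. v (x + r *\<^sub>R y)) y) = r * norm (grad v (x + r *\<^sub>R y))" for y
  proof -
    have "grad (\<lambda>y. v (x + r *\<^sub>R y)) y = r *\<^sub>R grad v (x + r *\<^sub>R y)"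
      by (rule blinfun_eqI) (simp add: grad_apply[OF v] grad_apply[OF Ck_on_affine[OF v]] frechet_affine[OF v] scaleR_blinfun.rep_eq)
    then show ?thesis using r by simp
  qed
  have "(LINT \<eta>|sphere_measure. norm (v (x + r *\<^sub>R \<eta>))) \<le>
    real CARD('n) * (LINT y|lebesgue. indicator (ball 0 1) y * norm (v (x + r *\<^sub>R y))) +
    (LINT y|lebesgue. indicator (ball 0 1) y * norm (grad (\<lambda>y. v (x + r *\<^sub>R y)) y))"
    by (rule trace_inequality_unit_ball[OF Ck_on_affine[OF v]])
  also have "(LINT y|lebesgue. indicator (ball 0 1) y * norm (v (x + r *\<^sub>R y))) =
    (1 / r ^ CARD('n)) * (LINT y|lebesgue. indicator (ball x r) y * norm (v y))"
    using integral_ball_affine[OF r, of "\<lambda>y. norm (v y)" x] by simp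
  also have "(LINT y|lebesgue. indicator (ball 0 1) y * norm (grad (\<lambda>y. v (x + r *\<^sub>R y)) y)) =
    (1 / r ^ CARD('n)) * (LINT y|lebesgue. indicator (ball x r) y * (r * norm (grad v y)))"
    using integral_ball_affine[OF r, of "\<lambda>y. r * norm (grad v y)" x] by (simp add: g)
  also have "(LINT y|lebesgue. indicator (ball x r) y * (r * norm (grad v y))) = r * (LINT y|lebesgue. indicator (ball x r) y * norm (grad v y))"
    by (simp add: mult.left_commute[of _ r])
  finally show ?thesis by simp
qed

section \<open>Local integrability and test functions\<close>

lemma Lp_on_1_iff:
  fixes f :: "real^'n \<Rightarrow> 'b::{banach, second_countable_topology}"
  shows "Lp_on 1 S f \<longleftrightarrow> integrable (lebesgue_on S) f"
  unfolding Lp_on_def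
  by (auto simp: powr_one_gt_zero_iff intro: integrable_norm_cancel integrable_norm)

lemma L1_loc_iff:
  fixes f :: "real^'n \<Rightarrow> 'b::{banach, second_countable_topology}"
  shows "L1_loc \<Omega> f \<longleftrightarrow> (\<forall>K. compact K \<and> K \<subseteq> \<Omega> \<longrightarrow> integrable (lebesgue_on K) f)"
  unfolding L1_loc_def Lp_on_1_iff ..

lemma integrable_lebesgue_on_iff:
  fixes f :: "real^'n \<Rightarrow> 'b::{banach, second_countable_topology}"
  assumes "S \<in> sets lebesgue"
  shows "integrable (lebesgue_on S) f \<longleftrightarrow> integrable lebesgue (\<lambda>x. indicator S x *\<^sub>R f x)"
  using assms by (intro integrable_restrict_space) simp

lemma integral_lebesgue_on:
  fixes f :: "real^'n \<Rightarrow> 'b::{banach, second_countable_topology}"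
  assumes "S \<in> sets lebesgue"
  shows "(LINT x|lebesgue_on S. f x) = (LINT x|lebesgue. indicator S x *\<^sub>R f x)"
  using assms by (intro integral_restrict_space) simp

lemma compact_sets_lebesgue: "compact K \<Longrightarrow> K \<in> sets lebesgue" for K :: "'a::euclidean_space set"
  using lmeasurable_compact fmeasurableD by blast

lemma open_sets_lebesgue: "open K \<Longrightarrow> K \<in> sets lebesgue" for K :: "'a::euclidean_space set"
  by simp

lemma L1_loc_integrable:
  fixes f :: "real^'n \<Rightarrow> 'b::{banach, second_countable_topology}"
  assumes "L1_loc \<Omega> f" "compact K" "K \<subseteq> \<Omega>"
  shows "integrable lebesgue (\<lambda>x. indicator K x *\<^sub>R f x)"
  using assms unfolding L1_loc_iff by (subst integrable_lebesgue_on_iff[symmetric]) (auto intro: compact_sets_lebesgue)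

lemma L1_loc_subset: "L1_loc \<Omega> f \<Longrightarrow> \<Omega>' \<subseteq> \<Omega> \<Longrightarrow> L1_loc \<Omega>' f"
  unfolding L1_loc_def by blast

lemma L1_loc_diff:
  fixes f g :: "real^'n \<Rightarrow> 'b::{banach, second_countable_topology}"
  shows "L1_loc \<Omega> f \<Longrightarrow> L1_loc \<Omega> g \<Longrightarrow> L1_loc \<Omega> (\<lambda>x. f x - g x)"
  unfolding L1_loc_iff by (blast intro: Bochner_Integration.integrable_diff)

lemma L1_loc_bounded_linear:
  fixes f :: "real^'n \<Rightarrow> 'b::{banach, second_countable_topology}"
    and T :: "'b \<Rightarrow> 'c::{banach, second_countable_topology}"
  shows "bounded_linear T \<Longrightarrow> L1_loc \<Omega> f \<Longrightarrow> L1_loc \<Omega> (\<lambda>x. T (f x))"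
  unfolding L1_loc_iff by (blast intro: integrable_bounded_linear)

lemma partial_outside_support:
  fixes \<phi> :: "real^'n \<Rightarrow> 'b::real_normed_vector"
  assumes "closed K" "\<forall>y. y \<notin> K \<longrightarrow> \<phi> y = 0" "x \<notin> K"
  shows "partial j \<phi> x = 0"
proof -
  have "((\<lambda>x. 0) has_derivative (\<lambda>h. 0)) (at x)" by simp
  then have "(\<phi> has_derivative (\<lambda>h. 0)) (at x)"
    by (rule has_derivative_transform_within_open[of _ _ x UNIV "- K"]) (use assms in auto)
  then show ?thesis unfolding partial_def by (subst frechet_eq) auto
qed

lemma integral_lebesgue_on_support:
  fixes f :: "real^'n \<Rightarrow> 'b::{banach, second_countable_topology}"
  assumes "open \<Omega>" "K \<subseteq> \<Omega>" "\<forall>x. x \<notin> K \<longrightarrow> g x = (0::real)"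
  shows "(LINT x|lebesgue_on \<Omega>. g x *\<^sub>R f x) = (LINT x|lebesgue. g x *\<^sub>R (indicator K x *\<^sub>R f x))"
proof -
  have eq: "indicator \<Omega> x *\<^sub>R (g x *\<^sub>R f x) = g x *\<^sub>R (indicator K x *\<^sub>R f x)" for x
    using assms(2,3) by (cases "x \<in> K") (auto simp: indicator_def)
  show ?thesis by (simp only: integral_lebesgue_on[OF open_sets_lebesgue[OF assms(1)]] eq)
qed

lemma integrable_bounded_continuous_scaleR:
  fixes f :: "real^'n \<Rightarrow> 'b::{banach, second_countable_topology}"
  assumes g: "continuous_on UNIV g" and K: "compact K" and f: "integrable lebesgue (\<lambda>x. indicator K x *\<^sub>R f x)"
  shows "integrable lebesgue (\<lambda>x. g x *\<^sub>R (indicator K x *\<^sub>R f x))"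
proof -
  from continuous_compact_bound[OF continuous_on_subset[OF g subset_UNIV] K]
  obtain B where B: "\<forall>y\<in>K. norm (g y) \<le> B" ..
  show ?thesis
  proof (rule Bochner_Integration.integrable_bound[OF integrable_scaleR_right[OF f, of B]])
    show "(\<lambda>x. g x *\<^sub>R (indicator K x *\<^sub>R f x)) \<in> borel_measurable lebesgue"
      by (intro borel_measurable_scaleR[OF borel_measurable_lebesgue_continuous[OF g]] borel_measurable_integrable[OF f])
    show "AE x in lebesgue. norm (g x *\<^sub>R (indicator K x *\<^sub>R f x)) \<le> norm (B *\<^sub>R (indicator K x *\<^sub>R f x))"
    proof (rule AE_I2)
      fix x
      show "norm (g x *\<^sub>R (indicator K x *\<^sub>R f x)) \<le> norm (B *\<^sub>R (indicator K x *\<^sub>R f x))"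
      proof (cases "x \<in> K")
        case True
        then have "\<bar>g x\<bar> \<le> \<bar>B\<bar>" using B by fastforce
        then show ?thesis using True by (simp add: mult_right_mono)
      qed simp
    qed
  qed
qed

lemma test_functionE:
  assumes "test_function \<Omega> \<phi>"
  obtains K where "compact K" "K \<subseteq> \<Omega>" "\<forall>x. x \<notin> K \<longrightarrow> \<phi> x = 0"
    "\<And>j. \<forall>x. x \<notin> K \<longrightarrow> partial j \<phi> x = 0" "continuous_on UNIV \<phi>" "\<And>j. continuous_on UNIV (partial j \<phi>)"
proof -
  obtain K where K: "compact K" "K \<subseteq> \<Omega>" "\<forall>x. x \<notin> K \<longrightarrow> \<phi> x = 0" and s: "smooth_on \<phi> UNIV"
    using assms unfolding test_function_def by blast
  have "\<forall>x. x \<notin> K \<longrightarrow> partial j \<phi> x = 0" for j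
    using partial_outside_support[OF compact_imp_closed[OF K(1)] K(3)] by blast
  then show thesis
    by (rule that[OF K _ smooth_imp_continuous[OF s] smooth_imp_continuous[OF smooth_on_partial[OF s]]])
qed

lemma integrable_test:
  fixes f :: "real^'n \<Rightarrow> 'b::{banach, second_countable_topology}"
  assumes \<Omega>: "open \<Omega>" and g: "continuous_on UNIV g" and K: "compact K" "K \<subseteq> \<Omega>" "\<forall>x. x \<notin> K \<longrightarrow> g x = (0::real)"
    and f: "L1_loc \<Omega> f"
  shows "integrable (lebesgue_on \<Omega>) (\<lambda>x. g x *\<^sub>R f x)"
proof -
  have eq: "indicator \<Omega> x *\<^sub>R (g x *\<^sub>R f x) = g x *\<^sub>R (indicator K x *\<^sub>R f x)" for x
    using K(2,3) by (cases "x \<in> K") (auto simp: indicator_def)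
  show ?thesis
    unfolding integrable_lebesgue_on_iff[OF open_sets_lebesgue[OF \<Omega>]] eq
    by (rule integrable_bounded_continuous_scaleR[OF g K(1) L1_loc_integrable[OF f K(1,2)]])
qed

lemma scaled_bump_outside: "0 < \<epsilon> \<Longrightarrow> y \<notin> cball x \<epsilon> \<Longrightarrow> scaled_bump \<epsilon> (x - y) = 0"
  using smooth_supp_scaled_bump[of \<epsilon>] by (auto simp: smooth_supp_def dist_norm not_le)

lemma test_function_scaled_bump:
  fixes x :: "real^'n"
  assumes e: "0 < \<epsilon>" and sub: "cball x \<epsilon> \<subseteq> \<Omega>"
  shows "test_function \<Omega> (\<lambda>z. scaled_bump \<epsilon> (x - z))"
  unfolding test_function_def
proof (intro conjI exI[of _ "cball x \<epsilon>"] allI impI)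
  have "Ck_on k (\<lambda>z. scaled_bump \<epsilon> (x + (- 1) *\<^sub>R z)) UNIV" for k
    using smooth_supp_scaled_bump[OF e] unfolding smooth_supp_def smooth_on_def by (intro Ck_on_affine) blast
  then show "smooth_on (\<lambda>z. scaled_bump \<epsilon> (x - z)) UNIV" unfolding smooth_on_def by simp
qed (use e sub scaled_bump_outside in auto)

text \<open>Negligibility is a local property by the Lindelof theorem. Locally integrable functions can
  thus be cut off to globally integrable ones near each point.\<close>

lemma AE_lebesgue_on_local:
  fixes \<Omega> :: "(real^'n) set"
  assumes \<Omega>: "open \<Omega>"
    and loc: "\<And>x. x \<in> \<Omega> \<Longrightarrow> \<exists>d>0. AE y in lebesgue. y \<in> ball x d \<longrightarrow> P y"
  shows "AE x in lebesgue_on \<Omega>. P x"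
proof -
  have "negligible {x \<in> \<Omega>. \<not> P x}"
    unfolding locally_negligible_alt[of "{x \<in> \<Omega>. \<not> P x}"]
  proof (rule ballI)
    fix x assume x: "x \<in> {x \<in> \<Omega>. \<not> P x}"
    then obtain d where d: "d > 0" "AE y in lebesgue. y \<in> ball x d \<longrightarrow> P y" using loc by blast
    have "{y \<in> space lebesgue. \<not> (y \<in> ball x d \<longrightarrow> P y)} \<in> null_sets lebesgue"
      by (rule completion.AE_iff_null_sets[THEN iffD1, OF d(2)])
    then have "negligible {y. \<not> (y \<in> ball x d \<longrightarrow> P y)}" by (simp add: negligible_iff_null_sets)
    then have "negligible ({x \<in> \<Omega>. \<not> P x} \<inter> ball x d)" by (rule negligible_subset) auto
    moreover have "openin (top_of_set {x \<in> \<Omega>. \<not> P x}) ({x \<in> \<Omega>. \<not> P x} \<inter> ball x d)" by (simp add: openin_open_Int)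
    ultimately show "\<exists>U. openin (top_of_set {x \<in> \<Omega>. \<not> P x}) U \<and> x \<in> U \<and> negligible U"
      using x d(1) by (intro exI[of _ "{x \<in> \<Omega>. \<not> P x} \<inter> ball x d"]) auto
  qed
  then have N: "{x \<in> \<Omega>. \<not> P x} \<in> null_sets lebesgue" by (simp add: negligible_iff_null_sets)
  have "AE x in lebesgue. x \<in> \<Omega> \<longrightarrow> P x" by (rule AE_I'[OF N]) auto
  then show ?thesis using \<Omega> by (subst AE_restrict_space_iff) auto
qed

lemma open_double_ball:
  fixes x :: "'a::metric_space"
  assumes "open \<Omega>" "x \<in> \<Omega>"
  obtains d where "d > 0" "cball x (2 * d) \<subseteq> \<Omega>"
proof -
  obtain e where "e > 0" "cball x e \<subseteq> \<Omega>" using assms open_contains_cball by blast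
  then show thesis by (intro that[of "e / 2"]) auto
qed

text \<open>Testing with translates of the scaled bump says that the mollifications of \<open>f\<close> vanish, and these
  converge to \<open>f\<close> almost everywhere.\<close>

lemma fundamental_lemma:
  fixes f :: "real^'n \<Rightarrow> 'b::{banach, second_countable_topology}"
  assumes \<Omega>: "open \<Omega>" and f: "L1_loc \<Omega> f"
    and zero: "\<And>\<phi>. test_function \<Omega> \<phi> \<Longrightarrow> (LINT x|lebesgue_on \<Omega>. \<phi> x *\<^sub>R f x) = 0"
  shows "AE x in lebesgue_on \<Omega>. f x = 0"
proof (rule AE_lebesgue_on_local[OF \<Omega>])
  fix x assume "x \<in> \<Omega>"
  then obtain d where d: "d > 0" "cball x (2 * d) \<subseteq> \<Omega>" by (rule open_double_ball[OF \<Omega>])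
  define F where "F z = indicator (cball x (2 * d)) z *\<^sub>R f z" for z
  have F: "integrable lebesgue F" unfolding F_def by (rule L1_loc_integrable[OF f compact_cball d(2)])
  have "AE y in lebesgue. y \<in> ball x d \<longrightarrow> f y = 0"
    using bump_kernel.mollify_AE[OF F]
  proof eventually_elim
    fix y assume lim: "((\<lambda>\<epsilon>. mollify bump_kernel \<epsilon> F y) \<longlongrightarrow> F y) (at_right 0)"
    show "y \<in> ball x d \<longrightarrow> f y = 0"
    proof
      assume y: "y \<in> ball x d"
      have "mollify bump_kernel \<epsilon> F y = 0" if e: "0 < \<epsilon>" "\<epsilon> < d" for \<epsilon>
      proof -
        have sub: "cball y \<epsilon> \<subseteq> cball x (2 * d)"
        proof
          fix z assume "z \<in> cball y \<epsilon>"
          then show "z \<in> cball x (2 * d)" using y e dist_triangle[of x z y] by simp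
        qed
        have "scaled_bump \<epsilon> (y - z) *\<^sub>R F z = scaled_bump \<epsilon> (y - z) *\<^sub>R (indicator (cball y \<epsilon>) z *\<^sub>R f z)" for z
          using sub scaled_bump_outside[OF e(1), of z y] by (cases "z \<in> cball y \<epsilon>") (auto simp: F_def indicator_def)
        then have "mollify bump_kernel \<epsilon> F y = (LINT z|lebesgue. scaled_bump \<epsilon> (y - z) *\<^sub>R (indicator (cball y \<epsilon>) z *\<^sub>R f z))"
          unfolding mollify_conv conv_def by simp
        also have "\<dots> = (LINT z|lebesgue_on \<Omega>. scaled_bump \<epsilon> (y - z) *\<^sub>R f z)"
          using sub d(2) by (intro integral_lebesgue_on_support[OF \<Omega>, symmetric] allI impI scaled_bump_outside[OF e(1)]) auto
        also have "\<dots> = 0" using sub d(2) by (intro zero test_function_scaled_bump[OF e(1)]) auto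
        finally show ?thesis .
      qed
      then have "\<forall>\<^sub>F \<epsilon> in at_right 0. mollify bump_kernel \<epsilon> F y = 0"
        using d(1) by (intro eventually_at_rightI[of 0 d]) auto
      then have "((\<lambda>\<epsilon>. mollify bump_kernel \<epsilon> F y) \<longlongrightarrow> 0) (at_right 0)" by (rule tendsto_eventually)
      then have "F y = 0" using lim by (rule tendsto_unique[OF trivial_limit_at_right_real, rotated])
      moreover have "y \<in> cball x (2 * d)" using y d(1) by simp
      ultimately show "f y = 0" by (simp add: F_def)
    qed
  qed
  with d(1) show "\<exists>d>0. AE y in lebesgue. y \<in> ball x d \<longrightarrow> f y = 0" by blast
qed

section \<open>Weak derivatives\<close>

lemma has_weak_derivative_partial:
  assumes "has_weak_derivative \<Omega> u D" "test_function \<Omega> \<phi>"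
  shows "(LINT x|lebesgue_on \<Omega>. partial j \<phi> x *\<^sub>R u x) = - (LINT x|lebesgue_on \<Omega>. \<phi> x *\<^sub>R D x (axis j 1))"
  using assms unfolding has_weak_derivative_def partial_def by blast

lemma bounded_linear_blinfun_at: "bounded_linear (\<lambda>T. blinfun_apply T h)"
  by (rule bounded_linear_intros bounded_linear_ident)+

lemma blinfun_eq_axis:
  fixes T T' :: "(real^'n) \<Rightarrow>\<^sub>L 'b::real_normed_vector"
  assumes "\<And>j. T (axis j 1) = T' (axis j 1)"
  shows "T = T'"
proof (rule blinfun_eqI)
  fix h
  have "linear (blinfun_apply T)" "linear (blinfun_apply T')"
    using blinfun.bounded_linear_right bounded_linear.linear by blast+
  then show "T h = T' h" using linear_axis_expansion[of T h] linear_axis_expansion[of T' h] assms by simp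
qed

lemma weak_derivative_unique:
  fixes u :: "real^'n \<Rightarrow> 'e::euclidean_space"
  assumes \<Omega>: "open \<Omega>" and D: "has_weak_derivative \<Omega> u D" and D': "has_weak_derivative \<Omega> u D'"
  shows "AE x in lebesgue_on \<Omega>. D x = D' x"
proof -
  have L: "L1_loc \<Omega> (\<lambda>x. D x h)" "L1_loc \<Omega> (\<lambda>x. D' x h)" for h
    using D D' unfolding has_weak_derivative_def by (auto intro: L1_loc_bounded_linear[OF bounded_linear_blinfun_at])
  have "AE x in lebesgue_on \<Omega>. D x (axis j 1) - D' x (axis j 1) = 0" for j
  proof (rule fundamental_lemma[OF \<Omega> L1_loc_diff[OF L]])
    fix \<phi> assume \<phi>: "test_function \<Omega> \<phi>"
    obtain K where K: "compact K" "K \<subseteq> \<Omega>" "\<forall>x. x \<notin> K \<longrightarrow> \<phi> x = 0" "continuous_on UNIV \<phi>"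
      by (rule test_functionE[OF \<phi>]) blast
    have "(LINT x|lebesgue_on \<Omega>. \<phi> x *\<^sub>R (D x (axis j 1) - D' x (axis j 1))) =
      (LINT x|lebesgue_on \<Omega>. \<phi> x *\<^sub>R D x (axis j 1)) - (LINT x|lebesgue_on \<Omega>. \<phi> x *\<^sub>R D' x (axis j 1))"
      unfolding scaleR_diff_right by (intro Bochner_Integration.integral_diff integrable_test[OF \<Omega> K(4,1,2,3)] L)
    also have "\<dots> = 0"
      using has_weak_derivative_partial[OF D \<phi>, of j] has_weak_derivative_partial[OF D' \<phi>, of j] by simp
    finally show "(LINT x|lebesgue_on \<Omega>. \<phi> x *\<^sub>R (D x (axis j 1) - D' x (axis j 1))) = 0" .
  qed
  then have "AE x in lebesgue_on \<Omega>. \<forall>j\<in>UNIV. D x (axis j 1) - D' x (axis j 1) = 0"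
    by (intro AE_finite_allI) auto
  then show ?thesis by eventually_elim (auto intro: blinfun_eq_axis)
qed

lemma test_function_subset: "test_function \<Omega>' \<phi> \<Longrightarrow> \<Omega>' \<subseteq> \<Omega> \<Longrightarrow> test_function \<Omega> \<phi>"
  unfolding test_function_def by blast

text \<open>A test function of the smaller set is one of the larger set, and the integrals only see its
  support.\<close>

lemma has_weak_derivative_subset:
  fixes u :: "real^'n \<Rightarrow> 'e::euclidean_space"
  assumes D: "has_weak_derivative \<Omega> u D" and \<Omega>: "open \<Omega>" "open \<Omega>'" "\<Omega>' \<subseteq> \<Omega>"
  shows "has_weak_derivative \<Omega>' u D"
  unfolding has_weak_derivative_def
proof (intro conjI allI impI)
  show "L1_loc \<Omega>' u" "L1_loc \<Omega>' D"
    using D L1_loc_subset[OF _ \<Omega>(3)] unfolding has_weak_derivative_def by blast+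
  fix \<phi> j assume \<phi>: "test_function \<Omega>' \<phi>"
  obtain K where K: "compact K" "K \<subseteq> \<Omega>'" "\<forall>x. x \<notin> K \<longrightarrow> \<phi> x = 0" "\<And>j. \<forall>x. x \<notin> K \<longrightarrow> partial j \<phi> x = 0"
    by (rule test_functionE[OF \<phi>]) blast
  have K': "K \<subseteq> \<Omega>" using K(2) \<Omega>(3) by blast
  have "(LINT x|lebesgue_on \<Omega>'. partial j \<phi> x *\<^sub>R u x) = (LINT x|lebesgue_on \<Omega>. partial j \<phi> x *\<^sub>R u x)"
    by (simp only: integral_lebesgue_on_support[OF \<Omega>(2) K(2) K(4)] integral_lebesgue_on_support[OF \<Omega>(1) K' K(4)])
  also have "\<dots> = - (LINT x|lebesgue_on \<Omega>. \<phi> x *\<^sub>R D x (axis j 1))"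
    by (rule has_weak_derivative_partial[OF D test_function_subset[OF \<phi> \<Omega>(3)]])
  also have "(LINT x|lebesgue_on \<Omega>. \<phi> x *\<^sub>R D x (axis j 1)) = (LINT x|lebesgue_on \<Omega>'. \<phi> x *\<^sub>R D x (axis j 1))"
    by (simp only: integral_lebesgue_on_support[OF \<Omega>(2) K(2) K(3)] integral_lebesgue_on_support[OF \<Omega>(1) K' K(3)])
  finally show "(LINT x|lebesgue_on \<Omega>'. frechet_derivative \<phi> (at x) (axis j 1) *\<^sub>R u x) =
    - (LINT x|lebesgue_on \<Omega>'. \<phi> x *\<^sub>R D x (axis j 1))" unfolding partial_def .
qed

section \<open>Existence of traces on spheres\<close>

text \<open>Completeness of \<open>L\<^sup>1\<close> in the form needed here: a telescoping series whose norms have summable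
  integrals converges absolutely almost everywhere, and the sum of the norms dominates.\<close>

lemma integral_norm_cauchy_limit:
  fixes w :: "nat \<Rightarrow> 'a \<Rightarrow> 'b::{banach, second_countable_topology}"
  assumes w: "\<And>k. integrable M (w k)"
    and sum: "summable (\<lambda>k. LINT x|M. norm (w (Suc k) x - w k x))"
  obtains g where "integrable M g" "(\<lambda>k. LINT x|M. norm (w k x - g x)) \<longlonglongrightarrow> 0"
proof -
  define s where "s k x = w (Suc k) x - w k x" for k x
  have s: "integrable M (s k)" for k unfolding s_def using w by (intro Bochner_Integration.integrable_diff)
  have sn: "integrable M (\<lambda>x. norm (s k x))" for k by (rule integrable_norm[OF s])
  define a where "a k = (LINT x|M. norm (s k x))" for k
  have a: "summable a" "0 \<le> a k" for k using sum by (simp_all add: a_def[abs_def] s_def)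
  have "(\<integral>\<^sup>+x. (\<Sum>k. ennreal (norm (s k x))) \<partial>M) = (\<Sum>k. \<integral>\<^sup>+x. ennreal (norm (s k x)) \<partial>M)"
    using s by (intro nn_integral_suminf) simp
  also have "\<dots> = (\<Sum>k. ennreal (a k))"
    unfolding a_def by (intro suminf_cong nn_integral_eq_integral sn) simp
  also have "\<dots> = ennreal (suminf a)" using a by (intro suminf_ennreal2) auto
  finally have "(\<integral>\<^sup>+x. (\<Sum>k. ennreal (norm (s k x))) \<partial>M) \<noteq> \<infinity>" by simp
  then have "AE x in M. (\<Sum>k. ennreal (norm (s k x))) \<noteq> \<infinity>"
    using s by (intro nn_integral_noteq_infinite) auto
  then have ae: "AE x in M. summable (\<lambda>k. norm (s k x))"
    by eventually_elim (intro summable_suminf_not_top, auto)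
  have S: "integrable M (\<lambda>x. \<Sum>k. norm (s k x))"
    using ae a by (intro integrable_suminf sn) (simp_all add: a_def[abs_def])
  have G: "integrable M (\<lambda>x. \<Sum>k. s k x)"
    using ae a by (intro integrable_suminf s) (simp_all add: a_def[abs_def])
  define g where "g x = w 0 x + (\<Sum>k. s k x)" for x
  have g: "integrable M g" unfolding g_def by (intro Bochner_Integration.integrable_add w G)
  have tel: "w k x = w 0 x + (\<Sum>i<k. s i x)" for k x
    using sum_lessThan_telescope[of "\<lambda>n. w n x" k] by (simp add: s_def)
  have "(\<lambda>k. LINT x|M. norm (w k x - g x)) \<longlonglongrightarrow> (LINT x|M. 0)"
  proof (rule integral_dominated_convergence[where w="\<lambda>x. 2 * (\<Sum>k. norm (s k x))"])
    show "(\<lambda>x. norm (w k x - g x)) \<in> borel_measurable M" for k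
      by (intro borel_measurable_integrable integrable_norm Bochner_Integration.integrable_diff w g)
    show "integrable M (\<lambda>x. 2 * (\<Sum>k. norm (s k x)))" by (intro integrable_mult_right S)
    show "AE x in M. (\<lambda>k. norm (w k x - g x)) \<longlonglongrightarrow> 0"
      using ae
    proof eventually_elim
      fix x assume "summable (\<lambda>k. norm (s k x))"
      then have "summable (\<lambda>k. s k x)" by (rule summable_norm_cancel)
      then have "(\<lambda>k. (\<Sum>i<k. s i x)) \<longlonglongrightarrow> (\<Sum>k. s k x)" by (rule summable_LIMSEQ)
      then have "(\<lambda>k. norm ((\<Sum>i<k. s i x) - (\<Sum>k. s k x))) \<longlonglongrightarrow> norm ((\<Sum>k. s k x) - (\<Sum>k. s k x))"
        by (intro tendsto_intros)
      then show "(\<lambda>k. norm (w k x - g x)) \<longlonglongrightarrow> 0" by (subst tel) (simp add: g_def)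
    qed
    show "AE x in M. norm (norm (w k x - g x)) \<le> 2 * (\<Sum>k. norm (s k x))" for k
      using ae
    proof eventually_elim
      fix x assume sm: "summable (\<lambda>k. norm (s k x))"
      have "norm (\<Sum>i<k. s i x) \<le> (\<Sum>i<k. norm (s i x))" by (rule norm_sum)
      also have "\<dots> \<le> (\<Sum>k. norm (s k x))" by (rule sum_le_suminf[OF sm]) auto
      finally have 1: "norm (\<Sum>i<k. s i x) \<le> (\<Sum>k. norm (s k x))" .
      have 2: "norm (\<Sum>k. s k x) \<le> (\<Sum>k. norm (s k x))" by (rule summable_norm[OF sm])
      have "w k x - g x = (\<Sum>i<k. s i x) - (\<Sum>k. s k x)" by (subst tel) (simp add: g_def)
      then show "norm (norm (w k x - g x)) \<le> 2 * (\<Sum>k. norm (s k x))"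
        using 1 2 norm_triangle_ineq4[of "\<Sum>i<k. s i x" "\<Sum>k. s k x"] by simp
    qed
  qed simp
  then show thesis by (intro that[OF g]) simp
qed

lemma smooth_imp_Ck: "smooth_on f S \<Longrightarrow> Ck_on k f S"
  unfolding smooth_on_def by blast

lemma Ck_on_diff:
  assumes "open S" "Ck_on k f S" "Ck_on k g S"
  shows "Ck_on k (\<lambda>x. f x - g x) S"
  using Ck_on_add[OF assms(1,2) Ck_on_bounded_linear[OF assms(1) bounded_linear_minus[OF bounded_linear_ident] assms(3)]]
  by simp

lemma grad_diff:
  assumes f: "Ck_on (Suc 0) f UNIV" and g: "Ck_on (Suc 0) g UNIV"
  shows "grad (\<lambda>x. f x - g x) y = grad f y - grad g y"
proof (rule blinfun_eqI)
  fix h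
  have "frechet_derivative (\<lambda>x. f x - g x) (at y) = (\<lambda>h. frechet_derivative f (at y) h - frechet_derivative g (at y) h)"
    by (intro frechet_eq has_derivative_diff Ck1_derivative f g)
  then show "grad (\<lambda>x. f x - g x) y h = (grad f y - grad g y) h"
    by (simp add: grad_apply[OF f] grad_apply[OF g] grad_apply[OF Ck_on_diff[OF open_UNIV f g]] blinfun.diff_left)
qed

text \<open>The derivative falls on the kernel, and \<open>z \<mapsto> scaled_bump \<epsilon> (y - z)\<close> is a test function when its
  support lies in \<open>\<Omega>\<close>. Cutting \<open>u\<close> off by the indicator of \<open>K\<close> is harmless because the kernel at \<open>y\<close>
  does not reach the complement of \<open>K\<close>.\<close>

lemma grad_mollify:
  fixes u :: "real^'n \<Rightarrow> 'e::euclidean_space"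
  assumes \<Omega>: "open \<Omega>" and D: "has_weak_derivative \<Omega> u D" and K: "compact K" "K \<subseteq> \<Omega>"
    and e: "0 < \<epsilon>" and y: "cball y \<epsilon> \<subseteq> K"
  shows "grad (mollify bump_kernel \<epsilon> (\<lambda>z. indicator K z *\<^sub>R u z)) y = mollify bump_kernel \<epsilon> (\<lambda>z. indicator K z *\<^sub>R D z) y"
proof (rule blinfun_eq_axis)
  fix j :: 'n
  let ?u = "\<lambda>z. indicator K z *\<^sub>R u z" and ?D = "\<lambda>z. indicator K z *\<^sub>R D z"
  have L: "L1_loc \<Omega> u" "L1_loc \<Omega> D" using D unfolding has_weak_derivative_def by blast+
  have ui: "integrable lebesgue ?u" and Di: "integrable lebesgue ?D"
    by (rule L1_loc_integrable[OF L(1) K], rule L1_loc_integrable[OF L(2) K])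
  have ss: "smooth_supp \<epsilon> (scaled_bump \<epsilon> :: real^'n \<Rightarrow> real)" by (rule smooth_supp_scaled_bump[OF e])
  have C1: "Ck_on (Suc 0) (conv (scaled_bump \<epsilon>) ?u) UNIV" by (rule smooth_imp_Ck[OF smooth_conv[OF ss ui]])
  define \<phi> where "\<phi> z = scaled_bump \<epsilon> (y - z)" for z
  have test: "test_function \<Omega> \<phi>" unfolding \<phi>_def[abs_def] by (rule test_function_scaled_bump[OF e order_trans[OF y K(2)]])
  have \<phi>0: "\<forall>z. z \<notin> K \<longrightarrow> \<phi> z = 0" using y scaled_bump_outside[OF e] unfolding \<phi>_def by blast
  have p\<phi>: "partial j \<phi> z = - partial j (scaled_bump \<epsilon>) (y - z)" for z
  proof -
    have C: "Ck_on (Suc 0) (scaled_bump \<epsilon> :: real^'n \<Rightarrow> real) UNIV" using ss unfolding smooth_supp_def by (blast intro: smooth_imp_Ck)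
    have "\<phi> = (\<lambda>z. scaled_bump \<epsilon> (y + (- 1) *\<^sub>R z))" by (simp add: \<phi>_def fun_eq_iff)
    then have "frechet_derivative \<phi> (at z) = (\<lambda>h. (- 1) *\<^sub>R frechet_derivative (scaled_bump \<epsilon>) (at (y + (- 1) *\<^sub>R z)) h)"
      by (simp only: frechet_affine[OF C])
    then show ?thesis by (simp add: partial_def)
  qed
  have p\<phi>0: "\<forall>z. z \<notin> K \<longrightarrow> partial j \<phi> z = 0"
    using partial_outside_support[OF compact_imp_closed[OF K(1)] \<phi>0] by blast
  have "grad (mollify bump_kernel \<epsilon> ?u) y (axis j 1) = partial j (conv (scaled_bump \<epsilon>) ?u) y"
    unfolding mollify_conv grad_apply[OF C1] partial_def ..
  also have "\<dots> = conv (partial j (scaled_bump \<epsilon>)) ?u y" by (rule partial_conv[OF ss ui])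
  also have "\<dots> = - (LINT z|lebesgue. partial j \<phi> z *\<^sub>R ?u z)"
    unfolding conv_def p\<phi> by simp
  also have "(LINT z|lebesgue. partial j \<phi> z *\<^sub>R ?u z) = (LINT z|lebesgue_on \<Omega>. partial j \<phi> z *\<^sub>R u z)"
    by (rule integral_lebesgue_on_support[OF \<Omega> K(2) p\<phi>0, symmetric])
  also have "\<dots> = - (LINT z|lebesgue_on \<Omega>. \<phi> z *\<^sub>R D z (axis j 1))" by (rule has_weak_derivative_partial[OF D test])
  also have "(LINT z|lebesgue_on \<Omega>. \<phi> z *\<^sub>R D z (axis j 1)) = (LINT z|lebesgue. \<phi> z *\<^sub>R (indicator K z *\<^sub>R D z (axis j 1)))"
    by (rule integral_lebesgue_on_support[OF \<Omega> K(2) \<phi>0])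
  also have "\<dots> = (LINT z|lebesgue. (\<phi> z *\<^sub>R ?D z) (axis j 1))"
    by (simp add: blinfun.scaleR_left)
  also have "\<dots> = (LINT z|lebesgue. \<phi> z *\<^sub>R ?D z) (axis j 1)"
    unfolding \<phi>_def by (intro integral_bounded_linear[OF bounded_linear_blinfun_at] integrable_smooth_supp_scaleR[OF ss Di])
  also have "(LINT z|lebesgue. \<phi> z *\<^sub>R ?D z) = mollify bump_kernel \<epsilon> ?D y"
    unfolding mollify_conv conv_def \<phi>_def ..
  finally show "grad (mollify bump_kernel \<epsilon> ?u) y (axis j 1) = mollify bump_kernel \<epsilon> ?D y (axis j 1)" by simp
qed

lemma mollify_L1:
  fixes f :: "real^'n \<Rightarrow> 'b::{banach, second_countable_topology}"
  assumes f: "integrable lebesgue f"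
  shows "((\<lambda>\<epsilon>. LINT x|lebesgue. norm (mollify bump_kernel \<epsilon> f x - f x)) \<longlongrightarrow> 0) (at_right 0)"
    and "0 < \<epsilon> \<Longrightarrow> integrable lebesgue (\<lambda>x. norm (mollify bump_kernel \<epsilon> f x - f x))"
  using bump_kernel.mollify_Lp(2,3)[OF order_refl f] integrable_norm[OF f] by (simp_all add: powr_one_gt_zero_iff)

text \<open>The set \<open>K'\<close> is the closed \<open>d\<close>-neighbourhood of \<open>K\<close>, which is compact as the sum of two compact
  sets.\<close>

lemma compact_collar:
  fixes K :: "'a::euclidean_space set"
  assumes K: "compact K" "K \<subseteq> \<Omega>" "open \<Omega>"
  obtains d K' where "0 < d" "compact K'" "K' \<subseteq> \<Omega>" "\<And>x. x \<in> K \<Longrightarrow> cball x d \<subseteq> K'"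
proof -
  obtain d where d: "d > 0" "(\<Union>x\<in>K. cball x d) \<subseteq> \<Omega>"
    by (rule compact_subset_open_imp_cball_epsilon_subset[OF K(1,3,2)])
  have "compact {x + y | x y. x \<in> K \<and> y \<in> cball 0 d}" by (rule compact_sums[OF K(1) compact_cball])
  moreover have eq: "{x + y | x y. x \<in> K \<and> y \<in> cball 0 d} = (\<Union>x\<in>K. cball x d)"
  proof (intro equalityI subsetI)
    fix z assume "z \<in> (\<Union>x\<in>K. cball x d)"
    then obtain x where "x \<in> K" "dist x z \<le> d" by auto
    then have "z = x + (z - x)" "x \<in> K" "z - x \<in> cball 0 d" by (auto simp: dist_norm norm_minus_commute)
    then show "z \<in> {x + y | x y. x \<in> K \<and> y \<in> cball 0 d}" by blast
  next
    fix z assume "z \<in> {x + y | x y. x \<in> K \<and> y \<in> cball 0 d}"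
    then obtain x y where xy: "z = x + y" "x \<in> K" "y \<in> cball 0 d" by blast
    then have "z \<in> cball x d" by (simp add: dist_norm)
    with xy(2) show "z \<in> (\<Union>x\<in>K. cball x d)" by blast
  qed
  ultimately show thesis using d by (intro that[of d "\<Union>x\<in>K. cball x d"]) auto
qed

text \<open>Mollifications with rapidly decreasing bandwidth \<open>e k\<close> approximate \<open>u\<close> in \<open>W\<^sup>1\<^sup>,\<^sup>1\<close> of the ball with
  error at most \<open>(1/2) ^ k\<close>. The trace inequality turns this into summable distances between
  consecutive restrictions to the sphere, so these restrictions converge in \<open>L\<^sup>1\<close>.\<close>

lemma has_sphere_trace_exists:
  fixes u :: "real^'n \<Rightarrow> 'e::euclidean_space"
  assumes \<Omega>: "open \<Omega>" and D: "has_weak_derivative \<Omega> u D" and sub: "cball x r \<subseteq> \<Omega>" and r: "0 < r"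
  shows "\<exists>g. has_sphere_trace u x r g"
proof -
  obtain d K where d: "0 < d" and K: "compact K" "K \<subseteq> \<Omega>" and coll: "\<And>y. y \<in> cball x r \<Longrightarrow> cball y d \<subseteq> K"
    by (rule compact_collar[OF compact_cball sub \<Omega>]) blast
  have bK: "y \<in> K" if "y \<in> ball x r" for y
    by (rule subsetD[OF coll[of y]]) (use that d in auto)
  have L: "L1_loc \<Omega> u" "L1_loc \<Omega> D" using D unfolding has_weak_derivative_def by blast+
  define U where "U z = indicator K z *\<^sub>R u z" for z
  define V where "V z = indicator K z *\<^sub>R D z" for z
  have U: "integrable lebesgue U" and V: "integrable lebesgue V"
    unfolding U_def V_def by (rule L1_loc_integrable[OF L(1) K], rule L1_loc_integrable[OF L(2) K])
  \<comment> \<open>The bandwidth stays below the width \<open>d\<close> of the collar, so that \<open>grad_mollify\<close> applies on the ball.\<close>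
  define P where "P k e \<longleftrightarrow> 0 < e \<and> e < d \<and> (LINT y|lebesgue. norm (mollify bump_kernel e U y - U y)) < (1/2) ^ k \<and>
    (LINT y|lebesgue. norm (mollify bump_kernel e V y - V y)) < (1/2) ^ k" for k :: nat and e
  have "\<exists>e. P k e" for k
  proof -
    have "\<forall>\<^sub>F e in at_right 0. e \<in> {0<..<d}" by (rule eventually_at_right_real[OF d])
    moreover have "\<forall>\<^sub>F e in at_right 0. (LINT y|lebesgue. norm (mollify bump_kernel e U y - U y)) < (1/2) ^ k"
      by (rule order_tendstoD(2)[OF mollify_L1(1)[OF U]]) simp
    moreover have "\<forall>\<^sub>F e in at_right 0. (LINT y|lebesgue. norm (mollify bump_kernel e V y - V y)) < (1/2) ^ k"
      by (rule order_tendstoD(2)[OF mollify_L1(1)[OF V]]) simp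
    ultimately have "\<forall>\<^sub>F e in at_right 0. P k e"
      unfolding P_def by eventually_elim simp
    then show ?thesis by (rule eventually_happens'[OF trivial_limit_at_right_real])
  qed
  then obtain e where "\<forall>k. P k (e k)" using choice[of P] by blast
  then have e: "0 < e k" "e k < d" "(LINT y|lebesgue. norm (mollify bump_kernel (e k) U y - U y)) < (1/2) ^ k"
    "(LINT y|lebesgue. norm (mollify bump_kernel (e k) V y - V y)) < (1/2) ^ k" for k
    unfolding P_def by simp_all
  define v where "v k = mollify bump_kernel (e k) U" for k
  have smooth: "smooth_on (v k) UNIV" for k
    unfolding v_def mollify_conv by (rule smooth_conv[OF smooth_supp_scaled_bump[OF e(1)] U])
  have C1: "Ck_on (Suc 0) (v k) UNIV" for k by (rule smooth_imp_Ck[OF smooth])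
  have cv: "continuous_on UNIV (v k)" for k by (rule smooth_imp_continuous[OF smooth])
  have gv: "grad (v k) y = mollify bump_kernel (e k) V y" if "y \<in> ball x r" for k y
    unfolding v_def U_def[abs_def] V_def[abs_def]
  proof (rule grad_mollify[OF \<Omega> D K e(1)])
    have "cball y (e k) \<subseteq> cball y d" using e(2)[of k] by (intro subset_cball) simp
    also have "cball y d \<subseteq> K" using that by (intro coll) simp
    finally show "cball y (e k) \<subseteq> K" .
  qed
  have b: "ball x r \<in> sets lebesgue" by simp
  have UV: "U y = u y" "V y = D y" if "y \<in> ball x r" for y using that bK by (auto simp: U_def V_def)
  have a1: "(LINT y|lebesgue. indicator (ball x r) y * norm (v k y - U y)) \<le> (1/2) ^ k" for k
  proof -
    have i: "integrable lebesgue (\<lambda>y. norm (v k y - U y))" unfolding v_def by (rule mollify_L1(2)[OF U e(1)])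
    have "(LINT y|lebesgue. indicator (ball x r) y * norm (v k y - U y)) \<le> (LINT y|lebesgue. norm (v k y - U y))"
      using integrable_indicator_scaleR[OF i b] by (intro integral_mono i) (auto simp: indicator_def)
    then show ?thesis using e(3)[of k] unfolding v_def by linarith
  qed
  have i2: "integrable lebesgue (\<lambda>y. norm (mollify bump_kernel (e k) V y - V y))" for k by (rule mollify_L1(2)[OF V e(1)])
  have eqV: "indicator (ball x r) y * norm (grad (v k) y - V y) = indicator (ball x r) y * norm (mollify bump_kernel (e k) V y - V y)" for k y
    by (cases "y \<in> ball x r") (simp_all add: gv)
  have a2: "(LINT y|lebesgue. indicator (ball x r) y * norm (grad (v k) y - V y)) \<le> (1/2) ^ k" for k
  proof -
    have "(LINT y|lebesgue. indicator (ball x r) y * norm (grad (v k) y - V y)) \<le> (LINT y|lebesgue. norm (mollify bump_kernel (e k) V y - V y))"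
      unfolding eqV using integrable_indicator_scaleR[OF i2 b] by (intro integral_mono i2) (auto simp: indicator_def)
    then show ?thesis using e(4)[of k] by linarith
  qed
  have j1: "integrable lebesgue (\<lambda>y. indicator (ball x r) y * norm (v k y - U y))" for k
    using integrable_indicator_scaleR[OF mollify_L1(2)[OF U e(1)] b] by (simp add: v_def)
  have j2: "integrable lebesgue (\<lambda>y. indicator (ball x r) y * norm (grad (v k) y - V y))" for k
    unfolding eqV using integrable_indicator_scaleR[OF i2 b] by simp
  define w where "w k \<eta> = v k (x + r *\<^sub>R \<eta>)" for k \<eta>
  have wi: "integrable sphere_measure (w k)" for k
    unfolding w_def by (rule integrable_sphere_measure_continuous(1))
      (rule continuous_on_compose2[OF cv], auto intro!: continuous_intros)
  define c where "c = (real CARD('n) / r ^ CARD('n)) + (r / r ^ CARD('n))"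
  have c0: "0 \<le> real CARD('n) / r ^ CARD('n)" "0 \<le> r / r ^ CARD('n)" using r by auto
  have step: "(LINT \<eta>|sphere_measure. norm (w (Suc k) \<eta> - w k \<eta>)) \<le> c * (2 * (1/2) ^ k)" for k
  proof -
    let ?f = "\<lambda>y. v (Suc k) y - v k y"
    have half: "(1/2 :: real) ^ Suc k \<le> (1/2) ^ k" by simp
    have C: "Ck_on (Suc 0) ?f UNIV" by (rule Ck_on_diff[OF open_UNIV C1 C1])
    have "(LINT y|lebesgue. indicator (ball x r) y * norm (?f y)) \<le>
      (LINT y|lebesgue. indicator (ball x r) y * norm (v (Suc k) y - U y) + indicator (ball x r) y * norm (v k y - U y))"
    proof (rule integral_mono)
      show "integrable lebesgue (\<lambda>y. indicator (ball x r) y * norm (?f y))"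
        using integrable_indicator_continuous[of "\<lambda>y. norm (?f y)" "ball x r"] cv by (simp add: continuous_intros)
      show "indicator (ball x r) y * norm (?f y) \<le> indicator (ball x r) y * norm (v (Suc k) y - U y) + indicator (ball x r) y * norm (v k y - U y)" for y
        using norm_triangle_ineq4[of "v (Suc k) y - U y" "v k y - U y"] by (simp add: indicator_def)
    qed (intro Bochner_Integration.integrable_add j1)
    also have "\<dots> \<le> 2 * (1/2) ^ k" using order_trans[OF a1[of "Suc k"] half] a1[of k] j1 by simp
    finally have 1: "(LINT y|lebesgue. indicator (ball x r) y * norm (?f y)) \<le> 2 * (1/2) ^ k" .
    have "(LINT y|lebesgue. indicator (ball x r) y * norm (grad ?f y)) \<le>
      (LINT y|lebesgue. indicator (ball x r) y * norm (grad (v (Suc k)) y - V y) + indicator (ball x r) y * norm (grad (v k) y - V y))"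
    proof (rule integral_mono)
      show "integrable lebesgue (\<lambda>y. indicator (ball x r) y * norm (grad ?f y))"
        using integrable_indicator_continuous[OF continuous_on_norm[OF grad_continuous[OF C]], of "ball x r"] by simp
      show "indicator (ball x r) y * norm (grad ?f y) \<le> indicator (ball x r) y * norm (grad (v (Suc k)) y - V y) + indicator (ball x r) y * norm (grad (v k) y - V y)" for y
        using norm_triangle_ineq4[of "grad (v (Suc k)) y - V y" "grad (v k) y - V y"] by (simp add: indicator_def grad_diff[OF C1 C1])
    qed (intro Bochner_Integration.integrable_add j2)
    also have "\<dots> \<le> 2 * (1/2) ^ k" using order_trans[OF a2[of "Suc k"] half] a2[of k] j2 by simp
    finally have 2: "(LINT y|lebesgue. indicator (ball x r) y * norm (grad ?f y)) \<le> 2 * (1/2) ^ k" .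
    have "(LINT \<eta>|sphere_measure. norm (w (Suc k) \<eta> - w k \<eta>)) \<le>
      (real CARD('n) / r ^ CARD('n)) * (LINT y|lebesgue. indicator (ball x r) y * norm (?f y)) +
      (r / r ^ CARD('n)) * (LINT y|lebesgue. indicator (ball x r) y * norm (grad ?f y))"
      unfolding w_def by (rule trace_inequality_ball[OF C r])
    also have "\<dots> \<le> (real CARD('n) / r ^ CARD('n)) * (2 * (1/2) ^ k) + (r / r ^ CARD('n)) * (2 * (1/2) ^ k)"
      by (intro add_mono mult_left_mono 1 2 c0)
    finally show ?thesis by (simp add: c_def distrib_right)
  qed
  have "summable (\<lambda>k. c * (2 * (1/2 :: real) ^ k))" by (intro summable_mult summable_geometric) simp
  then have "summable (\<lambda>k. LINT \<eta>|sphere_measure. norm (w (Suc k) \<eta> - w k \<eta>))"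
    by (rule summable_comparison_test'[where N=0]) (use step in simp)
  then obtain g where g: "integrable sphere_measure g" "(\<lambda>k. LINT \<eta>|sphere_measure. norm (w k \<eta> - g \<eta>)) \<longlonglongrightarrow> 0"
    by (rule integral_norm_cauchy_limit[OF wi])
  have pow: "(\<lambda>k. (1/2 :: real) ^ k) \<longlonglongrightarrow> 0" by (rule LIMSEQ_power_zero) simp
  have wd: "has_weak_derivative (ball x r) u D"
    by (rule has_weak_derivative_subset[OF D \<Omega> open_ball]) (use sub ball_subset_cball in blast)
  have int_ball: "integrable (lebesgue_on (ball x r)) u" "integrable (lebesgue_on (ball x r)) D"
  proof -
    have eqU: "indicator (ball x r) y *\<^sub>R u y = indicator (ball x r) y *\<^sub>R U y" for y using UV(1)[of y] by (auto simp: indicator_def)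
    show "integrable (lebesgue_on (ball x r)) u"
      unfolding integrable_lebesgue_on_iff[OF b] eqU by (rule integrable_indicator_scaleR[OF U b])
    have eqV: "indicator (ball x r) y *\<^sub>R D y = indicator (ball x r) y *\<^sub>R V y" for y using UV(2)[of y] by (auto simp: indicator_def)
    show "integrable (lebesgue_on (ball x r)) D"
      unfolding integrable_lebesgue_on_iff[OF b] eqV by (rule integrable_indicator_scaleR[OF V b])
  qed
  have "has_sphere_trace u x r g"
    unfolding has_sphere_trace_def
  proof (intro conjI exI[of _ D] exI[of _ v] allI)
    show "sobolev1 1 (ball x r) u" unfolding sobolev1_def Lp_on_1_iff using wd int_ball by blast
    have "(LINT y|lebesgue_on (ball x r). norm (v k y - u y)) = (LINT y|lebesgue. indicator (ball x r) y * norm (v k y - U y))" for k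
      unfolding integral_lebesgue_on[OF b] by (intro Bochner_Integration.integral_cong) (auto simp: indicator_def UV)
    then have le: "(LINT y|lebesgue_on (ball x r). norm (v k y - u y)) \<le> (1/2) ^ k" for k using a1[of k] by simp
    show "(\<lambda>k. LINT y|lebesgue_on (ball x r). norm (v k y - u y)) \<longlonglongrightarrow> 0"
      by (rule tendsto_sandwich[OF _ _ tendsto_const pow]) (use le in auto)
    have "(LINT y|lebesgue_on (ball x r). norm (grad (v k) y - D y)) = (LINT y|lebesgue. indicator (ball x r) y * norm (grad (v k) y - V y))" for k
      unfolding integral_lebesgue_on[OF b] by (intro Bochner_Integration.integral_cong) (auto simp: indicator_def UV)
    then have le: "(LINT y|lebesgue_on (ball x r). norm (grad (v k) y - D y)) \<le> (1/2) ^ k" for k using a2[of k] by simp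
    have "(\<lambda>k. LINT y|lebesgue_on (ball x r). norm (grad (v k) y - D y)) \<longlonglongrightarrow> 0"
      by (rule tendsto_sandwich[OF _ _ tendsto_const pow]) (use le in auto)
    then show "(\<lambda>k. LINT y|lebesgue_on (ball x r). norm (Blinfun (frechet_derivative (v k) (at y)) - D y)) \<longlonglongrightarrow> 0"
      unfolding grad_def .
    show "(\<lambda>k. LINT \<eta>|sphere_measure. norm (v k (x + r *\<^sub>R \<eta>) - g \<eta>)) \<longlonglongrightarrow> 0"
      using g(2) unfolding w_def .
  qed (fact r g wd smooth)+
  then show ?thesis by (rule exI[of _ g])
qed

section \<open>Spherical difference quotients as volume means\<close>

lemma space_sphere_measure: "space (sphere_measure :: (real^'n) measure) = sphere 0 1"
  by (simp add: sphere_measure_density space_restrict_space)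

lemma integrable_sphere_nth_scaleR:
  fixes g :: "real^'n \<Rightarrow> 'b::{banach, second_countable_topology}"
  assumes g: "integrable sphere_measure g"
  shows "integrable sphere_measure (\<lambda>\<eta>. (\<eta> $ j) *\<^sub>R g \<eta>)"
    and "norm (LINT \<eta>|sphere_measure. (\<eta> $ j) *\<^sub>R g \<eta>) \<le> (LINT \<eta>|sphere_measure. norm (g \<eta>))"
proof -
  have "integrable sphere_measure (\<lambda>\<eta>::real^'n. \<eta> $ j)"
    by (rule integrable_sphere_measure_continuous(1)) (intro continuous_intros)
  then have m: "(\<lambda>\<eta>::real^'n. \<eta> $ j) \<in> borel_measurable sphere_measure" by (rule borel_measurable_integrable)
  have le: "norm ((\<eta> $ j) *\<^sub>R g \<eta>) \<le> norm (g \<eta>)" if "\<eta> \<in> space sphere_measure" for \<eta>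
    using component_le_norm_cart[of \<eta> j] that by (simp add: space_sphere_measure mult_left_le_one_le)
  show i: "integrable sphere_measure (\<lambda>\<eta>. (\<eta> $ j) *\<^sub>R g \<eta>)"
    by (rule Bochner_Integration.integrable_bound[OF g])
      (intro borel_measurable_scaleR m borel_measurable_integrable[OF g], rule AE_I2, rule le)
  have "norm (LINT \<eta>|sphere_measure. (\<eta> $ j) *\<^sub>R g \<eta>) \<le> (LINT \<eta>|sphere_measure. norm ((\<eta> $ j) *\<^sub>R g \<eta>))"
    by (rule integral_norm_bound)
  also have "\<dots> \<le> (LINT \<eta>|sphere_measure. norm (g \<eta>))"
    by (intro integral_mono integrable_norm i g le)
  finally show "norm (LINT \<eta>|sphere_measure. (\<eta> $ j) *\<^sub>R g \<eta>) \<le> (LINT \<eta>|sphere_measure. norm (g \<eta>))" .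
qed

text \<open>The divergence theorem for a constant function. Because of this the value \<open>u x\<close> drops out of the
  spherical difference quotients.\<close>

lemma sphere_measure_nth_const: "(LINT \<eta>|sphere_measure. (\<eta> $ j) *\<^sub>R c) = (0 :: 'b::{banach, second_countable_topology})"
  using divergence_unit_ball[OF Ck_on_const, of j c] by (simp add: partial_def frechet_derivative_const)

text \<open>Both sides are continuous under the convergence that defines the trace, so the divergence theorem
  passes from the smooth approximations to \<open>u\<close>. The weak derivative in the definition of the trace may
  differ from \<open>D\<close>, but only on a null set.\<close>

lemma trace_divergence:
  fixes u :: "real^'n \<Rightarrow> 'e::euclidean_space"
  assumes tr: "has_sphere_trace u x r g" and D: "has_weak_derivative (ball x r) u D"
    and Di: "integrable lebesgue (\<lambda>y. indicator (ball x r) y *\<^sub>R D y)"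
  shows "(LINT \<eta>|sphere_measure. (\<eta> $ j) *\<^sub>R g \<eta>) =
    (r / r ^ CARD('n)) *\<^sub>R (LINT y|lebesgue. indicator (ball x r) y *\<^sub>R D y) (axis j 1)"
proof -
  obtain D' v where r: "0 < r" and g: "integrable sphere_measure g" and D': "has_weak_derivative (ball x r) u D'"
    and v: "\<And>k. smooth_on (v k) UNIV"
    and lim2: "(\<lambda>k. LINT y|lebesgue_on (ball x r). norm (grad (v k) y - D' y)) \<longlonglongrightarrow> 0"
    and lim3: "(\<lambda>k. LINT \<eta>|sphere_measure. norm (v k (x + r *\<^sub>R \<eta>) - g \<eta>)) \<longlonglongrightarrow> 0"
    using tr unfolding has_sphere_trace_def grad_def by blast
  have C1: "Ck_on (Suc 0) (v k) UNIV" for k by (rule smooth_imp_Ck[OF v])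
  have cv: "continuous_on UNIV (v k)" for k by (rule smooth_imp_continuous[OF v])
  have b: "ball x r \<in> sets lebesgue" by simp
  define A where "A k = (LINT \<eta>|sphere_measure. (\<eta> $ j) *\<^sub>R v k (x + r *\<^sub>R \<eta>))" for k
  have vi: "integrable sphere_measure (\<lambda>\<eta>. v k (x + r *\<^sub>R \<eta>))" for k
    by (rule integrable_sphere_measure_continuous(1))
      (rule continuous_on_compose2[OF cv], auto intro!: continuous_intros)
  have "norm (A k - (LINT \<eta>|sphere_measure. (\<eta> $ j) *\<^sub>R g \<eta>)) \<le> (LINT \<eta>|sphere_measure. norm (v k (x + r *\<^sub>R \<eta>) - g \<eta>))" for k
  proof -
    have "A k - (LINT \<eta>|sphere_measure. (\<eta> $ j) *\<^sub>R g \<eta>) = (LINT \<eta>|sphere_measure. (\<eta> $ j) *\<^sub>R (v k (x + r *\<^sub>R \<eta>) - g \<eta>))"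
      unfolding A_def scaleR_diff_right
      by (intro Bochner_Integration.integral_diff[symmetric] integrable_sphere_nth_scaleR(1) vi g)
    then show ?thesis
      using integrable_sphere_nth_scaleR(2)[OF Bochner_Integration.integrable_diff[OF vi g], of j k] by simp
  qed
  then have Alim: "(\<lambda>k. A k - (LINT \<eta>|sphere_measure. (\<eta> $ j) *\<^sub>R g \<eta>)) \<longlonglongrightarrow> 0"
    by (intro Lim_null_comparison[OF always_eventually lim3] allI)
  define I where "I = (LINT y|lebesgue. indicator (ball x r) y *\<^sub>R D y)"
  define B where "B k = (LINT y|lebesgue. indicator (ball x r) y *\<^sub>R partial j (v k) y)" for k
  have gi: "integrable lebesgue (\<lambda>y. indicator (ball x r) y *\<^sub>R grad (v k) y)" for k
    by (rule integrable_indicator_continuous[OF grad_continuous[OF C1]]) auto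
  have di: "integrable lebesgue (\<lambda>y. indicator (ball x r) y *\<^sub>R (grad (v k) y - D y))" for k
    unfolding scaleR_diff_right by (rule Bochner_Integration.integrable_diff[OF gi Di])
  have Bk: "B k - I (axis j 1) = (LINT y|lebesgue. indicator (ball x r) y *\<^sub>R (grad (v k) y - D y)) (axis j 1)" for k
  proof -
    have "B k = (LINT y|lebesgue. (indicator (ball x r) y *\<^sub>R grad (v k) y) (axis j 1))"
      unfolding B_def by (simp add: blinfun.scaleR_left grad_apply[OF C1] partial_def)
    also have "\<dots> = (LINT y|lebesgue. indicator (ball x r) y *\<^sub>R grad (v k) y) (axis j 1)"
      by (rule integral_bounded_linear[OF bounded_linear_blinfun_at gi])
    finally show ?thesis
      unfolding I_def scaleR_diff_right Bochner_Integration.integral_diff[OF gi Di] by (simp add: blinfun.diff_left)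
  qed
  have "norm (B k - I (axis j 1)) \<le> (LINT y|lebesgue_on (ball x r). norm (grad (v k) y - D' y))" for k
  proof -
    have ae: "AE y in lebesgue. norm (indicator (ball x r) y *\<^sub>R (grad (v k) y - D y)) = indicator (ball x r) y *\<^sub>R norm (grad (v k) y - D' y)"
    proof -
      have "AE y in lebesgue_on (ball x r). D y = D' y" by (rule weak_derivative_unique[OF open_ball D D'])
      then have "AE y in lebesgue. y \<in> ball x r \<longrightarrow> D y = D' y" by (subst (asm) AE_restrict_space_iff) auto
      then show ?thesis by eventually_elim (auto simp: indicator_def)
    qed
    have m: "(\<lambda>y. norm (indicator (ball x r) y *\<^sub>R (grad (v k) y - D y))) \<in> borel_measurable lebesgue"
      by (rule borel_measurable_integrable[OF integrable_norm[OF di]])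
    have "norm (B k - I (axis j 1)) \<le> norm (LINT y|lebesgue. indicator (ball x r) y *\<^sub>R (grad (v k) y - D y)) * norm (axis j 1 :: real^'n)"
      unfolding Bk by (rule norm_blinfun)
    also have "\<dots> = norm (LINT y|lebesgue. indicator (ball x r) y *\<^sub>R (grad (v k) y - D y))" by (simp add: norm_axis_1)
    also have "\<dots> \<le> (LINT y|lebesgue. norm (indicator (ball x r) y *\<^sub>R (grad (v k) y - D y)))" by (rule integral_norm_bound)
    also have "\<dots> = (LINT y|lebesgue. indicator (ball x r) y *\<^sub>R norm (grad (v k) y - D' y))"
      by (rule integral_cong_AE[OF m borel_measurable_AE[OF m ae] ae])
    also have "\<dots> = (LINT y|lebesgue_on (ball x r). norm (grad (v k) y - D' y))" by (rule integral_lebesgue_on[OF b, symmetric])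
    finally show ?thesis .
  qed
  then have "(\<lambda>k. B k - I (axis j 1)) \<longlonglongrightarrow> 0"
    by (intro Lim_null_comparison[OF always_eventually lim2] allI)
  then have "(\<lambda>k. (r / r ^ CARD('n)) *\<^sub>R B k) \<longlonglongrightarrow> (r / r ^ CARD('n)) *\<^sub>R I (axis j 1)"
    by (rule tendsto_scaleR[OF tendsto_const LIM_zero_cancel])
  moreover have "A = (\<lambda>k. (r / r ^ CARD('n)) *\<^sub>R B k)"
    unfolding A_def B_def by (rule ext) (rule divergence_ball[OF C1 r])
  ultimately have "A \<longlonglongrightarrow> (r / r ^ CARD('n)) *\<^sub>R I (axis j 1)" by simp
  then show ?thesis unfolding I_def[symmetric] using LIM_zero_cancel[OF Alim] LIMSEQ_unique by blast
qed

lemma bounded_linear_tensor_arg: "bounded_linear (\<lambda>\<eta>. (\<xi> \<bullet> \<eta>) *\<^sub>R (a :: 'e::real_normed_vector))"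
  by (rule bounded_linear_scaleR_const[OF bounded_linear_inner_right])

lemma tensor_apply: "blinfun_apply (tensor a \<xi>) \<eta> = (\<xi> \<bullet> \<eta>) *\<^sub>R a"
  unfolding tensor_def by (simp add: bounded_linear_Blinfun_apply[OF bounded_linear_tensor_arg])

lemma bounded_linear_tensor: "bounded_linear (\<lambda>a :: 'e::euclidean_space. tensor a \<xi>)"
  unfolding linear_conv_bounded_linear[symmetric]
  by (rule linearI; rule blinfun_eqI) (simp_all add: tensor_apply blinfun.add_left blinfun.scaleR_left scaleR_add_right)

text \<open>Separates the dependence on \<open>\<xi>\<close> from a bounded linear function of the vector argument, so that
  integrals of tensors reduce to the integrals against the coordinates of \<open>\<xi>\<close>.\<close>

lemma tensor_expansion:
  fixes \<xi> :: "real^'n"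
  shows "tensor a \<xi> = (\<Sum>j\<in>UNIV. tensor ((\<xi> $ j) *\<^sub>R a) (axis j 1))"
  by (rule blinfun_eqI) (simp add: tensor_apply blinfun.sum_left inner_vec_def[of \<xi>] inner_axis' scaleR_sum_left mult.commute)

text \<open>For any trace \<open>g\<close> and any constant \<open>c\<close> in place of \<open>u x\<close>, the spherical integrals of the
  difference quotients are multiples of the integral of the weak derivative over the ball.\<close>

context
  fixes u :: "real^'n \<Rightarrow> 'e::euclidean_space" and x r g and D :: "real^'n \<Rightarrow> ((real^'n) \<Rightarrow>\<^sub>L 'e)" and c :: 'e
  assumes tr: "has_sphere_trace u x r g" and D: "has_weak_derivative (ball x r) u D"
    and Di: "integrable lebesgue (\<lambda>y. indicator (ball x r) y *\<^sub>R D y)"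
begin

lemma trace_quotient_integrable: "integrable sphere_measure (\<lambda>\<eta>. (g \<eta> - c) /\<^sub>R r)"
proof -
  have "integrable sphere_measure g" using tr unfolding has_sphere_trace_def by blast
  moreover have "integrable sphere_measure (\<lambda>\<eta>::real^'n. c)" by (rule integrable_sphere_measure_continuous(1)) (rule continuous_on_const)
  ultimately show ?thesis by (intro integrable_scaleR_right Bochner_Integration.integrable_diff)
qed

lemma trace_quotient_nth:
  "(LINT \<eta>|sphere_measure. (\<eta> $ j) *\<^sub>R ((g \<eta> - c) /\<^sub>R r)) =
    (1 / r ^ CARD('n)) *\<^sub>R (LINT y|lebesgue. indicator (ball x r) y *\<^sub>R D y) (axis j 1)"
proof -
  have r: "0 < r" and g: "integrable sphere_measure g" using tr unfolding has_sphere_trace_def by blast+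
  have ci: "integrable sphere_measure (\<lambda>\<eta>::real^'n. c)" by (rule integrable_sphere_measure_continuous(1)) (rule continuous_on_const)
  have "(LINT \<eta>|sphere_measure. (\<eta> $ j) *\<^sub>R ((g \<eta> - c) /\<^sub>R r)) =
    (LINT \<eta>|sphere_measure. inverse r *\<^sub>R ((\<eta> $ j) *\<^sub>R g \<eta> - (\<eta> $ j) *\<^sub>R c))"
    by (rule Bochner_Integration.integral_cong) (simp_all add: scaleR_diff_right mult.commute)
  also have "\<dots> = inverse r *\<^sub>R (LINT \<eta>|sphere_measure. (\<eta> $ j) *\<^sub>R g \<eta> - (\<eta> $ j) *\<^sub>R c)" by (rule integral_scaleR_right)
  also have "(LINT \<eta>|sphere_measure. (\<eta> $ j) *\<^sub>R g \<eta> - (\<eta> $ j) *\<^sub>R c) = (LINT \<eta>|sphere_measure. (\<eta> $ j) *\<^sub>R g \<eta>) - (LINT \<eta>|sphere_measure. (\<eta> $ j) *\<^sub>R c)"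
    by (intro Bochner_Integration.integral_diff integrable_sphere_nth_scaleR(1) g ci)
  also have "\<dots> = (r / r ^ CARD('n)) *\<^sub>R (LINT y|lebesgue. indicator (ball x r) y *\<^sub>R D y) (axis j 1)"
    unfolding trace_divergence[OF tr D Di] sphere_measure_nth_const by simp
  finally show ?thesis using r by (simp add: divide_inverse)
qed

lemma trace_quotient_tensor:
  "(LINT \<xi>|sphere_measure. tensor ((g \<xi> - c) /\<^sub>R r) \<xi>) =
    (1 / r ^ CARD('n)) *\<^sub>R (LINT y|lebesgue. indicator (ball x r) y *\<^sub>R D y)"
proof -
  define I where "I = (LINT y|lebesgue. indicator (ball x r) y *\<^sub>R D y)"
  have i: "integrable sphere_measure (\<lambda>\<eta>. (\<eta> $ j) *\<^sub>R ((g \<eta> - c) /\<^sub>R r))" for j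
    by (rule integrable_sphere_nth_scaleR(1)[OF trace_quotient_integrable])
  have "(LINT \<xi>|sphere_measure. tensor ((g \<xi> - c) /\<^sub>R r) \<xi>) =
    (LINT \<xi>|sphere_measure. (\<Sum>j\<in>UNIV. tensor ((\<xi> $ j) *\<^sub>R ((g \<xi> - c) /\<^sub>R r)) (axis j 1)))"
    by (rule Bochner_Integration.integral_cong[OF refl], rule tensor_expansion)
  also have "\<dots> = (\<Sum>j\<in>UNIV. LINT \<xi>|sphere_measure. tensor ((\<xi> $ j) *\<^sub>R ((g \<xi> - c) /\<^sub>R r)) (axis j 1))"
    by (intro Bochner_Integration.integral_sum integrable_bounded_linear[OF bounded_linear_tensor] i)
  also have "\<dots> = (\<Sum>j\<in>UNIV. tensor (LINT \<xi>|sphere_measure. (\<xi> $ j) *\<^sub>R ((g \<xi> - c) /\<^sub>R r)) (axis j 1))"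
    by (intro sum.cong refl integral_bounded_linear[OF bounded_linear_tensor] i)
  also have "\<dots> = (\<Sum>j\<in>UNIV. tensor ((1 / r ^ CARD('n)) *\<^sub>R I (axis j 1)) (axis j 1))"
    unfolding trace_quotient_nth I_def ..
  also have "\<dots> = (1 / r ^ CARD('n)) *\<^sub>R I"
  proof (rule blinfun_eqI)
    fix h
    have "I h = (\<Sum>j\<in>UNIV. (h $ j) *\<^sub>R I (axis j 1))"
      by (rule linear_axis_expansion[OF bounded_linear.linear[OF blinfun.bounded_linear_right]])
    then show "(\<Sum>j\<in>UNIV. tensor ((1 / r ^ CARD('n)) *\<^sub>R I (axis j 1)) (axis j 1)) h = ((1 / r ^ CARD('n)) *\<^sub>R I) h"
      by (simp add: blinfun.sum_left blinfun.scaleR_left tensor_apply inner_axis' scaleR_sum_right mult.commute)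
  qed
  finally show ?thesis unfolding I_def .
qed

lemma trace_quotient_inner:
  "(LINT \<eta>|sphere_measure. (\<xi> \<bullet> \<eta>) *\<^sub>R ((g \<eta> - c) /\<^sub>R r)) = (LINT \<eta>|sphere_measure. tensor ((g \<eta> - c) /\<^sub>R r) \<eta>) \<xi>"
proof -
  have i: "integrable sphere_measure (\<lambda>\<eta>. (\<eta> $ j) *\<^sub>R ((g \<eta> - c) /\<^sub>R r))" for j
    by (rule integrable_sphere_nth_scaleR(1)[OF trace_quotient_integrable])
  have "integrable sphere_measure (\<lambda>\<xi>. \<Sum>j\<in>UNIV. tensor ((\<xi> $ j) *\<^sub>R ((g \<xi> - c) /\<^sub>R r)) (axis j 1))"
    by (intro Bochner_Integration.integrable_sum integrable_bounded_linear[OF bounded_linear_tensor] i)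
  moreover have "(\<lambda>\<eta>. tensor ((g \<eta> - c) /\<^sub>R r) \<eta>) = (\<lambda>\<xi>. \<Sum>j\<in>UNIV. tensor ((\<xi> $ j) *\<^sub>R ((g \<xi> - c) /\<^sub>R r)) (axis j 1))"
    by (rule ext, rule tensor_expansion)
  ultimately have "integrable sphere_measure (\<lambda>\<eta>. tensor ((g \<eta> - c) /\<^sub>R r) \<eta>)" by (simp only:)
  from integral_bounded_linear[OF bounded_linear_blinfun_at this, of \<xi>]
  show ?thesis by (simp add: tensor_apply inner_commute)
qed

end

definition ball_kernel :: "real^'n \<Rightarrow> real"
  where "ball_kernel y = indicator (ball 0 1) y / measure lebesgue (ball (0::real^'n) 1)"

interpretation ball_kernel: mollifier "ball_kernel :: real^'n \<Rightarrow> real" "1 / measure lebesgue (ball (0::real^'n) 1)"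
proof
  have pos: "0 < measure lebesgue (ball (0::real^'n) 1)" by simp
  show "ball_kernel \<in> borel_measurable borel" unfolding ball_kernel_def[abs_def]
    by (intro borel_measurable_divide borel_measurable_indicator borel_measurable_const) simp
  show "0 \<le> ball_kernel y" "ball_kernel y \<le> 1 / measure lebesgue (ball (0::real^'n) 1)" for y :: "real^'n"
    by (auto simp: ball_kernel_def indicator_def)
  show "ball_kernel y = 0" if "1 \<le> norm y" for y :: "real^'n" using that by (simp add: ball_kernel_def)
  show "(LINT y|lebesgue. ball_kernel (y :: real^'n)) = 1"
    unfolding ball_kernel_def using pos by simp
  have "isCont ball_kernel y" if "norm y \<noteq> 1" for y :: "real^'n"
  proof (cases "norm y < 1")
    case True
    then have "\<forall>\<^sub>F z in nhds y. z \<in> ball 0 1" by (intro eventually_nhds_in_open) auto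
    then have "\<forall>\<^sub>F z in nhds y. ball_kernel z = 1 / measure lebesgue (ball (0::real^'n) 1)"
      by eventually_elim (simp add: ball_kernel_def)
    then show ?thesis using isCont_cong[of ball_kernel "\<lambda>_. 1 / measure lebesgue (ball (0::real^'n) 1)" y] by simp
  next
    case False
    then have "\<forall>\<^sub>F z in nhds y. z \<in> - cball 0 1" using that by (intro eventually_nhds_in_open) auto
    then have "\<forall>\<^sub>F z in nhds y. ball_kernel z = 0"
      by eventually_elim (simp add: ball_kernel_def)
    then show ?thesis using isCont_cong[of ball_kernel "\<lambda>_. 0" y] by simp
  qed
  then have "norm y = 1" if "\<not> isCont ball_kernel y" for y :: "real^'n" using that by blast
  then have "{y :: real^'n. \<not> isCont ball_kernel y} \<subseteq> sphere 0 1" by auto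
  then show "negligible {y :: real^'n. \<not> isCont ball_kernel y}" by (rule negligible_subset[OF negligible_sphere])
qed

lemma mollify_ball_kernel:
  fixes f :: "real^'n \<Rightarrow> 'b::{banach, second_countable_topology}"
  assumes e: "0 < \<epsilon>"
  shows "mollify ball_kernel \<epsilon> f x = (1 / measure lebesgue (ball (0::real^'n) 1)) *\<^sub>R
    ((1 / \<epsilon> ^ CARD('n)) *\<^sub>R (LINT z|lebesgue. indicator (ball x \<epsilon>) z *\<^sub>R f z))"
proof -
  have "ball_kernel ((x - z) /\<^sub>R \<epsilon>) = indicator (ball x \<epsilon>) z / measure lebesgue (ball (0::real^'n) 1)" for z
  proof -
    have "norm ((x - z) /\<^sub>R \<epsilon>) = dist x z / \<epsilon>" using e by (simp add: dist_norm divide_inverse mult.commute)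
    also have "\<dots> < 1 \<longleftrightarrow> dist x z < \<epsilon>" using e by simp
    finally show ?thesis by (simp add: ball_kernel_def indicator_def)
  qed
  then have "mollify ball_kernel \<epsilon> f x = (LINT z|lebesgue. ((1 / measure lebesgue (ball (0::real^'n) 1)) * (1 / \<epsilon> ^ CARD('n))) *\<^sub>R (indicator (ball x \<epsilon>) z *\<^sub>R f z))"
    unfolding mollify_def by (intro Bochner_Integration.integral_cong) simp_all
  also have "\<dots> = ((1 / measure lebesgue (ball (0::real^'n) 1)) * (1 / \<epsilon> ^ CARD('n))) *\<^sub>R (LINT z|lebesgue. indicator (ball x \<epsilon>) z *\<^sub>R f z)"
    by (rule integral_scaleR_right)
  finally show ?thesis by simp
qed

text \<open>The key identity: since the volume of the ball of radius \<open>\<epsilon>\<close> is \<open>\<epsilon> ^ n\<close> times that of the unit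
  ball, the spherical mean at \<open>x\<close> is exactly the mean of the weak derivative over the ball about
  \<open>x\<close>. Restricting the derivative to a compact set makes it globally integrable.\<close>

lemma sphere_difference_mean_eq:
  fixes u :: "real^'n \<Rightarrow> 'e::euclidean_space"
  assumes \<Omega>: "open \<Omega>" and D: "has_weak_derivative \<Omega> u D" and K: "compact K" "K \<subseteq> \<Omega>"
    and e: "0 < \<epsilon>" and sub: "cball x \<epsilon> \<subseteq> K"
  shows "sphere_difference_mean u \<epsilon> x = mollify ball_kernel \<epsilon> (\<lambda>z. indicator K z *\<^sub>R D z) x"
    and "(1 / measure lborel (ball (0::real^'n) 1)) *\<^sub>R
        (LINT \<eta>|sphere_measure. (\<xi> \<bullet> \<eta>) *\<^sub>R ((sphere_trace u x \<epsilon> \<eta> - u x) /\<^sub>R \<epsilon>)) = sphere_difference_mean u \<epsilon> x \<xi>"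
    and "\<exists>g. has_sphere_trace u x \<epsilon> g"
proof -
  show ex: "\<exists>g. has_sphere_trace u x \<epsilon> g"
    by (rule has_sphere_trace_exists[OF \<Omega> D order_trans[OF sub K(2)] e])
  have tr: "has_sphere_trace u x \<epsilon> (sphere_trace u x \<epsilon>)"
    unfolding sphere_trace_def by (rule someI_ex[OF ex])
  have bK: "ball x \<epsilon> \<subseteq> K" using sub ball_subset_cball by blast
  have wd: "has_weak_derivative (ball x \<epsilon>) u D"
    by (rule has_weak_derivative_subset[OF D \<Omega> open_ball order_trans[OF bK K(2)]])
  have eq: "indicator (ball x \<epsilon>) y *\<^sub>R (indicator K y *\<^sub>R D y) = indicator (ball x \<epsilon>) y *\<^sub>R D y" for y
    using bK by (auto simp: indicator_def)
  have "L1_loc \<Omega> D" using D unfolding has_weak_derivative_def by blast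
  then have "integrable lebesgue (\<lambda>y. indicator K y *\<^sub>R D y)" by (rule L1_loc_integrable[OF _ K])
  from integrable_indicator_scaleR[OF this, of "ball x \<epsilon>"]
  have Di: "integrable lebesgue (\<lambda>y. indicator (ball x \<epsilon>) y *\<^sub>R D y)" unfolding eq by simp
  show "sphere_difference_mean u \<epsilon> x = mollify ball_kernel \<epsilon> (\<lambda>z. indicator K z *\<^sub>R D z) x"
    unfolding mollify_ball_kernel[OF e] eq sphere_difference_mean_def trace_quotient_tensor[OF tr wd Di] by simp
  show "(1 / measure lborel (ball (0::real^'n) 1)) *\<^sub>R
        (LINT \<eta>|sphere_measure. (\<xi> \<bullet> \<eta>) *\<^sub>R ((sphere_trace u x \<epsilon> \<eta> - u x) /\<^sub>R \<epsilon>)) = sphere_difference_mean u \<epsilon> x \<xi>"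
    unfolding sphere_difference_mean_def trace_quotient_inner[OF tr wd Di] by (simp add: blinfun.scaleR_left)
qed

section \<open>Convergence of the spherical means\<close>

text \<open>The key identity holds for every small \<open>\<epsilon>\<close>, so the limit exists at every Lebesgue point of the
  weak derivative.\<close>

lemma spherical_mean_AE:
  fixes u :: "real^'n \<Rightarrow> 'e::euclidean_space"
  assumes \<Omega>: "open \<Omega>" and D: "has_weak_derivative \<Omega> u D"
  shows "AE x in lebesgue_on \<Omega>. has_harmonic_differential u x (D x) \<and>
    ((\<lambda>\<epsilon>. sphere_difference_mean u \<epsilon> x) \<longlongrightarrow> D x) (at_right 0)"
proof (rule AE_lebesgue_on_local[OF \<Omega>])
  fix x0 assume "x0 \<in> \<Omega>"
  then obtain d where d: "d > 0" "cball x0 (2 * d) \<subseteq> \<Omega>" by (rule open_double_ball[OF \<Omega>])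
  define V where "V z = indicator (cball x0 (2 * d)) z *\<^sub>R D z" for z
  have "L1_loc \<Omega> D" using D unfolding has_weak_derivative_def by blast
  then have V: "integrable lebesgue V" unfolding V_def by (rule L1_loc_integrable[OF _ compact_cball d(2)])
  have "AE x in lebesgue. x \<in> ball x0 d \<longrightarrow> has_harmonic_differential u x (D x) \<and>
    ((\<lambda>\<epsilon>. sphere_difference_mean u \<epsilon> x) \<longlongrightarrow> D x) (at_right 0)"
    using ball_kernel.mollify_AE[OF V]
  proof (eventually_elim, intro impI)
    fix x assume lim: "((\<lambda>\<epsilon>. mollify ball_kernel \<epsilon> V x) \<longlongrightarrow> V x) (at_right 0)" and x: "x \<in> ball x0 d"
    have sub: "cball x \<epsilon> \<subseteq> cball x0 (2 * d)" if "\<epsilon> < d" for \<epsilon>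
    proof
      fix z assume "z \<in> cball x \<epsilon>"
      then show "z \<in> cball x0 (2 * d)" using x that dist_triangle[of x0 z x] by simp
    qed
    note eqs = sphere_difference_mean_eq[OF \<Omega> D compact_cball d(2) _ sub]
    have small: "\<forall>\<^sub>F \<epsilon> in at_right 0. \<epsilon> \<in> {0<..<d}" by (rule eventually_at_right_real[OF d(1)])
    have Vx: "V x = D x" using x d(1) by (simp add: V_def)
    have "\<forall>\<^sub>F \<epsilon> in at_right 0. sphere_difference_mean u \<epsilon> x = mollify ball_kernel \<epsilon> V x"
      using small by eventually_elim (simp add: eqs(1) V_def[abs_def])
    then have mean: "((\<lambda>\<epsilon>. sphere_difference_mean u \<epsilon> x) \<longlongrightarrow> D x) (at_right 0)"
      using lim unfolding Vx by (simp add: tendsto_cong)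
    have "has_harmonic_differential u x (D x)"
      unfolding has_harmonic_differential_def
    \<comment> \<open>No exceptional radii occur: the trace exists for every small radius, so the null set is empty.\<close>
    proof (intro allI bexI[of _ "{}"] conjI)
      fix \<xi> :: "real^'n"
      show "\<forall>\<^sub>F \<epsilon> in at 0 within {0<..} - {}. \<exists>g. has_sphere_trace u x \<epsilon> g"
        unfolding Diff_empty using small by eventually_elim (rule eqs(3); simp)
      have "((\<lambda>\<epsilon>. sphere_difference_mean u \<epsilon> x \<xi>) \<longlongrightarrow> D x \<xi>) (at_right 0)"
        by (rule bounded_linear.tendsto[OF bounded_linear_blinfun_at mean])
      moreover have "\<forall>\<^sub>F \<epsilon> in at_right 0. (1 / measure lborel (ball (0::real^'n) 1)) *\<^sub>R
        (LINT \<eta>|sphere_measure. (\<xi> \<bullet> \<eta>) *\<^sub>R ((sphere_trace u x \<epsilon> \<eta> - u x) /\<^sub>R \<epsilon>)) = sphere_difference_mean u \<epsilon> x \<xi>"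
        using small by eventually_elim (rule eqs(2); simp)
      ultimately show "((\<lambda>\<epsilon>. (1 / measure lborel (ball (0::real^'n) 1)) *\<^sub>R
        (LINT \<eta>|sphere_measure. (\<xi> \<bullet> \<eta>) *\<^sub>R ((sphere_trace u x \<epsilon> \<eta> - u x) /\<^sub>R \<epsilon>))) \<longlongrightarrow> D x \<xi>) (at 0 within {0<..} - {})"
        unfolding Diff_empty by (subst tendsto_cong)
    qed simp
    with mean show "has_harmonic_differential u x (D x) \<and> ((\<lambda>\<epsilon>. sphere_difference_mean u \<epsilon> x) \<longlongrightarrow> D x) (at_right 0)"
      by blast
  qed
  with d(1) show "\<exists>d>0. AE x in lebesgue. x \<in> ball x0 d \<longrightarrow> has_harmonic_differential u x (D x) \<and>
    ((\<lambda>\<epsilon>. sphere_difference_mean u \<epsilon> x) \<longlongrightarrow> D x) (at_right 0)" by blast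
qed

lemma Lp_on_cong_AE:
  fixes f g :: "real^'n \<Rightarrow> 'b::{banach, second_countable_topology}"
  assumes "Lp_on p S f" "g \<in> borel_measurable (lebesgue_on S)" "AE x in lebesgue_on S. f x = g x"
  shows "Lp_on p S g"
proof -
  have f: "integrable (lebesgue_on S) (\<lambda>x. norm (f x) powr p)" using assms(1) unfolding Lp_on_def by blast
  have "(\<lambda>x. norm (g x) powr p) \<in> borel_measurable (lebesgue_on S)" using assms(2) by measurable
  moreover have "AE x in lebesgue_on S. norm (f x) powr p = norm (g x) powr p" using assms(3) by eventually_elim simp
  ultimately have "integrable (lebesgue_on S) (\<lambda>x. norm (g x) powr p)"
    using integrable_cong_AE[of "\<lambda>x. norm (f x) powr p" "lebesgue_on S" "\<lambda>x. norm (g x) powr p"] f by simp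
  then show ?thesis using assms(2) unfolding Lp_on_def by blast
qed

lemma Lp_on_subset:
  fixes f :: "real^'n \<Rightarrow> 'b::{banach, second_countable_topology}"
  assumes f: "Lp_on p S f" and "S \<in> sets lebesgue" "T \<in> sets lebesgue" "T \<subseteq> S"
  shows "Lp_on p T f"
  unfolding Lp_on_def
proof
  show "f \<in> borel_measurable (lebesgue_on T)"
    using f assms(4) unfolding Lp_on_def by (blast intro: measurable_restrict_mono)
  have "integrable lebesgue (\<lambda>x. indicator S x *\<^sub>R (norm (f x) powr p))"
    using f unfolding Lp_on_def integrable_lebesgue_on_iff[OF assms(2)] by blast
  from integrable_indicator_scaleR[OF this assms(3)]
  have "integrable lebesgue (\<lambda>x. indicator T x *\<^sub>R (indicator S x *\<^sub>R (norm (f x) powr p)))" .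
  moreover have "indicator T x *\<^sub>R (indicator S x *\<^sub>R (norm (f x) powr p)) = indicator T x *\<^sub>R (norm (f x) powr p)" for x
    using assms(4) by (auto simp: indicator_def)
  ultimately show "integrable (lebesgue_on T) (\<lambda>x. norm (f x) powr p)"
    unfolding integrable_lebesgue_on_iff[OF assms(3)] by (simp only:)
qed

text \<open>Only some weak derivative of \<open>u\<close> is assumed to be \<open>p\<close>-integrable; uniqueness transfers this to
  \<open>D\<close>.\<close>

lemma weak_derivative_Lp_on_compact:
  fixes u :: "real^'n \<Rightarrow> 'e::euclidean_space"
  assumes \<Omega>: "open \<Omega>" and u: "sobolev1 p \<Omega> u" and D: "has_weak_derivative \<Omega> u D"
    and K: "compact K" "K \<subseteq> \<Omega>"
  shows "Lp_on p K D"
proof -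
  obtain D' where D': "has_weak_derivative \<Omega> u D'" "Lp_on p \<Omega> D'" using u unfolding sobolev1_def by blast
  note sets = open_sets_lebesgue[OF \<Omega>] compact_sets_lebesgue[OF K(1)]
  have "AE x in lebesgue. x \<in> \<Omega> \<longrightarrow> D' x = D x"
    using weak_derivative_unique[OF \<Omega> D'(1) D] \<Omega> by (subst (asm) AE_restrict_space_iff) auto
  then have "AE x in lebesgue. x \<in> K \<longrightarrow> D' x = D x" by eventually_elim (use K(2) in blast)
  then have ae: "AE x in lebesgue_on K. D' x = D x" using sets by (subst AE_restrict_space_iff) auto
  have "D \<in> borel_measurable (lebesgue_on K)"
    using D K unfolding has_weak_derivative_def L1_loc_def Lp_on_def by blast
  then show ?thesis by (rule Lp_on_cong_AE[OF Lp_on_subset[OF D'(2) sets K(2)] _ ae])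
qed

lemma spherical_mean_Lp:
  fixes u :: "real^'n \<Rightarrow> 'e::euclidean_space"
  assumes \<Omega>: "open \<Omega>" and p: "1 \<le> p" and u: "sobolev1 p \<Omega> u" and D: "has_weak_derivative \<Omega> u D"
  shows "tendsto_Lp_loc p \<Omega> (sphere_difference_mean u) D (at_right 0)"
  unfolding tendsto_Lp_loc_def
proof (intro allI impI)
  fix K assume "compact K \<and> K \<subseteq> \<Omega>"
  then have K: "compact K" "K \<subseteq> \<Omega>" by auto
  have Ks: "K \<in> sets lebesgue" by (rule compact_sets_lebesgue[OF K(1)])
  obtain d K' where d: "0 < d" and K': "compact K'" "K' \<subseteq> \<Omega>" and coll: "\<And>x. x \<in> K \<Longrightarrow> cball x d \<subseteq> K'"
    by (rule compact_collar[OF K \<Omega>]) blast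
  have K's: "K' \<in> sets lebesgue" by (rule compact_sets_lebesgue[OF K'(1)])
  have KK': "x \<in> K'" if "x \<in> K" for x using coll[OF that] d by auto
  define V where "V z = indicator K' z *\<^sub>R D z" for z
  have "L1_loc \<Omega> D" using D unfolding has_weak_derivative_def by blast
  then have V: "integrable lebesgue V" unfolding V_def by (rule L1_loc_integrable[OF _ K'])
  have "Lp_on p K' D" by (rule weak_derivative_Lp_on_compact[OF \<Omega> u D K'])
  then have "integrable lebesgue (\<lambda>x. indicator K' x *\<^sub>R (norm (D x) powr p))"
    unfolding Lp_on_def integrable_lebesgue_on_iff[OF K's] by blast
  moreover have "indicator K' x *\<^sub>R (norm (D x) powr p) = norm (V x) powr p" for x
    using p by (auto simp: V_def indicator_def)
  ultimately have Vp: "integrable lebesgue (\<lambda>x. norm (V x) powr p)" by simp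
  note Lp = ball_kernel.mollify_Lp[OF p V Vp]
  have eq: "sphere_difference_mean u \<epsilon> x = mollify ball_kernel \<epsilon> V x" if "\<epsilon> \<in> {0<..<d}" "x \<in> K" for \<epsilon> x
    unfolding V_def[abs_def]
  proof (rule sphere_difference_mean_eq(1)[OF \<Omega> D K'])
    show "0 < \<epsilon>" using that by simp
    have "cball x \<epsilon> \<subseteq> cball x d" using that by (intro subset_cball) simp
    then show "cball x \<epsilon> \<subseteq> K'" using coll[OF that(2)] by blast
  qed
  have small: "\<forall>\<^sub>F \<epsilon> in at_right 0. \<epsilon> \<in> {0<..<d}" by (rule eventually_at_right_real[OF d])
  have "Lp_on p K (sphere_difference_mean u \<epsilon>)" if e: "\<epsilon> \<in> {0<..<d}" for \<epsilon>
    unfolding Lp_on_def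
  proof
    have e0: "0 < \<epsilon>" using e by simp
    have "mollify ball_kernel \<epsilon> V \<in> borel_measurable (lebesgue_on K)"
      by (rule measurable_restrict_space1[OF borel_measurable_lebesgue_continuous[OF ball_kernel.mollify_continuous[OF e0 V]]])
    then show "sphere_difference_mean u \<epsilon> \<in> borel_measurable (lebesgue_on K)"
      by (rule measurable_cong[THEN iffD1, rotated]) (simp add: eq[OF e])
    have eqK: "indicator K x *\<^sub>R (norm (sphere_difference_mean u \<epsilon> x) powr p) = indicator K x *\<^sub>R (norm (mollify ball_kernel \<epsilon> V x) powr p)" for x
      using eq[OF e, of x] by (simp add: indicator_def)
    show "integrable (lebesgue_on K) (\<lambda>x. norm (sphere_difference_mean u \<epsilon> x) powr p)"
      unfolding integrable_lebesgue_on_iff[OF Ks] eqK by (rule integrable_indicator_scaleR[OF Lp(1)[OF e0] Ks])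
  qed
  then have ev: "\<forall>\<^sub>F \<epsilon> in at_right 0. Lp_on p K (sphere_difference_mean u \<epsilon>)"
    using small by (rule eventually_mono[rotated])
  have bound: "(LINT x|lebesgue_on K. norm (sphere_difference_mean u \<epsilon> x - D x) powr p) \<le>
    (LINT x|lebesgue. norm (mollify ball_kernel \<epsilon> V x - V x) powr p)" if e: "\<epsilon> \<in> {0<..<d}" for \<epsilon>
  proof -
    have e0: "0 < \<epsilon>" using e by simp
    have "(LINT x|lebesgue_on K. norm (sphere_difference_mean u \<epsilon> x - D x) powr p) =
      (LINT x|lebesgue. indicator K x *\<^sub>R (norm (mollify ball_kernel \<epsilon> V x - V x) powr p))"
      unfolding integral_lebesgue_on[OF Ks]
      by (rule Bochner_Integration.integral_cong[OF refl]) (auto simp: indicator_def eq[OF e] V_def KK')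
    also have "\<dots> \<le> (LINT x|lebesgue. norm (mollify ball_kernel \<epsilon> V x - V x) powr p)"
      by (intro integral_mono integrable_indicator_scaleR[OF Lp(2)[OF e0] Ks] Lp(2)[OF e0]) (simp add: indicator_def)
    finally show ?thesis .
  qed
  have "((\<lambda>\<epsilon>. LINT x|lebesgue_on K. norm (sphere_difference_mean u \<epsilon> x - D x) powr p) \<longlongrightarrow> 0) (at_right 0)"
  proof (rule tendsto_sandwich[OF _ _ tendsto_const Lp(3)])
    show "\<forall>\<^sub>F \<epsilon> in at_right 0. (LINT x|lebesgue_on K. norm (sphere_difference_mean u \<epsilon> x - D x) powr p) \<le>
      (LINT x|lebesgue. norm (mollify ball_kernel \<epsilon> V x - V x) powr p)"
      using small by eventually_elim (rule bound)
  qed simp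
  with ev weak_derivative_Lp_on_compact[OF \<Omega> u D K]
  show "Lp_on p K D \<and> (\<forall>\<^sub>F \<epsilon> in at_right 0. Lp_on p K (sphere_difference_mean u \<epsilon>)) \<and>
    ((\<lambda>\<epsilon>. LINT x|lebesgue_on K. norm (sphere_difference_mean u \<epsilon> x - D x) powr p) \<longlongrightarrow> 0) (at_right 0)" by blast
qed

section \<open>First order operators\<close>

text \<open>The function \<open>a\<close> is smooth on \<open>\<Omega>\<close> only. The product with \<open>\<phi>\<close>, extended by 0, is smooth on
  \<open>\<Omega>\<close> and vanishes on the complement of the support of \<open>\<phi>\<close>, and these two open sets cover the
  space.\<close>

lemma smooth_test_product:
  fixes a :: "real^'n \<Rightarrow> real"
  assumes \<Omega>: "open \<Omega>" and \<phi>: "test_function \<Omega> \<phi>" and a: "smooth_on a \<Omega>"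
  shows "test_function \<Omega> (\<lambda>x. if x \<in> \<Omega> then \<phi> x * a x else 0)"
proof -
  obtain K where K: "compact K" "K \<subseteq> \<Omega>" "\<forall>x. x \<notin> K \<longrightarrow> \<phi> x = 0" and s: "smooth_on \<phi> UNIV"
    using \<phi> unfolding test_function_def by blast
  let ?\<psi> = "\<lambda>x. if x \<in> \<Omega> then \<phi> x * a x else 0"
  have "Ck_on k ?\<psi> UNIV" for k
  proof (rule Ck_on_local)
    fix x :: "real^'n"
    have oK: "open (- K)" using compact_imp_closed[OF K(1)] by (rule open_Compl)
    have 1: "Ck_on k ?\<psi> (- K)"
      by (rule Ck_on_cong_open[OF oK _ Ck_on_const[of k 0]]) (use K(3) in auto)
    have "Ck_on k (\<lambda>x. \<phi> x * a x) \<Omega>"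
      by (intro Ck_on_bilinear[OF \<Omega> bounded_bilinear_mult] Ck_on_subset[OF smooth_imp_Ck[OF s]] smooth_imp_Ck[OF a]) simp
    then have 2: "Ck_on k ?\<psi> \<Omega>" by (rule Ck_on_cong_open[OF \<Omega>, rotated]) simp
    show "\<exists>U. open U \<and> x \<in> U \<and> Ck_on k ?\<psi> U"
    proof (cases "x \<in> K")
      case True
      then show ?thesis using 2 \<Omega> K(2) by blast
    next
      case False
      then show ?thesis using 1 oK by blast
    qed
  qed
  then have "smooth_on ?\<psi> UNIV" unfolding smooth_on_def by blast
  then show ?thesis unfolding test_function_def using K by (intro conjI exI[of _ K]) auto
qed

lemma L1_loc_blinfun_apply:
  fixes w :: "real^'n \<Rightarrow> 'e::euclidean_space" and A :: "real^'n \<Rightarrow> ('e \<Rightarrow>\<^sub>L 'f::euclidean_space)"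
  assumes w: "L1_loc \<Omega> w" and A: "continuous_on \<Omega> A"
  shows "L1_loc \<Omega> (\<lambda>x. A x (w x))"
  unfolding L1_loc_iff
proof (intro allI impI)
  fix K assume K: "compact K \<and> K \<subseteq> \<Omega>"
  have wK: "integrable (lebesgue_on K) w" using w K unfolding L1_loc_iff by blast
  have cA: "continuous_on K A" using A K continuous_on_subset by blast
  have Am: "A \<in> borel_measurable (lebesgue_on K)"
    by (rule continuous_imp_measurable_on_sets_lebesgue[OF cA]) (use K in \<open>simp add: compact_sets_lebesgue\<close>)
  from continuous_compact_bound[OF cA] K obtain B where B: "\<forall>y\<in>K. norm (A y) \<le> B" by blast
  show "integrable (lebesgue_on K) (\<lambda>x. A x (w x))"
  proof (rule Bochner_Integration.integrable_bound[OF integrable_scaleR_right[OF wK, of B]])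
    show "(\<lambda>x. A x (w x)) \<in> borel_measurable (lebesgue_on K)"
      by (rule borel_measurable_continuous_Pair[OF Am borel_measurable_integrable[OF wK]])
        (intro continuous_intros bounded_bilinear.continuous_on[OF bounded_bilinear_blinfun_apply])
    have "norm (A x (w x)) \<le> norm (B *\<^sub>R w x)" if "x \<in> space (lebesgue_on K)" for x
    proof -
      have "norm (A x (w x)) \<le> norm (A x) * norm (w x)" by (rule norm_blinfun)
      also have "\<dots> \<le> \<bar>B\<bar> * norm (w x)" using B that by (intro mult_right_mono) (auto simp: space_restrict_space intro: order_trans[OF _ abs_ge_self])
      finally show ?thesis by simp
    qed
    then show "AE x in lebesgue_on K. norm (A x (w x)) \<le> norm (B *\<^sub>R w x)" by (rule AE_I2)
  qed
qed

text \<open>Test functions are scalar, so \<open>A\<close> is split into its matrix entries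
  \<open>A x e \<bullet> f\<close> with respect to the standard bases; each entry times \<open>\<phi>\<close> is an admissible test
  function. Then the entries are reassembled.\<close>

lemma weak_product_rule:
  fixes u :: "real^'n \<Rightarrow> 'e::euclidean_space" and A :: "real^'n \<Rightarrow> ('e \<Rightarrow>\<^sub>L 'f::euclidean_space)"
  assumes \<Omega>: "open \<Omega>" and D: "has_weak_derivative \<Omega> u D" and A: "smooth_on A \<Omega>" and \<phi>: "test_function \<Omega> \<phi>"
  shows "(LINT x|lebesgue_on \<Omega>. \<phi> x *\<^sub>R A x (D x (axis j 1))) =
    - (LINT x|lebesgue_on \<Omega>. (frechet_derivative (\<lambda>y. \<phi> y *\<^sub>R A y) (at x) (axis j 1)) (u x))"
proof -
  have L: "L1_loc \<Omega> u" "L1_loc \<Omega> (\<lambda>x. D x (axis j 1))"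
    using D unfolding has_weak_derivative_def by (auto intro: L1_loc_bounded_linear[OF bounded_linear_blinfun_at])
  define P where "P e f = (\<lambda>T :: 'e \<Rightarrow>\<^sub>L 'f. T e \<bullet> f)" for e f
  have P: "bounded_linear (P e f)" for e f
    unfolding P_def by (rule bounded_linear_compose[OF bounded_linear_inner_left bounded_linear_blinfun_at])
  have expand: "T a = (\<Sum>f\<in>Basis. (\<Sum>e\<in>Basis. P e f T * (a \<bullet> e)) *\<^sub>R f)" for T :: "'e \<Rightarrow>\<^sub>L 'f" and a
  proof -
    have lin: "linear (blinfun_apply T)" by (rule bounded_linear.linear[OF blinfun.bounded_linear_right])
    have "T a = T (\<Sum>e\<in>Basis. (a \<bullet> e) *\<^sub>R e)" by (simp only: euclidean_representation)
    also have "\<dots> = (\<Sum>e\<in>Basis. (a \<bullet> e) *\<^sub>R T e)" by (simp add: linear_sum[OF lin] linear_scale[OF lin])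
    also have "\<dots> = (\<Sum>f\<in>Basis. ((\<Sum>e\<in>Basis. (a \<bullet> e) *\<^sub>R T e) \<bullet> f) *\<^sub>R f)" by (simp only: euclidean_representation)
    finally show ?thesis by (simp add: P_def inner_sum_left mult.commute)
  qed
  \<comment> \<open>The entry of \<open>A\<close> in row \<open>f\<close> and column \<open>e\<close>, times \<open>\<phi>\<close>.\<close>
  define \<psi> where "\<psi> e f = (\<lambda>x. if x \<in> \<Omega> then \<phi> x * P e f (A x) else 0)" for e f
  have aS: "smooth_on (\<lambda>x. P e f (A x)) \<Omega>" for e f
    using A unfolding smooth_on_def by (blast intro: Ck_on_bounded_linear[OF \<Omega> P])
  have \<psi>: "test_function \<Omega> (\<psi> e f)" for e f
    unfolding \<psi>_def by (rule smooth_test_product[OF \<Omega> \<phi> aS])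
  define Q where "Q = (\<lambda>y. \<phi> y *\<^sub>R A y)"
  have dQ: "(Q has_derivative frechet_derivative Q (at x)) (at x)" if "x \<in> \<Omega>" for x
  proof -
    have "smooth_on \<phi> UNIV" using \<phi> unfolding test_function_def by blast
    then have "\<phi> differentiable (at x)" by (rule smooth_on_differentiable) simp
    moreover have "A differentiable (at x)" by (rule smooth_on_differentiable[OF A that])
    ultimately show ?thesis unfolding Q_def by (intro has_derivative_frechet differentiable_scaleR)
  qed
  have p\<psi>: "partial j (\<psi> e f) x = P e f (partial j Q x)" if "x \<in> \<Omega>" for e f x
  proof -
    have "((\<lambda>y. P e f (Q y)) has_derivative (\<lambda>h. P e f (frechet_derivative Q (at x) h))) (at x)"
      by (rule bounded_linear.has_derivative[OF P dQ[OF that]])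
    then have "(\<psi> e f has_derivative (\<lambda>h. P e f (frechet_derivative Q (at x) h))) (at x)"
      by (rule has_derivative_transform_within_open[OF _ \<Omega> that])
        (simp add: \<psi>_def Q_def linear_scale[OF bounded_linear.linear[OF P]])
    then show ?thesis unfolding partial_def by (simp add: frechet_eq)
  qed
  have int1: "integrable (lebesgue_on \<Omega>) (\<lambda>x. \<psi> e f x *\<^sub>R D x (axis j 1))"
    and int2: "integrable (lebesgue_on \<Omega>) (\<lambda>x. partial j (\<psi> e f) x *\<^sub>R u x)" for e f
  proof -
    obtain K where K: "compact K" "K \<subseteq> \<Omega>" "\<forall>x. x \<notin> K \<longrightarrow> \<psi> e f x = 0"
      "\<And>j. \<forall>x. x \<notin> K \<longrightarrow> partial j (\<psi> e f) x = 0" "continuous_on UNIV (\<psi> e f)" "\<And>j. continuous_on UNIV (partial j (\<psi> e f))"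
      by (rule test_functionE[OF \<psi>]) blast
    show "integrable (lebesgue_on \<Omega>) (\<lambda>x. \<psi> e f x *\<^sub>R D x (axis j 1))" by (rule integrable_test[OF \<Omega> K(5,1,2,3) L(2)])
    show "integrable (lebesgue_on \<Omega>) (\<lambda>x. partial j (\<psi> e f) x *\<^sub>R u x)" by (rule integrable_test[OF \<Omega> K(6,1,2,4) L(1)])
  qed
  have sum: "(LINT x|lebesgue_on \<Omega>. (\<Sum>f\<in>Basis. (\<Sum>e\<in>Basis. g e f x \<bullet> e) *\<^sub>R f)) =
      (\<Sum>f\<in>Basis. (\<Sum>e\<in>Basis. (LINT x|lebesgue_on \<Omega>. g e f x) \<bullet> e) *\<^sub>R f)"
    if g: "\<And>e f. integrable (lebesgue_on \<Omega>) (g e f)" for g :: "'e \<Rightarrow> 'f \<Rightarrow> real^'n \<Rightarrow> 'e"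
  proof -
    have i: "integrable (lebesgue_on \<Omega>) (\<lambda>x. \<Sum>e\<in>Basis. g e f x \<bullet> e)" for f
      by (intro Bochner_Integration.integrable_sum integrable_inner_left g)
    have "(LINT x|lebesgue_on \<Omega>. (\<Sum>f\<in>Basis. (\<Sum>e\<in>Basis. g e f x \<bullet> e) *\<^sub>R f)) =
      (\<Sum>f\<in>Basis. LINT x|lebesgue_on \<Omega>. (\<Sum>e\<in>Basis. g e f x \<bullet> e) *\<^sub>R f)"
      by (intro Bochner_Integration.integral_sum integrable_scaleR_left i)
    also have "\<dots> = (\<Sum>f\<in>Basis. (LINT x|lebesgue_on \<Omega>. (\<Sum>e\<in>Basis. g e f x \<bullet> e)) *\<^sub>R f)"
      by (intro sum.cong refl integral_scaleR_left i)
    also have "\<dots> = (\<Sum>f\<in>Basis. (\<Sum>e\<in>Basis. LINT x|lebesgue_on \<Omega>. g e f x \<bullet> e) *\<^sub>R f)"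
      by (intro sum.cong refl arg_cong2[where f=scaleR] Bochner_Integration.integral_sum integrable_inner_left g)
    also have "\<dots> = (\<Sum>f\<in>Basis. (\<Sum>e\<in>Basis. (LINT x|lebesgue_on \<Omega>. g e f x) \<bullet> e) *\<^sub>R f)"
      by (intro sum.cong refl arg_cong2[where f=scaleR] integral_inner_left g)
    finally show ?thesis .
  qed
  have sp: "x \<in> \<Omega>" if "x \<in> space (lebesgue_on \<Omega>)" for x using that by (simp add: space_restrict_space)
  have "(LINT x|lebesgue_on \<Omega>. \<phi> x *\<^sub>R A x (D x (axis j 1))) =
    (LINT x|lebesgue_on \<Omega>. (\<Sum>f\<in>Basis. (\<Sum>e\<in>Basis. (\<psi> e f x *\<^sub>R D x (axis j 1)) \<bullet> e) *\<^sub>R f))"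
  proof (rule Bochner_Integration.integral_cong[OF refl])
    fix x assume "x \<in> space (lebesgue_on \<Omega>)"
    then have "x \<in> \<Omega>" by (rule sp)
    then show "\<phi> x *\<^sub>R A x (D x (axis j 1)) = (\<Sum>f\<in>Basis. (\<Sum>e\<in>Basis. (\<psi> e f x *\<^sub>R D x (axis j 1)) \<bullet> e) *\<^sub>R f)"
      by (subst expand) (simp add: \<psi>_def scaleR_sum_right sum_distrib_left mult.assoc)
  qed
  also have "\<dots> = (\<Sum>f\<in>Basis. (\<Sum>e\<in>Basis. (LINT x|lebesgue_on \<Omega>. \<psi> e f x *\<^sub>R D x (axis j 1)) \<bullet> e) *\<^sub>R f)"
    by (rule sum[OF int1])
  also have "\<dots> = (\<Sum>f\<in>Basis. (\<Sum>e\<in>Basis. (- (LINT x|lebesgue_on \<Omega>. partial j (\<psi> e f) x *\<^sub>R u x)) \<bullet> e) *\<^sub>R f)"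
    by (simp add: has_weak_derivative_partial[OF D \<psi>])
  also have "\<dots> = - (\<Sum>f\<in>Basis. (\<Sum>e\<in>Basis. (LINT x|lebesgue_on \<Omega>. partial j (\<psi> e f) x *\<^sub>R u x) \<bullet> e) *\<^sub>R f)"
    by (simp add: sum_negf)
  also have "(\<Sum>f\<in>Basis. (\<Sum>e\<in>Basis. (LINT x|lebesgue_on \<Omega>. partial j (\<psi> e f) x *\<^sub>R u x) \<bullet> e) *\<^sub>R f) =
    (LINT x|lebesgue_on \<Omega>. (\<Sum>f\<in>Basis. (\<Sum>e\<in>Basis. (partial j (\<psi> e f) x *\<^sub>R u x) \<bullet> e) *\<^sub>R f))"
    by (rule sum[OF int2, symmetric])
  also have "\<dots> = (LINT x|lebesgue_on \<Omega>. partial j Q x (u x))"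
  proof (rule Bochner_Integration.integral_cong[OF refl])
    fix x assume "x \<in> space (lebesgue_on \<Omega>)"
    then have x: "x \<in> \<Omega>" by (rule sp)
    show "(\<Sum>f\<in>Basis. (\<Sum>e\<in>Basis. (partial j (\<psi> e f) x *\<^sub>R u x) \<bullet> e) *\<^sub>R f) = partial j Q x (u x)"
      unfolding expand[of "partial j Q x"] by (simp add: p\<psi>[OF x])
  qed
  finally show ?thesis unfolding Q_def partial_def .
qed

lemma L1_loc_add:
  fixes f g :: "real^'n \<Rightarrow> 'b::{banach, second_countable_topology}"
  shows "L1_loc \<Omega> f \<Longrightarrow> L1_loc \<Omega> g \<Longrightarrow> L1_loc \<Omega> (\<lambda>x. f x + g x)"
  unfolding L1_loc_iff by (blast intro: Bochner_Integration.integrable_add)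

lemma L1_loc_sum:
  fixes f :: "'i \<Rightarrow> real^'n \<Rightarrow> 'b::{banach, second_countable_topology}"
  assumes "\<And>i. i \<in> I \<Longrightarrow> L1_loc \<Omega> (f i)"
  shows "L1_loc \<Omega> (\<lambda>x. \<Sum>i\<in>I. f i x)"
  using assms unfolding L1_loc_iff by (intro allI impI Bochner_Integration.integrable_sum) blast

lemma has_weak_image_first_order:
  fixes u :: "real^'n \<Rightarrow> 'e::euclidean_space"
    and A :: "'n \<Rightarrow> real^'n \<Rightarrow> ('e \<Rightarrow>\<^sub>L 'f::euclidean_space)"
  assumes \<Omega>: "open \<Omega>" and D: "has_weak_derivative \<Omega> u D"
    and A: "\<And>j. smooth_on (A j) \<Omega>" and B: "smooth_on B \<Omega>"
  shows "has_weak_image \<Omega> A B u (\<lambda>x. (\<Sum>j\<in>UNIV. A j x (D x (axis j 1))) + B x (u x))"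
  unfolding has_weak_image_def
proof (intro conjI allI impI)
  have "L1_loc \<Omega> D" and Lu: "L1_loc \<Omega> u" using D unfolding has_weak_derivative_def by blast+
  then have "L1_loc \<Omega> (\<lambda>x. D x (axis j 1))" for j by (intro L1_loc_bounded_linear[OF bounded_linear_blinfun_at])
  then have LA: "L1_loc \<Omega> (\<lambda>x. A j x (D x (axis j 1)))" for j
    by (rule L1_loc_blinfun_apply[OF _ smooth_imp_continuous[OF A]])
  have LB: "L1_loc \<Omega> (\<lambda>x. B x (u x))" by (rule L1_loc_blinfun_apply[OF Lu smooth_imp_continuous[OF B]])
  show "L1_loc \<Omega> (\<lambda>x. (\<Sum>j\<in>UNIV. A j x (D x (axis j 1))) + B x (u x))" by (intro L1_loc_add L1_loc_sum LA LB)
  fix \<phi> assume \<phi>: "test_function \<Omega> \<phi>"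
  obtain K where K: "compact K" "K \<subseteq> \<Omega>" "\<forall>x. x \<notin> K \<longrightarrow> \<phi> x = 0" "continuous_on UNIV \<phi>"
    by (rule test_functionE[OF \<phi>]) blast
  note i = integrable_test[OF \<Omega> K(4,1,2,3)]
  have "(LINT x|lebesgue_on \<Omega>. \<phi> x *\<^sub>R ((\<Sum>j\<in>UNIV. A j x (D x (axis j 1))) + B x (u x))) =
    (LINT x|lebesgue_on \<Omega>. (\<Sum>j\<in>UNIV. \<phi> x *\<^sub>R A j x (D x (axis j 1))) + \<phi> x *\<^sub>R B x (u x))"
    by (simp add: scaleR_add_right scaleR_sum_right)
  also have "\<dots> = (LINT x|lebesgue_on \<Omega>. (\<Sum>j\<in>UNIV. \<phi> x *\<^sub>R A j x (D x (axis j 1)))) + (LINT x|lebesgue_on \<Omega>. \<phi> x *\<^sub>R B x (u x))"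
    by (intro Bochner_Integration.integral_add Bochner_Integration.integrable_sum i LA LB)
  also have "(LINT x|lebesgue_on \<Omega>. (\<Sum>j\<in>UNIV. \<phi> x *\<^sub>R A j x (D x (axis j 1)))) = (\<Sum>j\<in>UNIV. LINT x|lebesgue_on \<Omega>. \<phi> x *\<^sub>R A j x (D x (axis j 1)))"
    by (intro Bochner_Integration.integral_sum i LA)
  also have "\<dots> = - (\<Sum>j\<in>UNIV. LINT x|lebesgue_on \<Omega>. (frechet_derivative (\<lambda>y. \<phi> y *\<^sub>R A j y) (at x) (axis j 1)) (u x))"
    by (simp add: weak_product_rule[OF \<Omega> D A \<phi>] sum_negf)
  finally show "(LINT x|lebesgue_on \<Omega>. \<phi> x *\<^sub>R ((\<Sum>j\<in>UNIV. A j x (D x (axis j 1))) + B x (u x))) =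
    - (\<Sum>j\<in>UNIV. LINT x|lebesgue_on \<Omega>. (frechet_derivative (\<lambda>y. \<phi> y *\<^sub>R A j y) (at x) (axis j 1)) (u x)) +
    (LINT x|lebesgue_on \<Omega>. \<phi> x *\<^sub>R B x (u x))" .
qed

lemma has_weak_image_unique:
  fixes u :: "real^'n \<Rightarrow> 'e::euclidean_space" and f g :: "real^'n \<Rightarrow> 'f::euclidean_space"
  assumes \<Omega>: "open \<Omega>" and f: "has_weak_image \<Omega> A B u f" and g: "has_weak_image \<Omega> A B u g"
  shows "AE x in lebesgue_on \<Omega>. f x = g x"
proof -
  have L: "L1_loc \<Omega> f" "L1_loc \<Omega> g" using f g unfolding has_weak_image_def by blast+
  have "AE x in lebesgue_on \<Omega>. f x - g x = 0"
  proof (rule fundamental_lemma[OF \<Omega> L1_loc_diff[OF L]])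
    fix \<phi> assume \<phi>: "test_function \<Omega> \<phi>"
    obtain K where K: "compact K" "K \<subseteq> \<Omega>" "\<forall>x. x \<notin> K \<longrightarrow> \<phi> x = 0" "continuous_on UNIV \<phi>"
      by (rule test_functionE[OF \<phi>]) blast
    have "(LINT x|lebesgue_on \<Omega>. \<phi> x *\<^sub>R (f x - g x)) = (LINT x|lebesgue_on \<Omega>. \<phi> x *\<^sub>R f x) - (LINT x|lebesgue_on \<Omega>. \<phi> x *\<^sub>R g x)"
      unfolding scaleR_diff_right by (intro Bochner_Integration.integral_diff integrable_test[OF \<Omega> K(4,1,2,3)] L)
    also have "\<dots> = 0" using f g \<phi> unfolding has_weak_image_def by simp
    finally show "(LINT x|lebesgue_on \<Omega>. \<phi> x *\<^sub>R (f x - g x)) = 0" .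
  qed
  then show ?thesis by eventually_elim simp
qed

lemma op_symbol_axis: "op_symbol A x (axis j 1) = A j x"
proof -
  have "op_symbol A x (axis j 1) = (\<Sum>i\<in>UNIV. if i = j then A i x else 0)"
    unfolding op_symbol_def by (intro sum.cong) (auto simp: axis_def)
  then show ?thesis by simp
qed

theorem theorem6p2:
  fixes \<Omega> :: "(real^'n) set" and p :: real
    and u :: "real^'n \<Rightarrow> 'e::euclidean_space"
    and Du :: "real^'n \<Rightarrow> ((real^'n) \<Rightarrow>\<^sub>L 'e)"
  assumes "open \<Omega>" and "connected \<Omega>" and "\<Omega> \<noteq> {}"
    and "1 \<le> p"
    and "sobolev1 p \<Omega> u"
    and "has_weak_derivative \<Omega> u Du"
  shows "(AE x in lebesgue_on \<Omega>. has_harmonic_differential u x (Du x)) \<and>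
    (AE x in lebesgue_on \<Omega>. ((\<lambda>\<epsilon>. sphere_difference_mean u \<epsilon> x) \<longlongrightarrow> Du x) (at_right 0)) \<and>
    tendsto_Lp_loc p \<Omega> (sphere_difference_mean u) Du (at_right 0) \<and>
    (\<forall>(A :: 'n \<Rightarrow> real^'n \<Rightarrow> ('e \<Rightarrow>\<^sub>L 'f::euclidean_space)) B.
      elliptic_operator \<Omega> A B \<longrightarrow>
        (\<exists>f. has_weak_image \<Omega> A B u f) \<and>
        (\<forall>f. has_weak_image \<Omega> A B u f \<longrightarrow>
          (AE x in lebesgue_on \<Omega>.
            f x = (\<Sum>j\<in>UNIV. op_symbol A x (axis j 1) (Du x (axis j 1))) + B x (u x))))"
proof (intro conjI allI impI)
  note \<Omega> = assms(1) and D = assms(6)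
  show "AE x in lebesgue_on \<Omega>. has_harmonic_differential u x (Du x)"
    "AE x in lebesgue_on \<Omega>. ((\<lambda>\<epsilon>. sphere_difference_mean u \<epsilon> x) \<longlongrightarrow> Du x) (at_right 0)"
    using spherical_mean_AE[OF \<Omega> D] by (eventually_elim, blast)+
  show "tendsto_Lp_loc p \<Omega> (sphere_difference_mean u) Du (at_right 0)"
    by (rule spherical_mean_Lp[OF \<Omega> assms(4,5) D])
next
  fix A :: "'n \<Rightarrow> real^'n \<Rightarrow> ('e \<Rightarrow>\<^sub>L 'f)" and B
  assume "elliptic_operator \<Omega> A B"
  then have sm: "smooth_on (A j) \<Omega>" "smooth_on B \<Omega>" for j unfolding elliptic_operator_def by blast+
  have image: "has_weak_image \<Omega> A B u (\<lambda>x. (\<Sum>j\<in>UNIV. op_symbol A x (axis j 1) (Du x (axis j 1))) + B x (u x))"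
    unfolding op_symbol_axis by (rule has_weak_image_first_order[OF assms(1,6) sm])
  then show "\<exists>f. has_weak_image \<Omega> A B u f" by blast
  fix f assume "has_weak_image \<Omega> A B u f"
  then show "AE x in lebesgue_on \<Omega>. f x = (\<Sum>j\<in>UNIV. op_symbol A x (axis j 1) (Du x (axis j 1))) + B x (u x)"
    by (rule has_weak_image_unique[OF assms(1) _ image])
qed

end
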